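(* Let $(V_n,g)$ be a smooth pseudo-Riemannian manifold of dimension $n=r+s$ whose metric has signature $(r,s)$ ($r$ positive and $s$ negative directions), and let $(V_D,\eta)$ be the pseudo-Euclidean space of dimension $D=p+q$ with flat metric $\eta$ of signature $(p,q)$, where $p\ge r$ and $q\ge s$. Fix signs $\epsilon_A\in\{+1,-1\}$, $A=n+1,\dots,D$, of which exactly $p-r$ equal $+1$ and $q-s$ equal $-1$, and put $g_{AB}=\epsilon_A\delta_{AB}$, with inverse $g^{AB}=\epsilon_A\delta_{AB}$ (no sum). Then the following are equivalent. (1) $(V_n,g)$ is locally and isometrically immersed in $(V_D,\eta)$: every point of $V_n$ has an open neighbourhood $U$ admitting a smooth immersion $Y:U\to V_D$ with $Y^*\eta=g|_U$. (2) Every point of $V_n$ has a coordinate neighbourhood with coordinates $x^1,\dots,x^n$ on which there exist $D-n$ smooth symmetric covariant $2$-tensor fields with components $b_{ijA}=b_{jiA}$ ($A=n+1,\dots,D$; $1\le i,j\le n$), and $\binom{D-n}{2}$ smooth covector fields with components $A_{iAB}=-A_{iBA}$ ($n+1\le A,B\le D$), satisfying the Gauss, Codazzi and Ricci equations, for all values of the free indices: $$R_{hijk}=g^{AB}\left(b_{ikA}\,b_{jhB}-b_{ijA}\,b_{khB}\right),$$ $$b_{ijC;k}-b_{ikC;j}=g^{AB}\left(b_{ikA}A_{jBC}-b_{ijA}A_{kBC}\right),$$ $$A_{jAB;k}-A_{kAB;j}=g^{MN}\left(A_{kAM}A_{jNB}-A_{jAM}A_{kNB}\right)+g^{ml}\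left(b_{jmA}\,b_{lkB}-b_{kmA}\,b_{ljB}\right).$$
   Context: Repeated indices are summed. Lower-case Latin indices $h,i,j,k,l,m$ run over $1,\dots,n$ (tangent indices). Capital indices $A,B,C,M,N$ run over $n+1,\dots,D$ (normal indices, one for each direction of an orthonormal frame of the normal space); they are lowered and raised with $g_{AB}=\epsilon_A\delta_{AB}$ and its inverse $g^{AB}$. The matrix $g^{ml}$ is the inverse of $g_{ml}$. A comma denotes partial differentiation with respect to the coordinates $x^i$. A semicolon denotes covariant differentiation with respect to the Levi-Civita connection of $g$ (Christoffel symbols $\Gamma^k_{ij}$), acting only on the lower-case indices: for each fixed $C$, $b_{ijC}$ is treated as a covariant $2$-tensor, and for each fixed pair $A,B$, $A_{iAB}$ is treated as a covector. Curvature convention: $R_{hijk}=g_{hl}R^l{}_{ijk}$ with $$R^l{}_{ijk}=\partial_k\Gamma^l_{ij}-\partial_j\Gamma^l_{ik}+\Gamma^l_{km}\Gamma^m_{ij}-\Gamma^l_{jm}\Gamma^m_{ik}.$$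
   Formalization: The curvature R^l_{ijk} is taken with the opposite overall sign to the stated convention, since with the stated sign the Gauss equation fails for immersed manifolds (for the unit 3-sphere in Euclidean 4-space it would force (det b)^2 = -1). *)

theory Defs
  imports "HOL-Analysis.Analysis"
begin

section \<open>Smooth maps between open subsets of Euclidean spaces\<close>

text \<open>These notions are only meant for open sets \<open>S\<close>: derivatives are taken at points of the
  ambient space, not within \<open>S\<close>.\<close>

primrec Ck_on :: "nat \<Rightarrow> ('a::real_normed_vector \<Rightarrow> 'b::real_normed_vector) \<Rightarrow> 'a set \<Rightarrow> bool" where
  "Ck_on 0 f S \<longleftrightarrow> continuous_on S f"
| "Ck_on (Suc k) f S \<longleftrightarrow>
     (\<forall>x\<in>S. f differentiable (at x)) \<and> (\<forall>v. Ck_on k (\<lambda>x. frechet_derivative f (at x) v) S)"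

definition smooth_on :: "('a::real_normed_vector \<Rightarrow> 'b::real_normed_vector) \<Rightarrow> 'a set \<Rightarrow> bool" where
  "smooth_on f S \<longleftrightarrow> (\<forall>k. Ck_on k f S)"

definition partial :: "'n::finite \<Rightarrow> (real^'n \<Rightarrow> 'b::real_normed_vector) \<Rightarrow> real^'n \<Rightarrow> 'b" where
  "partial i f x = frechet_derivative f (at x) (axis i 1)"


section \<open>Smooth manifolds\<close>

type_synonym ('a, 'n) chart = "'a set \<times> ('a \<Rightarrow> real^'n)"

definition coord_range :: "('a, 'n::finite) chart \<Rightarrow> (real^'n) set" where
  "coord_range c = snd c ` fst c"

text \<open>\<open>f\<close> expressed in the coordinates of the chart \<open>c\<close>.\<close>
definition in_coords :: "('a, 'n::finite) chart \<Rightarrow> ('a \<Rightarrow> 'b) \<Rightarrow> real^'n \<Rightarrow> 'b" where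
  "in_coords c f = f \<circ> inv_into (fst c) (snd c)"

abbreviation transition :: "('a, 'n::finite) chart \<Rightarrow> ('a, 'n) chart \<Rightarrow> real^'n \<Rightarrow> real^'n" where
  "transition c c' \<equiv> in_coords c (snd c')"

definition is_chart :: "'a topology \<Rightarrow> ('a, 'n::finite) chart \<Rightarrow> bool" where
  "is_chart X c \<longleftrightarrow> openin X (fst c) \<and> open (coord_range c) \<and>
     homeomorphic_map (subtopology X (fst c)) (top_of_set (coord_range c)) (snd c)"

definition smoothly_compatible :: "('a, 'n::finite) chart \<Rightarrow> ('a, 'n) chart \<Rightarrow> bool" where
  "smoothly_compatible c c' \<longleftrightarrow>
     smooth_on (transition c c') (snd c ` (fst c \<inter> fst c')) \<and>
     smooth_on (transition c' c) (snd c' ` (fst c \<inter> fst c'))"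

text \<open>\<open>\<A>\<close> is the maximal atlas; its members are exactly the coordinate systems of the manifold.
  The dimension is \<open>CARD('n)\<close>.\<close>
definition smooth_manifold :: "'a topology \<Rightarrow> ('a, 'n::finite) chart set \<Rightarrow> bool" where
  "smooth_manifold X \<A> \<longleftrightarrow>
     Hausdorff_space X \<and> second_countable X \<and>
     (\<forall>c\<in>\<A>. is_chart X c) \<and> (\<Union>c\<in>\<A>. fst c) = topspace X \<and>
     (\<forall>c\<in>\<A>. \<forall>c'\<in>\<A>. smoothly_compatible c c') \<and>
     (\<forall>c. is_chart X c \<and> (\<forall>c'\<in>\<A>. smoothly_compatible c c') \<longrightarrow> c \<in> \<A>)"


section \<open>Pseudo-Riemannian metrics\<close>

text \<open>There is a \<open>G\<close>-orthonormal basis \<open>e\<close> with \<open>r\<close> positive and \<open>s\<close> negative directions;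
  linear independence of \<open>e\<close> is implied by its orthonormality.\<close>
definition has_signature :: "real^'n^'n \<Rightarrow> nat \<Rightarrow> nat \<Rightarrow> bool" where
  "has_signature G r s \<longleftrightarrow>
     (\<exists>(e :: 'n::finite \<Rightarrow> real^'n) (\<sigma> :: 'n \<Rightarrow> real).
        (\<forall>i. \<sigma> i = 1 \<or> \<sigma> i = -1) \<and> card {i. \<sigma> i = 1} = r \<and> card {i. \<sigma> i = -1} = s \<and>
        (\<forall>i j. e i \<bullet> (G *v e j) = (if i = j then \<sigma> i else 0)))"

text \<open>A metric is given by its component matrices \<open>g c x\<close> in every coordinate system \<open>c\<close>, subject
  to the transformation law of covariant 2-tensors. The argument \<open>x\<close> is a coordinate vector in
  \<open>coord_range c\<close>, not a point of the manifold.\<close>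
definition pseudo_riemannian_metric ::
  "('a, 'n::finite) chart set \<Rightarrow> (('a, 'n) chart \<Rightarrow> real^'n \<Rightarrow> real^'n^'n) \<Rightarrow> nat \<Rightarrow> nat \<Rightarrow> bool" where
  "pseudo_riemannian_metric \<A> g r s \<longleftrightarrow>
     (\<forall>c\<in>\<A>. smooth_on (g c) (coord_range c) \<and>
        (\<forall>x\<in>coord_range c. transpose (g c x) = g c x \<and> has_signature (g c x) r s)) \<and>
     (\<forall>c\<in>\<A>. \<forall>c'\<in>\<A>. \<forall>x\<in>snd c ` (fst c \<inter> fst c'). \<forall>i j.
        g c x $ i $ j = (\<Sum>k\<in>UNIV. \<Sum>l\<in>UNIV. g c' (transition c c' x) $ k $ l *
            partial i (transition c c') x $ k * partial j (transition c c') x $ l))"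


section \<open>Local isometric immersions into a pseudo-Euclidean space\<close>

definition smooth_immersion ::
  "('a, 'n::finite) chart set \<Rightarrow> 'a set \<Rightarrow> ('a \<Rightarrow> real^'d) \<Rightarrow> bool" where
  "smooth_immersion \<A> U Y \<longleftrightarrow>
     (\<forall>c\<in>\<A>. smooth_on (in_coords c Y) (snd c ` (fst c \<inter> U)) \<and>
        (\<forall>x\<in>snd c ` (fst c \<inter> U). inj (frechet_derivative (in_coords c Y) (at x))))"

text \<open>\<open>Y\<^sup>*\<eta> = g\<close> on \<open>U\<close>, where \<open>\<eta>\<close> is the constant matrix of the flat metric.\<close>
definition pullback_metric_eq ::
  "('a, 'n::finite) chart set \<Rightarrow> (('a, 'n) chart \<Rightarrow> real^'n \<Rightarrow> real^'n^'n) \<Rightarrow> real^'d^'d \<Rightarrow>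
   'a set \<Rightarrow> ('a \<Rightarrow> real^'d) \<Rightarrow> bool" where
  "pullback_metric_eq \<A> g \<eta> U Y \<longleftrightarrow>
     (\<forall>c\<in>\<A>. \<forall>x\<in>snd c ` (fst c \<inter> U). \<forall>i j.
        partial i (in_coords c Y) x \<bullet> (\<eta> *v partial j (in_coords c Y) x) = g c x $ i $ j)"

definition locally_isometrically_immersed ::
  "'a topology \<Rightarrow> ('a, 'n::finite) chart set \<Rightarrow> (('a, 'n) chart \<Rightarrow> real^'n \<Rightarrow> real^'n^'n) \<Rightarrow>
   real^'d^'d \<Rightarrow> bool" where
  "locally_isometrically_immersed X \<A> g \<eta> \<longleftrightarrow>
     (\<forall>P\<in>topspace X. \<exists>U Y. openin X U \<and> P \<in> U \<and>
        smooth_immersion \<A> U Y \<and> pullback_metric_eq \<A> g \<eta> U Y)"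


section \<open>Levi-Civita connection and curvature in a coordinate system\<close>

text \<open>In this section \<open>G\<close> is the component matrix of the metric as a function of the coordinates.\<close>

definition metric_inv :: "(real^'n \<Rightarrow> real^'n^'n) \<Rightarrow> 'n::finite \<Rightarrow> 'n \<Rightarrow> real^'n \<Rightarrow> real" where
  "metric_inv G k l x = matrix_inv (G x) $ k $ l"

text \<open>\<open>christoffel G k i j\<close> has the upper index \<open>k\<close> and the lower indices \<open>i j\<close>.\<close>
definition christoffel :: "(real^'n \<Rightarrow> real^'n^'n) \<Rightarrow> 'n::finite \<Rightarrow> 'n \<Rightarrow> 'n \<Rightarrow> real^'n \<Rightarrow> real" where
  "christoffel G k i j x = (\<Sum>l\<in>UNIV. metric_inv G k l x / 2 *
     (partial i (\<lambda>y. G y $ l $ j) x + partial j (\<lambda>y. G y $ l $ i) x - partial l (\<lambda>y. G y $ i $ j) x))"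

text \<open>\<open>curvature G l i j k\<close> is \<open>R\<^sup>l\<^sub>i\<^sub>j\<^sub>k\<close>, normalised as
  \<open>\<partial>\<^sub>j \<Gamma>\<^sup>l\<^sub>i\<^sub>k - \<partial>\<^sub>k \<Gamma>\<^sup>l\<^sub>i\<^sub>j + \<Gamma>\<^sup>l\<^sub>j\<^sub>m \<Gamma>\<^sup>m\<^sub>i\<^sub>k - \<Gamma>\<^sup>l\<^sub>k\<^sub>m \<Gamma>\<^sup>m\<^sub>i\<^sub>j\<close>, so that \<open>R(\<partial>\<^sub>j, \<partial>\<^sub>k) \<partial>\<^sub>i = R\<^sup>l\<^sub>i\<^sub>j\<^sub>k \<partial>\<^sub>l\<close> and
  the unit sphere has \<open>R\<^sub>h\<^sub>i\<^sub>j\<^sub>k = g\<^sub>h\<^sub>j g\<^sub>i\<^sub>k - g\<^sub>h\<^sub>k g\<^sub>i\<^sub>j\<close>. The source prints the opposite overall sign for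
  \<open>R\<^sup>l\<^sub>i\<^sub>j\<^sub>k\<close>, which is incompatible with its Gauss equation
  \<open>R\<^sub>h\<^sub>i\<^sub>j\<^sub>k = g\<^sup>A\<^sup>B (b\<^sub>i\<^sub>k\<^sub>A b\<^sub>j\<^sub>h\<^sub>B - b\<^sub>i\<^sub>j\<^sub>A b\<^sub>k\<^sub>h\<^sub>B)\<close>: for the unit 3-sphere in Euclidean 4-space,
  the 2-by-2 minors of \<open>b\<close> in an orthonormal frame would then form minus the identity matrix, whence
  \<open>(det b)\<^sup>2 = -1\<close>. The equation is kept as printed and the sign of the curvature is changed.\<close>
definition curvature :: "(real^'n \<Rightarrow> real^'n^'n) \<Rightarrow> 'n::finite \<Rightarrow> 'n \<Rightarrow> 'n \<Rightarrow> 'n \<Rightarrow> real^'n \<Rightarrow> real" where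
  "curvature G l i j k x =
     partial j (christoffel G l i k) x - partial k (christoffel G l i j) x
     + (\<Sum>m\<in>UNIV. christoffel G l j m x * christoffel G m i k x)
     - (\<Sum>m\<in>UNIV. christoffel G l k m x * christoffel G m i j x)"

definition curvature_low :: "(real^'n \<Rightarrow> real^'n^'n) \<Rightarrow> 'n::finite \<Rightarrow> 'n \<Rightarrow> 'n \<Rightarrow> 'n \<Rightarrow> real^'n \<Rightarrow> real" where
  "curvature_low G h i j k x = (\<Sum>l\<in>UNIV. G x $ h $ l * curvature G l i j k x)"

text \<open>In both covariant derivatives the last index \<open>k\<close> is the direction of differentiation.\<close>

definition cov_deriv1 ::
  "(real^'n \<Rightarrow> real^'n^'n) \<Rightarrow> ('n \<Rightarrow> real^'n \<Rightarrow> real) \<Rightarrow> 'n::finite \<Rightarrow> 'n \<Rightarrow> real^'n \<Rightarrow> real" where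
  "cov_deriv1 G a j k x = partial k (a j) x - (\<Sum>m\<in>UNIV. christoffel G m j k x * a m x)"

definition cov_deriv2 ::
  "(real^'n \<Rightarrow> real^'n^'n) \<Rightarrow> ('n \<Rightarrow> 'n \<Rightarrow> real^'n \<Rightarrow> real) \<Rightarrow> 'n::finite \<Rightarrow> 'n \<Rightarrow> 'n \<Rightarrow> real^'n \<Rightarrow> real" where
  "cov_deriv2 G b i j k x = partial k (b i j) x
     - (\<Sum>m\<in>UNIV. christoffel G m i k x * b m j x)
     - (\<Sum>m\<in>UNIV. christoffel G m j k x * b i m x)"


section \<open>The Gauss, Codazzi and Ricci equations\<close>

text \<open>Normal indices are the elements of a finite set \<open>N\<close> of natural numbers, which may be empty.
  \<open>b i j A x\<close> and \<open>a i A B x\<close> are the components of the tensor and covector fields.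
  Since \<open>g\<^sub>A\<^sub>B = \<epsilon>\<^sub>A \<delta>\<^sub>A\<^sub>B\<close> with \<open>\<epsilon>\<^sub>A = \<plusminus>1\<close>, the matrix below is its inverse \<open>g\<^sup>A\<^sup>B\<close>.\<close>

definition normal_metric_inv :: "(nat \<Rightarrow> real) \<Rightarrow> nat \<Rightarrow> nat \<Rightarrow> real" where
  "normal_metric_inv \<epsilon> A B = (if A = B then \<epsilon> A else 0)"

definition gauss_equation ::
  "nat set \<Rightarrow> (nat \<Rightarrow> real) \<Rightarrow> (real^'n \<Rightarrow> real^'n^'n) \<Rightarrow>
   ('n::finite \<Rightarrow> 'n \<Rightarrow> nat \<Rightarrow> real^'n \<Rightarrow> real) \<Rightarrow> real^'n \<Rightarrow> bool" where
  "gauss_equation N \<epsilon> G b x \<longleftrightarrow>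
     (\<forall>h i j k. curvature_low G h i j k x =
        (\<Sum>A\<in>N. \<Sum>B\<in>N. normal_metric_inv \<epsilon> A B *
           (b i k A x * b j h B x - b i j A x * b k h B x)))"

definition codazzi_equation ::
  "nat set \<Rightarrow> (nat \<Rightarrow> real) \<Rightarrow> (real^'n \<Rightarrow> real^'n^'n) \<Rightarrow>
   ('n::finite \<Rightarrow> 'n \<Rightarrow> nat \<Rightarrow> real^'n \<Rightarrow> real) \<Rightarrow> ('n \<Rightarrow> nat \<Rightarrow> nat \<Rightarrow> real^'n \<Rightarrow> real) \<Rightarrow>
   real^'n \<Rightarrow> bool" where
  "codazzi_equation N \<epsilon> G b a x \<longleftrightarrow>
     (\<forall>i j k. \<forall>C\<in>N.
        cov_deriv2 G (\<lambda>i j. b i j C) i j k x - cov_deriv2 G (\<lambda>i j. b i j C) i k j x =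
        (\<Sum>A\<in>N. \<Sum>B\<in>N. normal_metric_inv \<epsilon> A B *
           (b i k A x * a j B C x - b i j A x * a k B C x)))"

definition ricci_equation ::
  "nat set \<Rightarrow> (nat \<Rightarrow> real) \<Rightarrow> (real^'n \<Rightarrow> real^'n^'n) \<Rightarrow>
   ('n::finite \<Rightarrow> 'n \<Rightarrow> nat \<Rightarrow> real^'n \<Rightarrow> real) \<Rightarrow> ('n \<Rightarrow> nat \<Rightarrow> nat \<Rightarrow> real^'n \<Rightarrow> real) \<Rightarrow>
   real^'n \<Rightarrow> bool" where
  "ricci_equation N \<epsilon> G b a x \<longleftrightarrow>
     (\<forall>j k. \<forall>A\<in>N. \<forall>B\<in>N.
        cov_deriv1 G (\<lambda>j. a j A B) j k x - cov_deriv1 G (\<lambda>j. a j A B) k j x =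
        (\<Sum>M\<in>N. \<Sum>L\<in>N. normal_metric_inv \<epsilon> M L *
           (a k A M x * a j L B x - a j A M x * a k L B x))
        + (\<Sum>m\<in>UNIV. \<Sum>l\<in>UNIV. metric_inv G m l x *
           (b j m A x * b l k B x - b k m A x * b l j B x)))"

definition locally_gauss_codazzi_ricci ::
  "'a topology \<Rightarrow> ('a, 'n::finite) chart set \<Rightarrow> (('a, 'n) chart \<Rightarrow> real^'n \<Rightarrow> real^'n^'n) \<Rightarrow>
   nat set \<Rightarrow> (nat \<Rightarrow> real) \<Rightarrow> bool" where
  "locally_gauss_codazzi_ricci X \<A> g N \<epsilon> \<longleftrightarrow>
     (\<forall>P\<in>topspace X. \<exists>c\<in>\<A>. P \<in> fst c \<and>
        (\<exists>(b :: 'n \<Rightarrow> 'n \<Rightarrow> nat \<Rightarrow> real^'n \<Rightarrow> real) (a :: 'n \<Rightarrow> nat \<Rightarrow> nat \<Rightarrow> real^'n \<Rightarrow> real).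
           (\<forall>i j. \<forall>A\<in>N. smooth_on (b i j A) (coord_range c)) \<and>
           (\<forall>i. \<forall>A\<in>N. \<forall>B\<in>N. smooth_on (a i A B) (coord_range c)) \<and>
           (\<forall>x\<in>coord_range c.
              (\<forall>i j. \<forall>A\<in>N. b i j A x = b j i A x) \<and>
              (\<forall>i. \<forall>A\<in>N. \<forall>B\<in>N. a i A B x = - a i B A x) \<and>
              gauss_equation N \<epsilon> (g c) b x \<and>
              codazzi_equation N \<epsilon> (g c) b a x \<and>
              ricci_equation N \<epsilon> (g c) b a x)))"

end

(* Necessity: near a point, choose an orthonormal frame of the normal bundle by Gram-Schmidt. The tangent
   vectors e_i = d_i Y together with this frame span the ambient space at each point, so for frame fields
   X, Z the identity d_j <d_k X, Z> - d_k <d_j X, Z> = <d_k X, d_j Z> - <d_j X, d_k Z>, expanded in the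
   frame, is the Gauss, Codazzi or Ricci equation according to whether X and Z are tangent or normal.

   Sufficiency: the unknown frame E and the immersion Y solve the linear total differential system
   d_i Y = E_i, d_i E = Om_i E. Multiplied by the Gram matrix H = diag(g, eps), its integrability condition
   becomes exactly the three equations, so it is solvable with any initial value. With a start frame of
   Gram matrix H, the difference of the Gram matrix of E and H satisfies a homogeneous linear system with
   initial value 0, hence vanishes, and Y is isometric.

   A flat linear system du = A u is solved on a small ball by Picard iteration of the integral equation
   along rays; flatness makes the defect du - A u satisfy a homogeneous contraction, hence vanish. *)
theory Submission
  imports Defs
begin

section \<open>Calculus of smooth maps\<close>

text \<open>The integral equation along rays is solvable whether or not the system is flat, and its
  solution already satisfies the system in the radial direction. Flatness concerns the transverse
  directions, so the iteration must control the derivative in every direction; values and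
  derivatives are iterated as pairs. Smoothness is then read off from the equation. Indefinite
  signature is the second obstacle: a projected vector may be null. So each new normal vector is
  chosen at the base point with its prescribed sign, by a dimension count, and only then extended to
  a neighbourhood, where continuity preserves the sign of its square. The connection matrix contains
  the inverse metric. Multiplication by the Gram matrix lowers an index and leaves as entries the
  Christoffel symbols of the first kind, \<open>b\<close> and \<open>a\<close>, whose derivatives
  are those of the three equations. Finally, the fields have to live on the whole range of a chart
  of the atlas, while a normal frame is built only near one point; maximality of the atlas supplies
  a smaller chart.\<close>

lemma Ck_on_cong_imp:
  "open S \<Longrightarrow> (\<And>x. x \<in> S \<Longrightarrow> f x = g x) \<Longrightarrow> Ck_on k f S \<Longrightarrow> Ck_on k g S"
proof (induction k arbitrary: f g)
  case 0
  then show ?case using continuous_on_cong[of S S f g] by simp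
next
  case (Suc k)
  have d: "g differentiable (at x)" if "x \<in> S" for x
    using Suc.prems that unfolding differentiable_def Ck_on.simps
    by (meson has_derivative_transform_within_open)
  have e: "frechet_derivative f (at x) = frechet_derivative g (at x)" if "x \<in> S" for x
    using Suc.prems that by (intro frechet_derivative_transform_within_open[of f x S]) auto
  have "Ck_on k (\<lambda>x. frechet_derivative g (at x) v) S" for v
    by (rule Suc.IH[of "\<lambda>x. frechet_derivative f (at x) v"]) (use Suc.prems e in auto)
  with d show ?case by simp
qed

lemma Ck_on_cong:
  assumes "open S" "\<And>x. x \<in> S \<Longrightarrow> f x = g x"
  shows "Ck_on k f S \<longleftrightarrow> Ck_on k g S"
  using Ck_on_cong_imp[of S f g k] Ck_on_cong_imp[of S g f k] assms by auto

lemma Ck_on_subset: "Ck_on k f S \<Longrightarrow> T \<subseteq> S \<Longrightarrow> Ck_on k f T"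
  by (induction k arbitrary: f) (auto intro: continuous_on_subset)

lemma Ck_on_imp_continuous_on: "Ck_on k f S \<Longrightarrow> continuous_on S f"
proof (cases k)
  case (Suc j)
  assume "Ck_on k f S"
  then have "f differentiable_on S"
    unfolding Suc differentiable_on_def using differentiable_at_withinI by auto
  then show ?thesis by (rule differentiable_imp_continuous_on)
qed simp

lemma Ck_on_SucD: "Ck_on (Suc k) f S \<Longrightarrow> Ck_on k f S"
proof (induction k arbitrary: f)
  case 0
  then show ?case using Ck_on_imp_continuous_on[OF 0] by simp
qed auto

text \<open>Turns every derivative rule into a smoothness rule: the derivative is supplied as an
  explicit family \<open>f'\<close>, so \<open>frechet_derivative\<close> of a compound map never
  has to be computed.\<close>

lemma Ck_on_SucI:
  assumes "open S" "\<And>x. x \<in> S \<Longrightarrow> (f has_derivative f' x) (at x)"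
    and "\<And>v. Ck_on k (\<lambda>x. f' x v) S"
  shows "Ck_on (Suc k) f S"
proof -
  have "frechet_derivative f (at x) = f' x" if "x \<in> S" for x
    by (rule frechet_derivative_at[OF assms(2)[OF that], symmetric])
  then have "Ck_on k (\<lambda>x. frechet_derivative f (at x) v) S" for v
    by (intro Ck_on_cong_imp[OF assms(1) _ assms(3)[of v]]) simp
  then show ?thesis using assms(2) by (auto simp: differentiable_def)
qed

lemma Ck_on_has_derivative:
  "Ck_on (Suc k) f S \<Longrightarrow> x \<in> S \<Longrightarrow> (f has_derivative frechet_derivative f (at x)) (at x)"
  by (simp add: frechet_derivative_works)

lemma Ck_on_partial: "Ck_on (Suc k) f S \<Longrightarrow> Ck_on k (partial i f) S"
  unfolding partial_def[abs_def] by (drule Ck_on.simps(2)[THEN iffD1]) blast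

lemma smooth_on_has_derivative:
  "smooth_on f S \<Longrightarrow> x \<in> S \<Longrightarrow> (f has_derivative frechet_derivative f (at x)) (at x)"
  using Ck_on_has_derivative[of 0] unfolding smooth_on_def by blast

lemma smooth_on_frechet_derivative:
  "smooth_on f S \<Longrightarrow> smooth_on (\<lambda>x. frechet_derivative f (at x) v) S"
  unfolding smooth_on_def by (metis Ck_on.simps(2))

lemma smooth_on_partial: "smooth_on f S \<Longrightarrow> smooth_on (partial i f) S"
  unfolding partial_def[abs_def] by (rule smooth_on_frechet_derivative)

lemma smooth_on_subset: "smooth_on f S \<Longrightarrow> T \<subseteq> S \<Longrightarrow> smooth_on f T"
  unfolding smooth_on_def using Ck_on_subset by blast

lemma smooth_on_cong:
  assumes "open S" "\<And>x. x \<in> S \<Longrightarrow> f x = g x"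
  shows "smooth_on f S \<longleftrightarrow> smooth_on g S"
  unfolding smooth_on_def by (simp add: Ck_on_cong[of S f g, OF assms])

lemma smooth_on_imp_continuous_on: "smooth_on f S \<Longrightarrow> continuous_on S f"
  unfolding smooth_on_def using Ck_on_imp_continuous_on by blast

section \<open>Closure properties of smooth maps\<close>

lemma Ck_on_const: "open S \<Longrightarrow> Ck_on k (\<lambda>x. c) S"
  by (induction k arbitrary: c) auto

lemma Ck_on_linear_compose:
  assumes "open S" "bounded_linear h" "Ck_on k f S"
  shows "Ck_on k (\<lambda>x. h (f x)) S"
  using assms(3)
proof (induction k arbitrary: f)
  case 0
  then show ?case using assms(2) by (simp add: bounded_linear.continuous_on)
next
  case (Suc k)
  show ?case
    by (rule Ck_on_SucI[OF assms(1) bounded_linear.has_derivative[OF assms(2) Ck_on_has_derivative[OF Suc.prems]]])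
       (use Suc in auto)
qed

lemma Ck_on_add:
  assumes "open S" "Ck_on k f S" "Ck_on k g S"
  shows "Ck_on k (\<lambda>x. f x + g x) S"
  using assms(2,3)
proof (induction k arbitrary: f g)
  case (Suc k)
  show ?case
    by (rule Ck_on_SucI[OF assms(1) has_derivative_add[OF Ck_on_has_derivative[OF Suc.prems(1)]
              Ck_on_has_derivative[OF Suc.prems(2)]]]) (use Suc in auto)
qed (simp add: continuous_on_add)

text \<open>The Leibniz rule expresses the derivative by products of the same kind, so the induction
  runs over both factors at once. Products, scalings, \<open>form\<close>, matrix products and
  evaluation of operators are all instances.\<close>

lemma Ck_on_bilinear:
  assumes "open S" "bounded_bilinear p" "Ck_on k f S" "Ck_on k g S"
  shows "Ck_on k (\<lambda>x. p (f x) (g x)) S"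
  using assms(3,4)
proof (induction k arbitrary: f g)
  case 0
  then show ?case using bounded_bilinear.continuous_on[OF assms(2)] by auto
next
  case (Suc k)
  have c: "Ck_on k f S" "Ck_on k g S" using Suc.prems Ck_on_SucD by auto
  show ?case
    by (rule Ck_on_SucI[OF assms(1) bounded_bilinear.FDERIV[OF assms(2)
            Ck_on_has_derivative[OF Suc.prems(1)] Ck_on_has_derivative[OF Suc.prems(2)]]])
       (use Suc.prems c in \<open>auto intro!: Ck_on_add Suc.IH assms(1)\<close>)
qed

lemma Ck_on_sum:
  assumes "open S" "\<And>i. i \<in> I \<Longrightarrow> Ck_on k (f i) S"
  shows "Ck_on k (\<lambda>x. \<Sum>i\<in>I. f i x) S"
proof (cases "finite I")
  case True
  then show ?thesis using assms(2)
    by (induction I rule: finite_induct) (auto intro!: Ck_on_add Ck_on_const assms(1))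
qed (simp add: Ck_on_const assms(1))

lemma smooth_on_const [intro]: "open S \<Longrightarrow> smooth_on (\<lambda>x. c) S"
  by (simp add: smooth_on_def Ck_on_const)

lemma smooth_on_linear_compose:
  "open S \<Longrightarrow> bounded_linear h \<Longrightarrow> smooth_on f S \<Longrightarrow> smooth_on (\<lambda>x. h (f x)) S"
  by (simp add: smooth_on_def Ck_on_linear_compose)

lemma smooth_on_add:
  "open S \<Longrightarrow> smooth_on f S \<Longrightarrow> smooth_on g S \<Longrightarrow> smooth_on (\<lambda>x. f x + g x) S"
  by (simp add: smooth_on_def Ck_on_add)

lemma smooth_on_bilinear:
  "open S \<Longrightarrow> bounded_bilinear p \<Longrightarrow> smooth_on f S \<Longrightarrow> smooth_on g S \<Longrightarrow> smooth_on (\<lambda>x. p (f x) (g x)) S"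
  by (simp add: smooth_on_def Ck_on_bilinear)

lemma smooth_on_sum:
  "open S \<Longrightarrow> (\<And>i. i \<in> I \<Longrightarrow> smooth_on (f i) S) \<Longrightarrow> smooth_on (\<lambda>x. \<Sum>i\<in>I. f i x) S"
  by (simp add: smooth_on_def Ck_on_sum)

lemma smooth_on_uminus: "open S \<Longrightarrow> smooth_on f S \<Longrightarrow> smooth_on (\<lambda>x. - f x) S"
  by (rule smooth_on_linear_compose[OF _ bounded_linear_minus[OF bounded_linear_ident]])

lemma smooth_on_diff:
  "open S \<Longrightarrow> smooth_on f S \<Longrightarrow> smooth_on g S \<Longrightarrow> smooth_on (\<lambda>x. f x - g x) S"
  using smooth_on_add[of S f "\<lambda>x. - g x"] smooth_on_uminus by auto

lemma smooth_on_mult: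
  fixes f g :: "_ \<Rightarrow> real"
  shows "open S \<Longrightarrow> smooth_on f S \<Longrightarrow> smooth_on g S \<Longrightarrow> smooth_on (\<lambda>x. f x * g x) S"
  by (rule smooth_on_bilinear[OF _ bounded_bilinear_mult])

lemma smooth_on_prod:
  fixes f :: "_ \<Rightarrow> _ \<Rightarrow> real"
  assumes "open S" "\<And>i. i \<in> I \<Longrightarrow> smooth_on (f i) S"
  shows "smooth_on (\<lambda>x. \<Prod>i\<in>I. f i x) S"
proof (cases "finite I")
  case True
  then show ?thesis using assms(2)
    by (induction I rule: finite_induct) (auto intro!: smooth_on_mult assms(1))
qed (use assms(1) in auto)

lemma smooth_on_scaleR:
  "open S \<Longrightarrow> smooth_on f S \<Longrightarrow> smooth_on g S \<Longrightarrow> smooth_on (\<lambda>x. f x *\<^sub>R g x) S"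
  by (rule smooth_on_bilinear[OF _ bounded_bilinear_scaleR])

lemma smooth_on_vec_nth: "open S \<Longrightarrow> smooth_on f S \<Longrightarrow> smooth_on (\<lambda>x. f x $ i) S"
  by (rule smooth_on_linear_compose[OF _ bounded_linear_vec_nth])

lemma bounded_linear_axis: "bounded_linear (axis i :: 'b::real_normed_vector \<Rightarrow> 'b^'n)"
proof (rule bounded_linear_intro[of _ 1])
  show "norm (axis i x :: 'b^'n) \<le> norm x * 1" for x
    using L2_set_le_sum[of UNIV "\<lambda>j. norm ((axis i x :: 'b^'n) $ j)"]
    by (simp add: norm_vec_def axis_def if_distrib sum.delta cong: if_cong)
qed (auto simp: vec_eq_iff axis_def)

lemma smooth_on_vec:
  fixes f :: "'a::real_normed_vector \<Rightarrow> 'b::real_normed_vector^'n"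
  assumes "open S" "\<And>i. smooth_on (\<lambda>x. f x $ i) S"
  shows "smooth_on f S"
proof -
  have e: "(\<lambda>x. \<Sum>i\<in>UNIV. axis i (f x $ i)) = f"
    by (auto simp: fun_eq_iff vec_eq_iff axis_def if_distrib sum.delta cong: if_cong)
  have "smooth_on (\<lambda>x. \<Sum>i\<in>UNIV. axis i (f x $ i)) S"
    by (rule smooth_on_sum[OF assms(1)], rule smooth_on_linear_compose[OF assms(1) bounded_linear_axis], rule assms(2))
  then show ?thesis by (simp only: e)
qed

lemma smooth_on_Pair:
  assumes "open S" "smooth_on f S" "smooth_on g S"
  shows "smooth_on (\<lambda>x. (f x, g x)) S"
proof -
  have "smooth_on (\<lambda>x. (f x, 0) + (0, g x)) S"
    by (rule smooth_on_add[OF assms(1) smooth_on_linear_compose[OF assms(1) _ assms(2)]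
        smooth_on_linear_compose[OF assms(1) _ assms(3)]])
       (auto intro!: bounded_linear_Pair bounded_linear_ident bounded_linear_zero)
  then show ?thesis by simp
qed

text \<open>Bootstrapping: the derivative of \<open>1/f\<close> is built from \<open>1/f\<close>
  itself and a derivative of \<open>f\<close>, so k orders of differentiability yield k+1.\<close>

lemma smooth_on_inverse:
  fixes f :: "_ \<Rightarrow> real"
  assumes "open S" "smooth_on f S" "\<And>x. x \<in> S \<Longrightarrow> f x \<noteq> 0"
  shows "smooth_on (\<lambda>x. inverse (f x)) S"
proof -
  have "Ck_on k (\<lambda>x. inverse (f x)) S" for k
  proof (induction k)
    case 0
    then show ?case using smooth_on_imp_continuous_on[OF assms(2)] assms(3)
      by (auto intro!: continuous_on_inverse)
  next
    case (Suc k)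
    have "Ck_on k (\<lambda>x. - (inverse (f x) * frechet_derivative f (at x) v * inverse (f x))) S" for v
      by (intro Ck_on_linear_compose[OF assms(1) bounded_linear_minus[OF bounded_linear_ident]]
          Ck_on_bilinear[OF assms(1) bounded_bilinear_mult] Suc)
         (use smooth_on_frechet_derivative[OF assms(2)] in \<open>auto simp: smooth_on_def\<close>)
    then show ?case
      by (intro Ck_on_SucI[OF assms(1) Deriv.has_derivative_inverse[OF assms(3) smooth_on_has_derivative[OF assms(2)]]]) auto
  qed
  then show ?thesis by (simp add: smooth_on_def)
qed

text \<open>The derivative has the exponent \<open>a - 1\<close>, so the induction is over all
  exponents simultaneously. The exponent -1/2 will normalise the normal vectors.\<close>

lemma smooth_on_powr:
  fixes f :: "_ \<Rightarrow> real"
  assumes "open S" "smooth_on f S" "\<And>x. x \<in> S \<Longrightarrow> f x > 0"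
  shows "smooth_on (\<lambda>x. f x powr a) S"
proof -
  have "Ck_on k (\<lambda>x. f x powr a) S" for k
  proof (induction k arbitrary: a)
    case 0
    show ?case using smooth_on_imp_continuous_on[OF assms(2)] assms(3)
      by (auto intro!: continuous_on_powr continuous_on_const) force
  next
    case (Suc k)
    have d: "((\<lambda>x. f x powr a) has_derivative (\<lambda>v. a * f x powr (a - 1) * frechet_derivative f (at x) v)) (at x)"
      if "x \<in> S" for x
    proof -
      have "((\<lambda>y. y powr a) has_derivative (\<lambda>h. a * f x powr (a - 1) * h)) (at (f x))"
        using has_real_derivative_powr[OF assms(3)[OF that], of a]
        by (simp add: has_field_derivative_def)
      from has_derivative_compose[OF smooth_on_has_derivative[OF assms(2) that] this]
      show ?thesis .
    qed
    have "Ck_on k (\<lambda>x. a * f x powr (a - 1) * frechet_derivative f (at x) v) S" for v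
      by (intro Ck_on_bilinear[OF assms(1) bounded_bilinear_mult] Suc Ck_on_const assms(1))
         (use smooth_on_frechet_derivative[OF assms(2)] in \<open>auto simp: smooth_on_def\<close>)
    then show ?case by (intro Ck_on_SucI[OF assms(1) d]) auto
  qed
  then show ?thesis by (simp add: smooth_on_def)
qed

text \<open>In the chain rule the derivative of \<open>g\<close> is taken at \<open>f x\<close> in a
  direction that also moves with \<open>x\<close>. Expanding this direction in \<open>Basis\<close>
  leaves derivatives of \<open>g\<close> in fixed directions, to which the induction hypothesis
  applies.\<close>

lemma Ck_on_compose:
  fixes f :: "'a::real_normed_vector \<Rightarrow> 'b::euclidean_space"
  assumes "open S" "open T" "f ` S \<subseteq> T" "Ck_on k f S" "Ck_on k g T"
  shows "Ck_on k (\<lambda>x. g (f x)) S"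
  using assms(4,5)
proof (induction k arbitrary: g)
  case 0
  then show ?case using assms(3) by (auto intro: continuous_on_compose2)
next
  case (Suc k)
  have fx: "f x \<in> T" if "x \<in> S" for x using that assms(3) by auto
  have d: "((\<lambda>x. g (f x)) has_derivative
      (\<lambda>v. \<Sum>b\<in>Basis. (frechet_derivative f (at x) v \<bullet> b) *\<^sub>R frechet_derivative g (at (f x)) b)) (at x)"
    if "x \<in> S" for x
  proof -
    have l: "linear (frechet_derivative g (at (f x)))"
      using Ck_on_has_derivative[OF Suc.prems(2) fx[OF that]] has_derivative_linear by blast
    have e: "frechet_derivative g (at (f x)) w = (\<Sum>b\<in>Basis. (w \<bullet> b) *\<^sub>R frechet_derivative g (at (f x)) b)" for w
    proof -
      have "frechet_derivative g (at (f x)) w = frechet_derivative g (at (f x)) (\<Sum>b\<in>Basis. (w \<bullet> b) *\<^sub>R b)"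
        by (simp only: euclidean_representation)
      then show ?thesis by (simp only: linear_sum[OF l] linear_cmul[OF l])
    qed
    show ?thesis
      by (rule has_derivative_eq_rhs[OF has_derivative_compose[OF Ck_on_has_derivative[OF Suc.prems(1) that]
            Ck_on_has_derivative[OF Suc.prems(2) fx[OF that]]]], rule ext, rule e)
  qed
  have "Ck_on k (\<lambda>x. \<Sum>b\<in>Basis. (frechet_derivative f (at x) v \<bullet> b) *\<^sub>R frechet_derivative g (at (f x)) b) S" for v
    by (rule Ck_on_sum[OF assms(1)], rule Ck_on_bilinear[OF assms(1) bounded_bilinear_scaleR],
        rule Ck_on_linear_compose[OF assms(1) bounded_linear_inner_left], use Suc.prems in simp,
        rule Suc.IH[OF Ck_on_SucD[OF Suc.prems(1)]], use Suc.prems in simp)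
  then show ?case by (intro Ck_on_SucI[OF assms(1) d]) auto
qed

lemma smooth_on_compose:
  fixes f :: "'a::real_normed_vector \<Rightarrow> 'b::euclidean_space"
  assumes "open S" "open T" "f ` S \<subseteq> T" "smooth_on f S" "smooth_on g T"
  shows "smooth_on (\<lambda>x. g (f x)) S"
  using assms Ck_on_compose[OF assms(1-3)] unfolding smooth_on_def by blast

lemma blinfun_eq_sum_Basis:
  fixes f :: "'b::euclidean_space \<Rightarrow>\<^sub>L 'c::real_normed_vector"
  shows "f = (\<Sum>b\<in>Basis. blinfun_scaleR_left (f b) o\<^sub>L blinfun_inner_left b)"
proof (rule blinfun_eqI)
  fix i :: 'b
  have "f i = f (\<Sum>b\<in>Basis. (i \<bullet> b) *\<^sub>R b)" by (simp add: euclidean_representation)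
  then show "f i = (\<Sum>b\<in>Basis. blinfun_scaleR_left (f b) o\<^sub>L blinfun_inner_left b) i"
    by (simp add: blinfun.sum_right blinfun.scaleR_right blinfun.sum_left inner_commute)
qed

text \<open>An operator depends linearly on its finitely many values on \<open>Basis\<close>. The
  coefficient of the linear system is an operator whose values are operators, so the lemma is
  applied to it twice.\<close>

lemma smooth_on_blinfun:
  fixes f :: "'a::real_normed_vector \<Rightarrow> 'b::euclidean_space \<Rightarrow>\<^sub>L 'c::real_normed_vector"
  assumes "open S" "\<And>b. b \<in> Basis \<Longrightarrow> smooth_on (\<lambda>x. f x b) S"
  shows "smooth_on f S"
proof -
  have l: "bounded_linear (\<lambda>y::'c. blinfun_scaleR_left y o\<^sub>L blinfun_inner_left b)" for b :: 'b
    by (intro bounded_linear_intros)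
  have "smooth_on (\<lambda>x. \<Sum>b\<in>Basis. blinfun_scaleR_left (f x b) o\<^sub>L blinfun_inner_left b) S"
    by (rule smooth_on_sum[OF assms(1)], rule smooth_on_linear_compose[OF assms(1) l], rule assms(2))
  then show ?thesis by (simp only: blinfun_eq_sum_Basis[symmetric])
qed

section \<open>Coordinate partial derivatives\<close>

lemma has_derivative_partial:
  fixes f :: "real^'n::finite \<Rightarrow> 'b::real_normed_vector"
  assumes "f differentiable (at x)"
  shows "(f has_derivative (\<lambda>h. \<Sum>i\<in>UNIV. h $ i *\<^sub>R partial i f x)) (at x)"
proof -
  have l: "linear (frechet_derivative f (at x))" by (rule linear_frechet_derivative[OF assms])
  have a: "h = (\<Sum>i\<in>UNIV. h $ i *\<^sub>R axis i 1)" for h :: "real^'n"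
    by (auto simp: vec_eq_iff axis_def if_distrib sum.delta cong: if_cong)
  have "frechet_derivative f (at x) h = (\<Sum>i\<in>UNIV. h $ i *\<^sub>R partial i f x)" for h
  proof -
    have "frechet_derivative f (at x) h = frechet_derivative f (at x) (\<Sum>i\<in>UNIV. h $ i *\<^sub>R axis i 1)"
      by (simp only: a[symmetric])
    then show ?thesis by (simp only: linear_sum[OF l] linear_cmul[OF l] partial_def)
  qed
  then show ?thesis
    by (intro has_derivative_eq_rhs[OF frechet_derivative_works[THEN iffD1, OF assms]] ext)
qed

lemma partial_eqI: "(f has_derivative f') (at x) \<Longrightarrow> partial i f x = f' (axis i 1)"
  unfolding partial_def by (simp add: frechet_derivative_at[symmetric])

lemma smooth_on_differentiable: "smooth_on f S \<Longrightarrow> x \<in> S \<Longrightarrow> f differentiable (at x)"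
  using smooth_on_has_derivative unfolding differentiable_def by blast

lemma partial_cong:
  assumes "open S" "x \<in> S" "f differentiable (at x)" "\<And>y. y \<in> S \<Longrightarrow> f y = g y"
  shows "partial i f x = partial i g x"
  unfolding partial_def using frechet_derivative_transform_within_open[of f x S g] assms by auto

lemma partial_sum:
  assumes "\<And>a. a \<in> I \<Longrightarrow> f a differentiable (at x)"
  shows "partial i (\<lambda>y. \<Sum>a\<in>I. f a y) x = (\<Sum>a\<in>I. partial i (f a) x)"
  unfolding partial_def[of i "f _"]
  by (rule partial_eqI) (intro has_derivative_sum; simp add: assms frechet_derivative_works[symmetric])

lemma partial_bilinear:
  assumes "bounded_bilinear p" "f differentiable (at x)" "g differentiable (at x)"
  shows "partial i (\<lambda>y. p (f y) (g y)) x = p (f x) (partial i g x) + p (partial i f x) (g x)"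
  unfolding partial_def[of i f] partial_def[of i g] 
  by (rule partial_eqI) (intro bounded_bilinear.FDERIV[OF assms(1)]; simp add: assms frechet_derivative_works[symmetric])

lemmas partial_mult = partial_bilinear[OF bounded_bilinear_mult]

lemma partial_linear_compose:
  assumes "bounded_linear h" "f differentiable (at x)"
  shows "partial i (\<lambda>y. h (f y)) x = h (partial i f x)"
  unfolding partial_def[of i f]
  by (rule partial_eqI) (intro bounded_linear.has_derivative[OF assms(1)]; simp add: assms frechet_derivative_works[symmetric])

lemma partial_const [simp]: "partial i (\<lambda>x. c) x = 0"
  by (simp add: partial_def)

lemma partial_vec_nth: "f differentiable (at x) \<Longrightarrow> partial i (\<lambda>y. f y $ k) x = partial i f x $ k"
  by (rule partial_linear_compose[OF bounded_linear_vec_nth])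

subsection \<open>Symmetry of second derivatives\<close>

text \<open>The second difference is symmetric in \<open>i\<close> and \<open>j\<close>. The mean
  value theorem, applied first in direction \<open>i\<close> and then in direction \<open>j\<close>,
  expresses it by a single mixed derivative.\<close>

lemma partial_commute_mvt:
  fixes f :: "real^'n::finite \<Rightarrow> real"
  assumes "Ck_on 2 f (ball x r)" "0 < h" "2 * h < r"
  obtains p where "dist x p \<le> 2 * h"
    "f (x + h *\<^sub>R axis i 1 + h *\<^sub>R axis j 1) - f (x + h *\<^sub>R axis i 1) - f (x + h *\<^sub>R axis j 1) + f x
       = h * h * partial j (partial i f) p"
proof -
  have C: "Ck_on (Suc (Suc 0)) f (ball x r)" using assms(1) by (simp add: numeral_2_eq_2)
  have in_ball: "dist x (x + s *\<^sub>R axis i 1 + t *\<^sub>R axis j 1) \<le> \<bar>s\<bar> + \<bar>t\<bar>" for s t :: real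
  proof -
    have "dist x (x + s *\<^sub>R axis i 1 + t *\<^sub>R axis j 1) = norm (s *\<^sub>R axis i 1 + t *\<^sub>R (axis j 1 :: real^'n))"
      by (simp add: dist_norm norm_minus_commute algebra_simps)
    also have "\<dots> \<le> \<bar>s\<bar> + \<bar>t\<bar>" by (rule order_trans[OF norm_triangle_ineq]) simp
    finally show ?thesis .
  qed
  have mem: "x + s *\<^sub>R axis i 1 + t *\<^sub>R axis j 1 \<in> ball x r" if "0 \<le> s" "s \<le> h" "0 \<le> t" "t \<le> h" for s t
    using in_ball[of s t] that assms(3) by auto
  have di: "((\<lambda>s. f (x + s *\<^sub>R axis i 1 + t *\<^sub>R axis j 1)) has_real_derivative
       partial i f (x + s *\<^sub>R axis i 1 + t *\<^sub>R axis j 1)) (at s)"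
    if "0 \<le> s" "s \<le> h" "0 \<le> t" "t \<le> h" for s t
  proof -
    have "((\<lambda>s. x + s *\<^sub>R axis i 1 + t *\<^sub>R axis j 1) has_derivative (\<lambda>u. u *\<^sub>R axis i 1)) (at s)"
      by (auto intro!: derivative_eq_intros)
    note dc = has_derivative_compose[OF this Ck_on_has_derivative[OF C mem[OF that]]]
    have l: "linear (frechet_derivative f (at (x + s *\<^sub>R axis i 1 + t *\<^sub>R axis j 1)))"
      using Ck_on_has_derivative[OF C mem[OF that]] has_derivative_linear by blast
    show ?thesis using dc unfolding has_field_derivative_def partial_def
      by (simp add: linear_cmul[OF l] mult_commute_abs)
  qed
  have C1: "Ck_on (Suc 0) (partial i f) (ball x r)"
    by (rule Ck_on_partial[OF C])
  have dj: "((\<lambda>t. partial i f (x + s *\<^sub>R axis i 1 + t *\<^sub>R axis j 1)) has_real_derivative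
       partial j (partial i f) (x + s *\<^sub>R axis i 1 + t *\<^sub>R axis j 1)) (at t)"
    if "0 \<le> s" "s \<le> h" "0 \<le> t" "t \<le> h" for s t
  proof -
    have "((\<lambda>t. x + s *\<^sub>R axis i 1 + t *\<^sub>R axis j 1) has_derivative (\<lambda>u. u *\<^sub>R axis j 1)) (at t)"
      by (auto intro!: derivative_eq_intros)
    note dc = has_derivative_compose[OF this Ck_on_has_derivative[OF C1 mem[OF that]]]
    have l: "linear (frechet_derivative (partial i f) (at (x + s *\<^sub>R axis i 1 + t *\<^sub>R axis j 1)))"
      using Ck_on_has_derivative[OF C1 mem[OF that]] has_derivative_linear by blast
    show ?thesis using dc unfolding has_field_derivative_def partial_def[of j]
      by (simp add: linear_cmul[OF l] mult_commute_abs)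
  qed
  \<comment> \<open>The summand with factor 0 keeps both terms in the form that \<open>di\<close>
    differentiates.\<close>
  define \<phi> where "\<phi> s = f (x + s *\<^sub>R axis i 1 + h *\<^sub>R axis j 1) - f (x + s *\<^sub>R axis i 1 + 0 *\<^sub>R axis j 1)" for s
  have "\<exists>\<xi>>0. \<xi> < h \<and> \<phi> h - \<phi> 0 = (h - 0) *
     (partial i f (x + \<xi> *\<^sub>R axis i 1 + h *\<^sub>R axis j 1) - partial i f (x + \<xi> *\<^sub>R axis i 1 + 0 *\<^sub>R axis j 1))"
    unfolding \<phi>_def by (rule MVT2[OF assms(2)]) (use assms(2) in \<open>intro DERIV_diff di; simp\<close>)
  then obtain \<xi> where \<xi>: "0 < \<xi>" "\<xi> < h" "\<phi> h - \<phi> 0 = h *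
     (partial i f (x + \<xi> *\<^sub>R axis i 1 + h *\<^sub>R axis j 1) - partial i f (x + \<xi> *\<^sub>R axis i 1 + 0 *\<^sub>R axis j 1))"
    by auto
  have "\<exists>\<zeta>>0. \<zeta> < h \<and> partial i f (x + \<xi> *\<^sub>R axis i 1 + h *\<^sub>R axis j 1) - partial i f (x + \<xi> *\<^sub>R axis i 1 + 0 *\<^sub>R axis j 1)
     = (h - 0) * partial j (partial i f) (x + \<xi> *\<^sub>R axis i 1 + \<zeta> *\<^sub>R axis j 1)"
    by (rule MVT2[OF assms(2)]) (use \<xi> in \<open>intro dj; simp\<close>)
  then obtain \<zeta> where \<zeta>: "0 < \<zeta>" "\<zeta> < h" "partial i f (x + \<xi> *\<^sub>R axis i 1 + h *\<^sub>R axis j 1) - partial i f (x + \<xi> *\<^sub>R axis i 1 + 0 *\<^sub>R axis j 1)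
     = h * partial j (partial i f) (x + \<xi> *\<^sub>R axis i 1 + \<zeta> *\<^sub>R axis j 1)"
    by auto
  show ?thesis
  proof (rule that)
    show "dist x (x + \<xi> *\<^sub>R axis i 1 + \<zeta> *\<^sub>R axis j 1) \<le> 2 * h"
      using in_ball[of \<xi> \<zeta>] \<xi> \<zeta> by linarith
    show "f (x + h *\<^sub>R axis i 1 + h *\<^sub>R axis j 1) - f (x + h *\<^sub>R axis i 1) - f (x + h *\<^sub>R axis j 1) + f x
       = h * h * partial j (partial i f) (x + \<xi> *\<^sub>R axis i 1 + \<zeta> *\<^sub>R axis j 1)"
      using \<xi>(3) \<zeta>(3) by (simp add: \<phi>_def algebra_simps)
  qed
qed

text \<open>Divided by the square of the step, the symmetric second difference is a mixed derivative
  of either order at a nearby point; continuity of both at \<open>x\<close> makes them agree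
  there.\<close>

lemma partial_commute_real:
  fixes f :: "real^'n::finite \<Rightarrow> real"
  assumes "open S" "Ck_on 2 f S" "x \<in> S"
  shows "partial i (partial j f) x = partial j (partial i f) x"
proof (rule ccontr)
  assume ne: "partial i (partial j f) x \<noteq> partial j (partial i f) x"
  define e where "e = dist (partial i (partial j f) x) (partial j (partial i f) x) / 2"
  have "e > 0" using ne by (simp add: e_def)
  obtain r where r: "r > 0" "ball x r \<subseteq> S" using assms openE by blast
  have C: "Ck_on (Suc (Suc 0)) f S" using assms(2) by (simp add: numeral_2_eq_2)
  then have "continuous_on S (partial i (partial j f))" "continuous_on S (partial j (partial i f))"
    unfolding partial_def[abs_def] by (simp_all only: Ck_on.simps)
  then have "isCont (partial i (partial j f)) x" "isCont (partial j (partial i f)) x"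
    using assms continuous_on_eq_continuous_at by blast+
  then obtain d1 d2 where d: "d1 > 0" "\<And>y. dist y x < d1 \<Longrightarrow> dist (partial i (partial j f) y) (partial i (partial j f) x) < e"
    "d2 > 0" "\<And>y. dist y x < d2 \<Longrightarrow> dist (partial j (partial i f) y) (partial j (partial i f) x) < e"
    using \<open>e > 0\<close> unfolding continuous_at_eps_delta by metis
  \<comment> \<open>Dividing by 3 leaves \<open>2 * h\<close> strictly below each of the three
    radii.\<close>
  define h where "h = Min {r, d1, d2} / 3"
  have h: "h > 0" "2 * h < r" "2 * h < d1" "2 * h < d2" using r d by (auto simp: h_def)
  have C2: "Ck_on 2 f (ball x r)" by (rule Ck_on_subset[OF assms(2) r(2)])
  obtain p where p: "dist x p \<le> 2 * h"
    "f (x + h *\<^sub>R axis i 1 + h *\<^sub>R axis j 1) - f (x + h *\<^sub>R axis i 1) - f (x + h *\<^sub>R axis j 1) + f x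
       = h * h * partial j (partial i f) p" using partial_commute_mvt[OF C2 h(1,2)] by blast
  obtain q where q: "dist x q \<le> 2 * h"
    "f (x + h *\<^sub>R axis j 1 + h *\<^sub>R axis i 1) - f (x + h *\<^sub>R axis j 1) - f (x + h *\<^sub>R axis i 1) + f x
       = h * h * partial i (partial j f) q" using partial_commute_mvt[OF C2 h(1,2)] by blast
  have "h * h * partial j (partial i f) p = h * h * partial i (partial j f) q"
    using p(2) q(2) by (simp add: algebra_simps)
  then have "partial j (partial i f) p = partial i (partial j f) q" using h by simp
  moreover have "dist (partial i (partial j f) q) (partial i (partial j f) x) < e"
    using d(2)[of q] q h by (simp add: dist_commute)
  moreover have "dist (partial j (partial i f) p) (partial j (partial i f) x) < e"
    using d(4)[of p] p h by (simp add: dist_commute)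
  moreover have "dist (partial i (partial j f) x) (partial j (partial i f) x)
    \<le> dist (partial i (partial j f) q) (partial i (partial j f) x) + dist (partial i (partial j f) q) (partial j (partial i f) x)"
    by (rule dist_triangle3)
  ultimately show False unfolding e_def by simp
qed

lemma partial_commute:
  fixes f :: "real^'n::finite \<Rightarrow> real^'m::finite"
  assumes "open S" "smooth_on f S" "x \<in> S"
  shows "partial i (partial j f) x = partial j (partial i f) x"
proof -
  have *: "partial i (partial j (\<lambda>y. f y $ k)) x = partial i (partial j f) x $ k" for i j k
  proof -
    have "partial i (partial j (\<lambda>y. f y $ k)) x = partial i (\<lambda>y. partial j f y $ k) x"
      by (rule partial_cong[OF assms(1,3)])
        (use assms in \<open>auto intro!: partial_vec_nth smooth_on_differentiable[OF smooth_on_partial[OF smooth_on_vec_nth]] 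
           intro: smooth_on_differentiable\<close>)
    also have "\<dots> = partial i (partial j f) x $ k"
      by (rule partial_vec_nth[OF smooth_on_differentiable[OF smooth_on_partial[OF assms(2)] assms(3)]])
    finally show ?thesis .
  qed
  have "partial i (partial j (\<lambda>y. f y $ k)) x = partial j (partial i (\<lambda>y. f y $ k)) x" for k
    using partial_commute_real[OF assms(1) _ assms(3)] smooth_on_vec_nth[OF assms(1,2), of k] 
    unfolding smooth_on_def by blast
  then show ?thesis by (simp add: * vec_eq_iff)
qed

section \<open>Linear total differential systems\<close>

text \<open>The bounds make the Picard map \<open>T\<close> below, of the integral equation
  \<open>u x = w + \<integral>\<^sub>0\<^sup>1 A (x0 + t (x - x0)) (x - x0) (u (x0 + t (x - x0))) dt\<close>, turn the bounds \<open>\<alpha>\<close> for \<open>u\<close> and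
  \<open>c * \<alpha>\<close> for its derivative into \<open>\<alpha> / 2\<close> and \<open>c * \<alpha> / 2\<close>.\<close>
locale radial_system =
  fixes A :: "'a::euclidean_space \<Rightarrow> 'a \<Rightarrow>\<^sub>L 'b \<Rightarrow>\<^sub>L 'b::banach"
    and A' :: "'a \<Rightarrow> 'a \<Rightarrow>\<^sub>L 'a \<Rightarrow>\<^sub>L 'b \<Rightarrow>\<^sub>L 'b"
    and x0 :: 'a and r c :: real
  assumes r: "r > 0" and c: "c > 0"
    and A_deriv: "\<And>x. x \<in> ball x0 r \<Longrightarrow> (A has_derivative A' x) (at x)"
    and A'_cont: "continuous_on (ball x0 r) A'"
    and A_bound: "\<And>x. x \<in> ball x0 r \<Longrightarrow> norm (A x) * r \<le> 1 / 4"
    and A'_bound: "\<And>x. x \<in> ball x0 r \<Longrightarrow> norm (A' x) * r + norm (A x) \<le> c / 4"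
begin

definition ray :: "real \<Rightarrow> 'a \<Rightarrow> 'a" where "ray t x = x0 + t *\<^sub>R (x - x0)"

definition rint :: "('a \<Rightarrow> 'b) \<Rightarrow> 'a \<Rightarrow> real \<Rightarrow> 'b" where
  "rint u x t = A (ray t x) (x - x0) (u (ray t x))"

text \<open>The derivative of \<open>rint u\<close> in \<open>x\<close> when \<open>u'\<close> is
  the derivative of \<open>u\<close>; the factors \<open>t\<close> come from the chain rule along
  \<open>ray t\<close>.\<close>

definition drint :: "('a \<Rightarrow> 'b) \<Rightarrow> ('a \<Rightarrow> 'a \<Rightarrow>\<^sub>L 'b) \<Rightarrow> 'a \<Rightarrow> real \<Rightarrow> 'a \<Rightarrow>\<^sub>L 'b" where
  "drint u u' x t = Blinfun (\<lambda>k. t *\<^sub>R A' (ray t x) k (x - x0) (u (ray t x))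
     + A (ray t x) k (u (ray t x)) + t *\<^sub>R A (ray t x) (x - x0) (u' (ray t x) k))"

definition T :: "('a \<Rightarrow> 'b) \<Rightarrow> 'a \<Rightarrow> 'b" where
  "T u x = integral {0..1} (rint u x)"

definition dT :: "('a \<Rightarrow> 'b) \<Rightarrow> ('a \<Rightarrow> 'a \<Rightarrow>\<^sub>L 'b) \<Rightarrow> 'a \<Rightarrow> 'a \<Rightarrow>\<^sub>L 'b" where
  "dT u u' x = integral {0..1} (drint u u' x)"

lemma drint_apply: "drint u u' x t k = t *\<^sub>R A' (ray t x) k (x - x0) (u (ray t x))
     + A (ray t x) k (u (ray t x)) + t *\<^sub>R A (ray t x) (x - x0) (u' (ray t x) k)"
  unfolding drint_def by (subst bounded_linear_Blinfun_apply) (auto intro!: bounded_linear_intros)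

lemma ray_in: "x \<in> ball x0 r \<Longrightarrow> 0 \<le> t \<Longrightarrow> t \<le> 1 \<Longrightarrow> ray t x \<in> ball x0 r"
proof -
  assume a: "x \<in> ball x0 r" "0 \<le> t" "t \<le> 1"
  have "norm (t *\<^sub>R (x - x0)) \<le> 1 * norm (x - x0)"
    using a by (simp add: mult_left_le_one_le)
  then show ?thesis using a(1) by (simp add: ray_def dist_norm norm_minus_commute)
qed

lemma A_cont: "continuous_on (ball x0 r) A"
  using A_deriv by (meson continuous_at_imp_continuous_on has_derivative_continuous)

lemma ray_cont [continuous_intros]:
  "continuous_on X f \<Longrightarrow> continuous_on X g \<Longrightarrow> continuous_on X (\<lambda>y. ray (f y) (g y))"
  unfolding ray_def by (intro continuous_intros)

lemma cont_along:
  assumes "continuous_on (ball x0 r) h"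
  shows "continuous_on (ball x0 r \<times> cbox 0 1) (\<lambda>y. h (ray (snd y) (fst y)))"
  by (rule continuous_on_compose2[OF assms]) (auto intro!: continuous_intros simp: ray_in simp del: mem_ball)

lemma rint_cont:
  assumes "continuous_on (ball x0 r) u"
  shows "continuous_on (ball x0 r \<times> cbox 0 1) (\<lambda>(x, t). rint u x t)"
  unfolding rint_def split_beta
  by (intro continuous_intros cont_along assms A_cont)

lemma drint_cont:
  assumes "continuous_on (ball x0 r) u" "continuous_on (ball x0 r) u'"
  shows "continuous_on (ball x0 r \<times> cbox 0 1) (\<lambda>(x, t). drint u u' x t)"
  unfolding split_beta
  by (rule continuous_on_blinfun_componentwise, unfold drint_apply)
     (intro continuous_intros cont_along assms A_cont A'_cont)

lemma rint_cont1:
  assumes "continuous_on (ball x0 r) u" "x \<in> ball x0 r"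
  shows "continuous_on (cbox 0 1) (rint u x)"
  using continuous_on_compose2[OF rint_cont[OF assms(1)], of "cbox 0 1" "\<lambda>t. (x, t)"] assms(2)
  by (force intro!: continuous_intros)

lemma drint_cont1:
  assumes "continuous_on (ball x0 r) u" "continuous_on (ball x0 r) u'" "x \<in> ball x0 r"
  shows "continuous_on (cbox 0 1) (drint u u' x)"
  using continuous_on_compose2[OF drint_cont[OF assms(1,2)], of "cbox 0 1" "\<lambda>t. (x, t)"] assms(3)
  by (force intro!: continuous_intros)

lemma rint_deriv:
  fixes u' :: "'a \<Rightarrow> 'a \<Rightarrow>\<^sub>L 'b"
  assumes "x \<in> ball x0 r" "t \<in> cbox 0 1" "\<And>x. x \<in> ball x0 r \<Longrightarrow> (u has_derivative u' x) (at x)"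
  shows "((\<lambda>x. rint u x t) has_derivative drint u u' x t) (at x)"
proof -
  have p: "ray t x \<in> ball x0 r" using assms ray_in by auto
  have d: "(ray t has_derivative (\<lambda>k. t *\<^sub>R k)) (at x)"
    unfolding ray_def by (auto intro!: derivative_eq_intros)
  note dA = has_derivative_compose[OF d A_deriv[OF p]]
  note du = has_derivative_compose[OF d assms(3)[OF p]]
  show ?thesis unfolding rint_def
    by (rule has_derivative_eq_rhs, rule derivative_intros, rule derivative_intros, rule dA,
        rule derivative_intros, rule has_derivative_ident, rule has_derivative_const, rule du)
       (auto simp: fun_eq_iff drint_apply blinfun.bilinear_simps algebra_simps)
qed

lemma T_deriv:
  fixes u' :: "'a \<Rightarrow> 'a \<Rightarrow>\<^sub>L 'b"
  assumes u: "\<And>x. x \<in> ball x0 r \<Longrightarrow> (u has_derivative u' x) (at x)" and u': "continuous_on (ball x0 r) u'"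
    and x: "x \<in> ball x0 r"
  shows "(T u has_derivative dT u u' x) (at x)"
proof -
  have cu: "continuous_on (ball x0 r) u"
    using u by (meson continuous_at_imp_continuous_on has_derivative_continuous)
  have "((\<lambda>x. integral (cbox 0 1) (rint u x)) has_derivative integral (cbox 0 1) (drint u u' x)) (at x within ball x0 r)"
    by (rule leibniz_rule[OF has_derivative_at_withinI[OF rint_deriv] integrable_continuous[OF rint_cont1[OF cu]] drint_cont[OF cu u'] x])
       (use u in auto)
  then show ?thesis using x unfolding T_def[abs_def] dT_def by (simp add: at_within_open[OF x])
qed

lemma dT_cont:
  assumes "continuous_on (ball x0 r) u" "continuous_on (ball x0 r) u'"
  shows "continuous_on (ball x0 r) (dT u u')"
  using integral_continuous_on_param[OF drint_cont[OF assms]] unfolding dT_def[abs_def] by simp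

lemma bound1:
  assumes x: "x \<in> ball x0 r" and t: "t \<in> cbox 0 1"
  shows "norm (A (ray t x) (x - x0) v) \<le> norm v / 4"
proof -
  have "norm (x - x0) \<le> r" using x by (simp add: dist_norm norm_minus_commute)
  then have "norm (A (ray t x)) * norm (x - x0) \<le> norm (A (ray t x)) * r" by (simp add: mult_left_mono)
  also have "\<dots> \<le> 1/4" using A_bound ray_in x t by auto
  finally have "norm (A (ray t x) (x - x0)) \<le> 1/4" using norm_blinfun order_trans by blast
  then have "norm (A (ray t x) (x - x0)) * norm v \<le> 1/4 * norm v" by (intro mult_right_mono) auto
  then show ?thesis using norm_blinfun[of "A (ray t x) (x - x0)" v] by simp
qed

lemma T_bound:
  assumes u: "continuous_on (ball x0 r) u" "\<And>x. x \<in> ball x0 r \<Longrightarrow> norm (u x) \<le> \<alpha>" and x: "x \<in> ball x0 r"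
  shows "norm (T u x) \<le> \<alpha> / 2"
proof -
  have "0 \<le> \<alpha>" using u(2)[OF x] norm_ge_zero order_trans by blast
  have "norm (rint u x t) \<le> \<alpha> / 4" if "t \<in> cbox 0 1" for t
    using bound1[OF x that, of "u (ray t x)"] u(2)[of "ray t x"] ray_in[OF x, of t] that unfolding rint_def by simp
  then show ?thesis
    using integral_bound[of 0 1 "rint u x" "\<alpha> / 4"] rint_cont1[OF u(1) x] \<open>0 \<le> \<alpha>\<close> unfolding T_def by simp
qed

text \<open>The first two terms of \<open>drint\<close> together cost
  \<open>c * \<alpha> / 4\<close> by \<open>A'_bound\<close>; the third, which contains
  \<open>u'\<close>, costs another quarter by \<open>bound1\<close>. Hence the common rate 1/2,
  although the values alone would shrink by 1/4.\<close>

lemma dT_bound: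
  assumes u: "continuous_on (ball x0 r) u" "\<And>x. x \<in> ball x0 r \<Longrightarrow> norm (u x) \<le> \<alpha>"
    and u': "continuous_on (ball x0 r) u'" "\<And>x. x \<in> ball x0 r \<Longrightarrow> norm (u' x) \<le> c * \<alpha>" and x: "x \<in> ball x0 r"
  shows "norm (dT u u' x) \<le> c * \<alpha> / 2"
proof -
  have a0: "0 \<le> \<alpha>" using u(2)[OF x] norm_ge_zero order_trans by blast
  have "norm (drint u u' x t) \<le> c * \<alpha> / 2" if t: "t \<in> cbox 0 1" for t
  proof (rule norm_blinfun_bound)
    show "0 \<le> c * \<alpha> / 2" using a0 c by simp
    fix k
    let ?p = "ray t x"
    have p: "?p \<in> ball x0 r" using ray_in x t by auto
    have xr: "norm (x - x0) \<le> r" using x by (simp add: dist_norm norm_minus_commute)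
    have "norm (A' ?p k (x - x0)) \<le> norm (A' ?p) * norm k * norm (x - x0)"
      by (meson norm_blinfun order_trans mult_right_mono norm_ge_zero)
    also have "\<dots> \<le> norm (A' ?p) * norm k * r" using xr by (simp add: mult_left_mono)
    finally have 1: "norm (A' ?p k (x - x0) (u ?p)) \<le> norm (A' ?p) * norm k * r * \<alpha>"
      by (rule order_trans[OF norm_blinfun mult_mono]) (use u(2)[OF p] r in auto)
    have 2: "norm (t *\<^sub>R A' ?p k (x - x0) (u ?p)) \<le> norm (A' ?p) * norm k * r * \<alpha>"
      using t 1 mult_left_le_one_le[of "norm (A' ?p k (x - x0) (u ?p))" t] by simp
    have 3: "norm (A ?p k (u ?p)) \<le> norm (A ?p) * norm k * \<alpha>"
      by (intro order_trans[OF norm_blinfun] mult_mono norm_blinfun) (use u(2)[OF p] in auto)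
    have "norm (u' ?p k) \<le> c * \<alpha> * norm k"
      by (intro order_trans[OF norm_blinfun] mult_right_mono) (use u'(2)[OF p] in auto)
    then have "norm (A ?p (x - x0) (u' ?p k)) \<le> c * \<alpha> * norm k / 4"
      using bound1[OF x t, of "u' ?p k"] by simp
    then have 4: "norm (t *\<^sub>R A ?p (x - x0) (u' ?p k)) \<le> c * \<alpha> * norm k / 4"
      using t mult_left_le_one_le[of "norm (A ?p (x - x0) (u' ?p k))" t] by simp
    have "norm (drint u u' x t k) \<le> norm (A' ?p) * norm k * r * \<alpha> + norm (A ?p) * norm k * \<alpha> + c * \<alpha> * norm k / 4"
      unfolding drint_apply by (intro norm_triangle_mono 2 3 4)
    also have "\<dots> = (norm (A' ?p) * r + norm (A ?p)) * (\<alpha> * norm k) + c * \<alpha> * norm k / 4" by (simp add: algebra_simps)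
    also have "\<dots> \<le> c / 4 * (\<alpha> * norm k) + c * \<alpha> * norm k / 4"
      using A'_bound[OF p] a0 by (intro add_right_mono mult_right_mono) auto
    finally show "norm (drint u u' x t k) \<le> c * \<alpha> / 2 * norm k" by (simp add: algebra_simps)
  qed
  then show ?thesis
    using integral_bound[of 0 1 "drint u u' x" "c * \<alpha> / 2"] drint_cont1[OF u(1) u'(1) x] unfolding dT_def by simp
qed

text \<open>The terms of the Neumann series of \<open>u = w + T u\<close>, obtained from the
  constant \<open>w\<close> by iterating \<open>T\<close>, each paired with its derivative so that
  the series can be differentiated term by term.\<close>

primrec U :: "'b \<Rightarrow> nat \<Rightarrow> ('a \<Rightarrow> 'b) \<times> ('a \<Rightarrow> 'a \<Rightarrow>\<^sub>L 'b)" where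
  "U w 0 = (\<lambda>x. w, \<lambda>x. 0)"
| "U w (Suc m) = (T (fst (U w m)), dT (fst (U w m)) (snd (U w m)))"

lemma U_props:
  "(\<forall>x\<in>ball x0 r. (fst (U w m) has_derivative snd (U w m) x) (at x)
     \<and> norm (fst (U w m) x) \<le> norm w * (1/2) ^ m \<and> norm (snd (U w m) x) \<le> c * (norm w * (1/2) ^ m))
   \<and> continuous_on (ball x0 r) (fst (U w m)) \<and> continuous_on (ball x0 r) (snd (U w m))"
proof (induction m)
  case 0
  then show ?case using c by simp
next
  case (Suc m)
  have d: "\<forall>x\<in>ball x0 r. (fst (U w (Suc m)) has_derivative snd (U w (Suc m)) x) (at x)"
    using Suc by (auto intro!: T_deriv)
  then have "continuous_on (ball x0 r) (fst (U w (Suc m)))"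
    by (meson continuous_at_imp_continuous_on has_derivative_continuous)
  then show ?case using d Suc T_bound[of "fst (U w m)" "norm w * (1/2) ^ m"]
     dT_bound[of "fst (U w m)" "norm w * (1/2) ^ m" "snd (U w m)"]
    by (auto intro!: dT_cont simp: field_simps)
qed

section \<open>The sum of the Neumann series\<close>

definition F :: "'b \<Rightarrow> 'a \<Rightarrow> 'b" where "F w x = (\<Sum>m. fst (U w m) x)"
definition dF :: "'b \<Rightarrow> 'a \<Rightarrow> 'a \<Rightarrow>\<^sub>L 'b" where "dF w x = (\<Sum>m. snd (U w m) x)"

lemma U_sums: assumes "x \<in> ball x0 r" shows "(\<lambda>m. fst (U w m) x) sums F w x"
  unfolding F_def
  by (rule summable_sums, rule summable_comparison_test'[of "\<lambda>m. norm w * (1/2) ^ m" 0])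
     (use U_props assms in \<open>auto intro!: summable_mult summable_geometric\<close>)

lemma tail_bound:
  fixes f :: "nat \<Rightarrow> 'c::banach"
  assumes "\<And>m. norm (f m) \<le> K * (1/2) ^ m"
  shows "summable f" "norm (suminf f - sum f {..<n}) \<le> 2 * K * (1/2) ^ n"
proof -
  show s: "summable f"
    by (rule summable_comparison_test'[of "\<lambda>m. K * (1/2) ^ m" 0]) (use assms in \<open>auto intro!: summable_mult summable_geometric\<close>)
  have "norm (suminf f - sum f {..<n}) = norm (\<Sum>m. f (m + n))"
    by (simp add: suminf_minus_initial_segment[OF s])
  also have "\<dots> \<le> (\<Sum>m. K * (1/2) ^ (m + n))"
    by (rule norm_suminf_le[OF assms]) (auto simp: power_add intro!: summable_mult summable_mult2 summable_geometric)
  also have "\<dots> = (\<Sum>m. K * (1/2) ^ n * (1/2) ^ m)" by (simp add: power_add mult_ac)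
  also have "\<dots> = K * (1/2) ^ n * (\<Sum>m. (1/2) ^ m)" by (rule suminf_mult) (simp add: summable_geometric)
  also have "\<dots> = K * (2 * (1/2) ^ n)" by (simp add: suminf_geometric)
  finally show "norm (suminf f - sum f {..<n}) \<le> 2 * K * (1/2) ^ n" by simp
qed

lemma half_power_tendsto: "((\<lambda>n. K * (1/2::real) ^ n) \<longlongrightarrow> 0) sequentially"
  by (intro tendsto_mult_right_zero LIMSEQ_power_zero) simp

lemma F_tail: assumes "x \<in> ball x0 r" shows "norm (F w x - (\<Sum>m<n. fst (U w m) x)) \<le> 2 * norm w * (1/2) ^ n"
  unfolding F_def by (rule tail_bound) (use U_props assms in auto)

lemma dF_tail: assumes "x \<in> ball x0 r" shows "norm (dF w x - (\<Sum>m<n. snd (U w m) x)) \<le> 2 * (c * norm w) * (1/2) ^ n"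
  unfolding dF_def by (rule tail_bound) (use U_props assms in \<open>auto simp: mult.assoc\<close>)

lemma dF_cont: "continuous_on (ball x0 r) (dF w)"
proof (rule uniform_limit_theorem)
  show "uniform_limit (ball x0 r) (\<lambda>n x. \<Sum>m<n. snd (U w m) x) (dF w) sequentially"
  proof (rule uniform_limitI)
    fix e :: real assume "e > 0"
    then have "\<forall>\<^sub>F n in sequentially. 2 * (c * norm w) * (1/2) ^ n < e"
      using order_tendstoD(2)[OF half_power_tendsto] by blast
    then show "\<forall>\<^sub>F n in sequentially. \<forall>x\<in>ball x0 r. dist (\<Sum>m<n. snd (U w m) x) (dF w x) < e"
    proof (rule eventually_mono, intro ballI)
      fix n x assume n: "2 * (c * norm w) * (1/2) ^ n < e" and "x \<in> ball x0 r"
      show "dist (\<Sum>m<n. snd (U w m) x) (dF w x) < e"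
        using dF_tail[OF \<open>x \<in> ball x0 r\<close>, of w n] n by (simp add: dist_norm norm_minus_commute)
    qed
  qed
  show "\<forall>\<^sub>F n in sequentially. continuous_on (ball x0 r) (\<lambda>x. \<Sum>m<n. snd (U w m) x)"
    using U_props by (auto intro!: always_eventually continuous_on_sum)
qed simp

lemma F_deriv: assumes x: "x \<in> ball x0 r" shows "(F w has_derivative dF w x) (at x)"
proof -
  have "\<exists>g. \<forall>x\<in>ball x0 r. (\<lambda>m. fst (U w m) x) sums g x \<and> (g has_derivative blinfun_apply (dF w x)) (at x within ball x0 r)"
  proof (rule has_derivative_series[where f'="\<lambda>m x. blinfun_apply (snd (U w m) x)"])
    show "(fst (U w m) has_derivative blinfun_apply (snd (U w m) x)) (at x within ball x0 r)" if "x \<in> ball x0 r" for m x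
      using U_props that has_derivative_at_withinI by blast
    fix e :: real assume "e > 0"
    then have "\<forall>\<^sub>F n in sequentially. 2 * (c * norm w) * (1/2) ^ n < e"
      using order_tendstoD(2)[OF half_power_tendsto] by blast
    then show "\<forall>\<^sub>F n in sequentially. \<forall>x\<in>ball x0 r. \<forall>h. norm ((\<Sum>m<n. snd (U w m) x h) - dF w x h) \<le> e * norm h"
    proof (rule eventually_mono, intro ballI allI)
      fix n x h assume n: "2 * (c * norm w) * (1/2) ^ n < e" and "x \<in> ball x0 r"
      have "norm ((\<Sum>m<n. snd (U w m) x h) - dF w x h) = norm ((dF w x - (\<Sum>m<n. snd (U w m) x)) h)"
        by (simp add: blinfun.diff_left blinfun.sum_left norm_minus_commute)
      also have "\<dots> \<le> e * norm h"
        using dF_tail[OF \<open>x \<in> ball x0 r\<close>, of w n] n by (intro order_trans[OF norm_blinfun] mult_right_mono) auto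
      finally show "norm ((\<Sum>m<n. snd (U w m) x h) - dF w x h) \<le> e * norm h" .
    qed
  qed (use x U_sums[OF x] in auto)
  then obtain g where g: "\<And>x. x \<in> ball x0 r \<Longrightarrow> (\<lambda>m. fst (U w m) x) sums g x"
    "(g has_derivative dF w x) (at x within ball x0 r)" using x by blast
  \<comment> \<open>The theorem on series provides an unspecified sum \<open>g\<close>, which is
    identified with \<open>F w\<close> on the ball.\<close>
  have "g y = F w y" if "y \<in> ball x0 r" for y
    using g(1)[OF that] U_sums[OF that] sums_unique2 by blast
  then show ?thesis using g(2) x has_derivative_transform_within_open[of g _ x "UNIV" "ball x0 r" "F w"]
    by (simp add: at_within_open[OF x])
qed

lemma F_cont: "continuous_on (ball x0 r) (F w)"
  using F_deriv by (meson continuous_at_imp_continuous_on has_derivative_continuous)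

text \<open>\<open>T\<close> is linear and moves each term to the next one. Applied to a tail of the
  series it gives \<open>T (F w)\<close> minus a shifted partial sum, and \<open>T_bound\<close>
  sends this to 0. The shift costs exactly the first term, \<open>w\<close>.\<close>

lemma F_fixpoint: assumes x: "x \<in> ball x0 r" shows "F w x = w + T (F w) x"
proof -
  have S: "T (\<lambda>y. F w y - (\<Sum>m<n. fst (U w m) y)) x = T (F w) x - (\<Sum>m<n. fst (U w (Suc m)) x)" for n
  proof -
    have i: "rint (F w) x integrable_on {0..1}" "\<And>m. rint (fst (U w m)) x integrable_on {0..1}"
      using integrable_continuous[OF rint_cont1[OF F_cont x]]
        integrable_continuous[OF rint_cont1[OF _ x]] U_props by auto
    have "rint (\<lambda>y. F w y - (\<Sum>m<n. fst (U w m) y)) x = (\<lambda>t. rint (F w) x t - (\<Sum>m<n. rint (fst (U w m)) x t))"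
      unfolding rint_def by (simp add: fun_eq_iff blinfun.diff_right blinfun.sum_right)
    then show ?thesis unfolding T_def
      by (simp add: integral_diff integrable_sum i integral_sum T_def)
  qed
  have "norm (T (F w) x - (\<Sum>m<n. fst (U w (Suc m)) x)) \<le> norm w * (1/2) ^ n" for n
    using T_bound[of "\<lambda>y. F w y - (\<Sum>m<n. fst (U w m) y)" "2 * norm w * (1/2) ^ n" x] F_tail x U_props
    using continuous_on_diff[OF F_cont[of w] continuous_on_sum[of "{..<n}" "ball x0 r" "\<lambda>m. fst (U w m)"]] U_props
    unfolding S by auto
  then have "(\<lambda>n. T (F w) x - (\<Sum>m<n. fst (U w (Suc m)) x)) \<longlonglongrightarrow> 0"
    by (intro Lim_null_comparison[OF always_eventually half_power_tendsto]) auto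
  then have "(\<lambda>n. \<Sum>m<n. fst (U w (Suc m)) x) \<longlonglongrightarrow> T (F w) x"
    using tendsto_diff[OF tendsto_const[of "T (F w) x"]] by fastforce
  then have "(\<lambda>m. fst (U w m) x) sums (T (F w) x + fst (U w 0) x)"
    unfolding sums_def[symmetric] by (rule sums_Suc_iff[of "\<lambda>m. fst (U w m) x", THEN iffD1])
  then have "F w x = T (F w) x + fst (U w 0) x" by (rule sums_unique2[OF U_sums[OF x]])
  then show ?thesis by (simp add: add.commute)
qed

lemma F_center: "F w x0 = w"
proof -
  have "rint (F w) x0 = (\<lambda>t. 0)" by (simp add: rint_def fun_eq_iff)
  then show ?thesis using F_fixpoint[of x0 w] r by (simp add: T_def)
qed

lemma dF_fixpoint: assumes x: "x \<in> ball x0 r" shows "dF w x = dT (F w) (dF w) x"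
proof -
  have "((\<lambda>x. w + T (F w) x) has_derivative (\<lambda>k. 0 + dT (F w) (dF w) x k)) (at x)"
    by (intro has_derivative_add has_derivative_const T_deriv F_deriv dF_cont x)
  then have "(F w has_derivative dT (F w) (dF w) x) (at x)"
    using has_derivative_transform_within_open[OF _ open_ball x, of _ _ UNIV "F w"] F_fixpoint by simp
  then show ?thesis using has_derivative_unique[OF F_deriv[OF x, of w]] by (simp add: blinfun_apply_inject[symmetric])
qed

text \<open>The derivative in \<open>t\<close> of
  \<open>t *\<^sub>R A (ray t x) k (F w (ray t x))\<close>. This product vanishes at
  \<open>t = 0\<close> and is the right-hand side of the system at \<open>t = 1\<close>, so that
  side becomes an integral comparable with the one of \<open>drint\<close>.\<close>

definition radial :: "'b \<Rightarrow> 'a \<Rightarrow> 'a \<Rightarrow> real \<Rightarrow> 'b" where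
  "radial w x k t = A (ray t x) k (F w (ray t x)) + t *\<^sub>R A' (ray t x) (x - x0) k (F w (ray t x))
     + t *\<^sub>R A (ray t x) k (dF w (ray t x) (x - x0))"

lemma radial_integral:
  assumes x: "x \<in> ball x0 r"
  shows "(radial w x k has_integral A x k (F w x)) {0..1}"
proof -
  have d: "((\<lambda>t. t *\<^sub>R A (ray t x) k (F w (ray t x))) has_vector_derivative radial w x k t) (at t)"
    if t: "t \<in> {0..1}" for t
  proof -
    have p: "ray t x \<in> ball x0 r" using x t ray_in by auto
    have dr: "((\<lambda>t. ray t x) has_derivative (\<lambda>s. s *\<^sub>R (x - x0))) (at t)"
      unfolding ray_def by (auto intro!: derivative_eq_intros)
    note dA = has_derivative_compose[OF dr A_deriv[OF p]]
    note dFr = has_derivative_compose[OF dr F_deriv[OF p]]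
    show ?thesis unfolding has_vector_derivative_def
      by (rule has_derivative_eq_rhs, rule derivative_intros, rule has_derivative_ident, rule derivative_intros,
          rule derivative_intros, rule dA, rule has_derivative_const, rule dFr)
         (auto simp: fun_eq_iff radial_def blinfun.bilinear_simps algebra_simps)
  qed
  have "(radial w x k has_integral (1 *\<^sub>R A (ray 1 x) k (F w (ray 1 x)) - 0 *\<^sub>R A (ray 0 x) k (F w (ray 0 x)))) {0..1}"
    by (rule fundamental_theorem_of_calculus[OF _ has_vector_derivative_at_within[OF d]]) auto
  then show ?thesis by (simp add: ray_def)
qed

lemma dF_integral:
  assumes x: "x \<in> ball x0 r"
  shows "((\<lambda>t. drint (F w) (dF w) x t k) has_integral dF w x k) {0..1}"
proof -
  have "(drint (F w) (dF w) x has_integral dF w x) {0..1}"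
    unfolding dF_fixpoint[OF x] dT_def
    using integrable_integral[OF integrable_continuous[OF drint_cont1[OF F_cont dF_cont x]]] by simp
  from has_integral_linear[OF this blinfun.bounded_linear_left, of k] show ?thesis by (simp add: o_def)
qed

text \<open>For \<open>k = x - x0\<close> the integrands \<open>drint\<close> and
  \<open>radial\<close> coincide identically, so along rays the equation holds without any
  integrability condition.\<close>

lemma dF_radial:
  assumes x: "x \<in> ball x0 r"
  shows "dF w x (x - x0) = A x (x - x0) (F w x)"
proof -
  have "(\<lambda>t. drint (F w) (dF w) x t (x - x0)) = radial w x (x - x0)"
    by (simp add: fun_eq_iff drint_apply radial_def)
  then show ?thesis using has_integral_unique[OF dF_integral[OF x, of w "x - x0"]] radial_integral[OF x] by metis
qed

section \<open>Consequences of flatness\<close>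

context
  assumes compat: "\<And>x h k v. x \<in> ball x0 r \<Longrightarrow>
    A' x k h v + A x h (A x k v) = A' x h k v + A x k (A x h v)"
begin

text \<open>Both sides of the equation are integrals along the ray. Flatness exchanges the two
  arguments of \<open>A'\<close>, and what is left of the difference of the integrands is
  \<open>A\<close> in the ray direction applied to the defect itself: a homogeneous integral
  equation.\<close>

lemma defect_integral:
  assumes x: "x \<in> ball x0 r"
  shows "((\<lambda>t. t *\<^sub>R A (ray t x) (x - x0) (dF w (ray t x) k - A (ray t x) k (F w (ray t x))))
     has_integral dF w x k - A x k (F w x)) {0..1}"
proof (rule has_integral_eq[OF _ has_integral_diff[OF dF_integral[OF x, of w k] radial_integral[OF x, of w k]]])
  fix t :: real assume t: "t \<in> {0..1}"
  let ?p = "ray t x"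
  have p: "?p \<in> ball x0 r" using x t ray_in by auto
  have ray: "?p - x0 = t *\<^sub>R (x - x0)" by (simp add: ray_def)
  \<comment> \<open>Absorbing \<open>t\<close> into \<open>x - x0\<close> gives the displacement of
    the ray point, so \<open>dF_radial\<close> applies there and no division by \<open>t\<close>
    occurs.\<close>
  have "t *\<^sub>R A ?p k (dF w ?p (x - x0)) = A ?p k (dF w ?p (?p - x0))"
    by (simp add: ray blinfun.scaleR_right)
  also have "\<dots> = t *\<^sub>R A ?p k (A ?p (x - x0) (F w ?p))"
    unfolding dF_radial[OF p] by (simp add: ray blinfun.bilinear_simps)
  finally have 1: "t *\<^sub>R A ?p k (dF w ?p (x - x0)) = t *\<^sub>R A ?p k (A ?p (x - x0) (F w ?p))" .
  have "A' ?p k (x - x0) (F w ?p) = A' ?p (x - x0) k (F w ?p) + A ?p k (A ?p (x - x0) (F w ?p)) - A ?p (x - x0) (A ?p k (F w ?p))"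
    using compat[OF p, of k "x - x0" "F w ?p"] by (simp add: algebra_simps)
  then show "drint (F w) (dF w) x t k - radial w x k t
     = t *\<^sub>R A ?p (x - x0) (dF w ?p k - A ?p k (F w ?p))"
    unfolding drint_apply radial_def 1 by (simp add: blinfun.diff_right scaleR_right_diff_distrib scaleR_right_distrib)
qed

lemma defect_halves:
  assumes M: "\<And>x. x \<in> ball x0 r \<Longrightarrow> norm (dF w x k - A x k (F w x)) \<le> M" and x: "x \<in> ball x0 r"
  shows "norm (dF w x k - A x k (F w x)) \<le> M / 2"
proof -
  have "0 \<le> M" using M[OF x] norm_ge_zero order_trans by blast
  have "norm (t *\<^sub>R A (ray t x) (x - x0) (dF w (ray t x) k - A (ray t x) k (F w (ray t x)))) \<le> M / 2"
    if t: "t \<in> cbox 0 1" for t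
  proof -
    let ?d = "dF w (ray t x) k - A (ray t x) k (F w (ray t x))"
    have "norm (A (ray t x) (x - x0) ?d) \<le> M / 4"
      using bound1[OF x t, of ?d] M[OF ray_in[OF x, of t]] t by simp
    moreover have "norm (t *\<^sub>R A (ray t x) (x - x0) ?d) \<le> norm (A (ray t x) (x - x0) ?d)"
      using t by (simp add: mult_left_le_one_le)
    ultimately show ?thesis using \<open>0 \<le> M\<close> by simp
  qed
  moreover have "((\<lambda>t. t *\<^sub>R A (ray t x) (x - x0) (dF w (ray t x) k - A (ray t x) k (F w (ray t x))))
     has_integral dF w x k - A x k (F w x)) (cbox 0 1)"
    using defect_integral[OF x, of w k] by simp
  ultimately have "norm (dF w x k - A x k (F w x)) \<le> M / 2 * measure lborel (cbox 0 (1::real))"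
    by (intro has_integral_bound[where f="\<lambda>t. t *\<^sub>R A (ray t x) (x - x0) (dF w (ray t x) k - A (ray t x) k (F w (ray t x)))"])
       (use \<open>0 \<le> M\<close> in auto)
  then show ?thesis by simp
qed

lemma solution:
  assumes x: "x \<in> ball x0 r"
  shows "(F w has_derivative (\<lambda>h. A x h (F w x))) (at x)"
proof -
  have "dF w x k = A x k (F w x)" for k
  proof -
    \<comment> \<open>The tail bounds with empty partial sum give \<open>2 * norm w\<close> for
      \<open>F w\<close> and \<open>2 * (c * norm w)\<close> for \<open>dF w\<close>; together with
      \<open>norm (A y) \<le> c / 2\<close> they yield this start value for the repeated
      halving.\<close>
    define M where "M = (2 * (c * norm w) + c * norm w) * norm k"
    have M0: "norm (dF w y k - A y k (F w y)) \<le> M" if y: "y \<in> ball x0 r" for y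
    proof -
      have f: "norm (F w y) \<le> 2 * norm w" "norm (dF w y) \<le> 2 * (c * norm w)"
        using F_tail[OF y, of w 0] dF_tail[OF y, of w 0] by auto
      have "0 \<le> norm (A' y) * r" using r by simp
      then have a: "norm (A y) \<le> c / 2" using A'_bound[OF y] c by linarith
      have 1: "norm (dF w y k) \<le> 2 * (c * norm w) * norm k"
        by (intro order_trans[OF norm_blinfun] mult_right_mono f) auto
      have "norm (A y k (F w y)) \<le> (norm (A y) * norm k) * norm (F w y)"
        by (intro order_trans[OF norm_blinfun] mult_right_mono norm_blinfun) auto
      also have "\<dots> \<le> (c / 2 * norm k) * (2 * norm w)"
        by (intro mult_mono f a) (use c in auto)
      finally have 2: "norm (A y k (F w y)) \<le> c * norm w * norm k" by (simp add: algebra_simps)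
      show ?thesis using norm_triangle_ineq4[of "dF w y k" "A y k (F w y)"] 1 2
        unfolding M_def by (simp add: algebra_simps)
    qed
    have "norm (dF w y k - A y k (F w y)) \<le> M * (1/2) ^ n" if "y \<in> ball x0 r" for y n
      using that
    proof (induction n arbitrary: y)
      case 0
      then show ?case using M0 by simp
    next
      case (Suc n)
      then show ?case using defect_halves[of w k "M * (1/2) ^ n" y] by simp
    qed
    then have "norm (dF w x k - A x k (F w x)) \<le> 0"
      using x by (intro LIMSEQ_le_const[OF half_power_tendsto]) blast
    then show ?thesis by simp
  qed
  then have "blinfun_apply (dF w x) = (\<lambda>h. A x h (F w x))" by auto
  then show ?thesis using F_deriv[OF x, of w] by simp
qed

end

end

text \<open>A Frobenius theorem for linear systems. The radius is fixed by the domain and a bound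
  for \<open>A\<close> alone, so it serves every initial value \<open>w\<close>.\<close>

theorem linear_total_differential:
  fixes A :: "'a::euclidean_space \<Rightarrow> 'a \<Rightarrow>\<^sub>L 'b \<Rightarrow>\<^sub>L 'b::banach"
  assumes S: "open S" "x0 \<in> S" and A: "smooth_on A S"
    and compat: "\<And>x h k v. x \<in> S \<Longrightarrow> frechet_derivative A (at x) k h v + A x h (A x k v)
        = frechet_derivative A (at x) h k v + A x k (A x h v)"
  obtains r where "r > 0" "ball x0 r \<subseteq> S"
    "\<And>w. \<exists>u. u x0 = w \<and> (\<forall>x\<in>ball x0 r. (u has_derivative (\<lambda>h. A x h (u x))) (at x))"
proof -
  define A' where "A' x = Blinfun (frechet_derivative A (at x))" for x
  have A': "blinfun_apply (A' x) = frechet_derivative A (at x)" if "x \<in> S" for x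
    unfolding A'_def
    by (rule bounded_linear_Blinfun_apply, rule has_derivative_bounded_linear, rule smooth_on_has_derivative[OF A that])
  have dA: "(A has_derivative A' x) (at x)" if "x \<in> S" for x
    using smooth_on_has_derivative[OF A that] by (simp add: A'[OF that])
  \<comment> \<open>In finite dimension, continuity in the operator norm follows from continuity in
    each fixed direction.\<close>
  have cA': "continuous_on S A'"
  proof (rule continuous_on_blinfun_componentwise)
    fix i :: 'a
    have "continuous_on S (\<lambda>x. frechet_derivative A (at x) i)"
      by (rule smooth_on_imp_continuous_on[OF smooth_on_frechet_derivative[OF A]])
    then show "continuous_on S (\<lambda>x. A' x i)" by (rule continuous_on_eq) (simp add: A')
  qed
  obtain R where R: "R > 0" "cball x0 R \<subseteq> S" using S open_contains_cball by blast
  have "bounded (A ` cball x0 R)" "bounded (A' ` cball x0 R)"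
    by (auto intro!: compact_imp_bounded compact_continuous_image continuous_on_subset[OF _ R(2)]
        smooth_on_imp_continuous_on[OF A] cA')
  then obtain a a' where a: "\<And>x. x \<in> cball x0 R \<Longrightarrow> norm (A x) \<le> a" "\<And>x. x \<in> cball x0 R \<Longrightarrow> norm (A' x) \<le> a'"
    unfolding bounded_iff ball_simps by blast
  have a0: "0 \<le> a" "0 \<le> a'" using a[of x0] R(1) norm_ge_zero order_trans by (metis centre_in_cball less_imp_le)+
  \<comment> \<open>\<open>r\<close> is made for \<open>A_bound\<close> and \<open>c\<close> for
    \<open>A'_bound\<close>; the added 1 keeps the denominator and \<open>c\<close>
    positive.\<close>
  define r where "r = min R (1 / (4 * (a + 1)))"
  define c where "c = 4 * (a' * r + a + 1)"
  have r: "r > 0" "r \<le> R" "r * (4 * (a + 1)) \<le> 1"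
    using R a0 by (auto simp: r_def min_def field_simps)
  have sub: "ball x0 r \<subseteq> cball x0 R" using r(2) by auto
  interpret radial_system A A' x0 r c
  proof
    show "r > 0" by fact
    show "c > 0" using a0 r by (auto simp: c_def intro!: add_nonneg_pos)
    show "(A has_derivative A' x) (at x)" if "x \<in> ball x0 r" for x using dA that sub R(2) by blast
    show "continuous_on (ball x0 r) A'" using cA' sub R(2) continuous_on_subset by blast
    show "norm (A x) * r \<le> 1 / 4" if "x \<in> ball x0 r" for x
    proof -
      have "norm (A x) * r \<le> (a + 1) * r" using a(1)[of x] that sub r(1) by (intro mult_right_mono) force+
      then show ?thesis using r(3) by (simp add: algebra_simps)
    qed
    show "norm (A' x) * r + norm (A x) \<le> c / 4" if "x \<in> ball x0 r" for x
    proof -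
      have "norm (A' x) * r \<le> a' * r" using a(2)[of x] that sub r(1) by (intro mult_right_mono) auto
      then show ?thesis using a(1)[of x] that sub by (force simp: c_def)
    qed
  qed
  have "(F w has_derivative (\<lambda>h. A x h (F w x))) (at x)" if "x \<in> ball x0 r" for x w
  proof (rule solution[OF _ that])
    fix y h k v assume "y \<in> ball x0 r"
    then have "y \<in> S" using sub R(2) by blast
    then show "A' y h k v + A y k (A y h v) = A' y k h v + A y h (A y k v)"
      using compat[of y k h v] by (simp add: A')
  qed
  then show ?thesis using that[OF r(1)] sub R(2) F_center by blast
qed

text \<open>Bootstrapping through the equation: the derivative of \<open>u\<close> is
  \<open>A\<close> applied to \<open>u\<close>, so it is as often differentiable as
  \<open>u\<close>.\<close>

lemma linear_system_solution_smooth: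
  fixes A :: "'a::euclidean_space \<Rightarrow> 'a \<Rightarrow>\<^sub>L 'b \<Rightarrow>\<^sub>L 'b::banach"
  assumes S: "open S" and A: "smooth_on A S"
    and u: "\<And>x. x \<in> S \<Longrightarrow> (u has_derivative (\<lambda>h. A x h (u x))) (at x)"
  shows "smooth_on u S"
proof -
  have "Ck_on k u S" for k
  proof (induction k)
    case 0
    show ?case using u by (auto intro!: continuous_at_imp_continuous_on dest: has_derivative_continuous)
  next
    case (Suc k)
    have "Ck_on k (\<lambda>x. A x v (u x)) S" for v
    proof -
      have "Ck_on k (\<lambda>x. A x v) S"
        by (rule Ck_on_linear_compose[OF S blinfun.bounded_linear_left]) (use A in \<open>auto simp: smooth_on_def\<close>)
      then show ?thesis by (rule Ck_on_bilinear[OF S bounded_bilinear_blinfun_apply _ Suc])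
    qed
    then show ?case by (intro Ck_on_SucI[where f'="\<lambda>x h. A x h (u x)", OF S u])
  qed
  then show ?thesis by (simp add: smooth_on_def)
qed

text \<open>On a ball where \<open>\<bar>K\<bar>\<close> times the radius is at most 1/2, the mean
  value inequality halves any bound of \<open>v\<close>, since \<open>v\<close> vanishes at the
  centre. Repetition from the bound 1 forces \<open>v\<close> to be 0.\<close>

lemma linear_system_unique:
  fixes v :: "'a::real_normed_vector \<Rightarrow> 'b::real_normed_vector"
  assumes S: "open S" "x0 \<in> S" and v0: "v x0 = 0"
    and v: "\<And>x. x \<in> S \<Longrightarrow> (v has_derivative v' x) (at x)"
    and K: "\<And>x h. x \<in> S \<Longrightarrow> norm (v' x h) \<le> K * norm h * norm (v x)"
  obtains r where "r > 0" "ball x0 r \<subseteq> S" "\<And>x. x \<in> ball x0 r \<Longrightarrow> v x = 0"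
proof -
  have "isCont v x0" using v[OF S(2)] has_derivative_continuous by blast
  then obtain d where d: "d > 0" "\<And>y. dist y x0 < d \<Longrightarrow> dist (v y) (v x0) < 1"
    unfolding continuous_at_eps_delta using zero_less_one by blast
  obtain R where R: "R > 0" "ball x0 R \<subseteq> S" using S openE by blast
  define r where "r = Min {d, R, 1 / (2 * (\<bar>K\<bar> + 1))}"
  have r: "r > 0" "r \<le> d" "r \<le> R" "r \<le> 1 / (2 * (\<bar>K\<bar> + 1))" using d R by (auto simp: r_def)
  have rK: "\<bar>K\<bar> * r \<le> 1 / 2"
  proof -
    have "r * (2 * (\<bar>K\<bar> + 1)) \<le> 1"
      using r(4) by (subst (asm) pos_le_divide_eq) auto
    then show ?thesis using r(1) by (simp add: algebra_simps)
  qed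
  have sub: "ball x0 r \<subseteq> S" using r(3) R(2) by auto
  have halves: "norm (v x) \<le> M / 2" if M: "\<And>x. x \<in> ball x0 r \<Longrightarrow> norm (v x) \<le> M" and x: "x \<in> ball x0 r" for M x
  proof -
    have M0: "0 \<le> M" using M[OF x] norm_ge_zero order_trans by blast
    have "norm (v x - v x0) \<le> \<bar>K\<bar> * M * norm (x - x0)"
    proof (rule differentiable_bound[of "ball x0 r" v v'])
      show "(v has_derivative v' y) (at y within ball x0 r)" if "y \<in> ball x0 r" for y
        using v that sub has_derivative_at_withinI by blast
      show "onorm (v' y) \<le> \<bar>K\<bar> * M" if y: "y \<in> ball x0 r" for y
      proof (rule onorm_bound)
        fix h
        have "norm (v' y h) \<le> K * norm h * norm (v y)" using K y sub by blast
        also have "\<dots> \<le> \<bar>K\<bar> * norm h * M"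
          by (intro mult_mono M y) auto
        finally show "norm (v' y h) \<le> \<bar>K\<bar> * M * norm h" by (simp add: algebra_simps)
      qed (use M0 in simp)
    qed (use x r in auto)
    also have "\<dots> \<le> \<bar>K\<bar> * M * r" using x M0 by (intro mult_left_mono) (auto simp: dist_norm norm_minus_commute)
    also have "\<dots> = M * (\<bar>K\<bar> * r)" by simp
    also have "\<dots> \<le> M * (1 / 2)" by (intro mult_left_mono rK M0)
    finally show ?thesis using v0 by simp
  qed
  have b: "norm (v x) \<le> (1/2) ^ n" if "x \<in> ball x0 r" for x n
    using that
  proof (induction n arbitrary: x)
    case 0
    then show ?case using d(2)[of x] r(2) v0 by (simp add: dist_commute)
  next
    case (Suc n)
    then show ?case using halves[of "(1/2) ^ n"] by simp
  qed
  have "v x = 0" if "x \<in> ball x0 r" for x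
  proof -
    have "(\<lambda>n. (1/2::real) ^ n) \<longlonglongrightarrow> 0" by (intro LIMSEQ_power_zero) simp
    then have "norm (v x) \<le> 0" by (rule LIMSEQ_le_const) (use b[OF that] in blast)
    then show ?thesis by simp
  qed
  then show ?thesis using that[OF r(1) sub] by blast
qed

section \<open>Linear algebra of symmetric bilinear forms\<close>

definition form :: "real^'d^'d \<Rightarrow> real^'d \<Rightarrow> real^'d::finite \<Rightarrow> real" where
  "form \<eta> u v = u \<bullet> (\<eta> *v v)"

lemma bounded_bilinear_form: "bounded_bilinear (form \<eta>)"
  unfolding form_def[abs_def]
  using bounded_bilinear.comp[OF bounded_bilinear_inner bounded_linear_ident matrix_vector_mul_bounded_linear] .

interpretation form: bounded_bilinear "form \<eta>" for \<eta>
  by (rule bounded_bilinear_form)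

lemma form_commute: "transpose \<eta> = \<eta> \<Longrightarrow> form \<eta> u v = form \<eta> v u"
  unfolding form_def by (metis dot_lmul_matrix inner_commute transpose_matrix_vector)

lemma form_eq_sum: "form \<eta> u v = (\<Sum>i\<in>UNIV. \<Sum>j\<in>UNIV. \<eta> $ i $ j * u $ i * v $ j)"
  by (simp add: form_def inner_vec_def matrix_vector_mult_def sum_distrib_left mult_ac)

text \<open>For a frame stored in the rows of \<open>F\<close> and having Gram matrix
  \<open>H\<close>, this is the completeness relation; it holds because a right inverse of a square
  matrix is a left inverse.\<close>

lemma gram_completeness:
  fixes F \<eta> H Hi :: "real^'d^'d"
  assumes "F ** \<eta> ** transpose F = H" "H ** Hi = mat 1"
  shows "\<eta> ** transpose F ** Hi ** F = mat 1"
proof -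
  have "F ** (\<eta> ** transpose F ** Hi) = mat 1" using assms by (simp add: matrix_mul_assoc)
  then show ?thesis using matrix_left_right_inverse by blast
qed

lemma matrix_inv_right: assumes "invertible A" shows "A ** matrix_inv A = mat 1"
  using someI_ex[OF assms[unfolded invertible_def]] unfolding matrix_inv_def by auto

lemma sum_delta_times:
  fixes f :: "'a \<Rightarrow> 'b::semiring_0"
  assumes "finite N" "A \<in> N"
  shows "(\<Sum>C\<in>N. (if A = C then c C else 0) * f C) = c A * f A"
    "(\<Sum>C\<in>N. (if C = A then c C else 0) * f C) = c A * f A"
    "(\<Sum>C\<in>N. f C * (if A = C then c C else 0)) = f A * c A"
    "(\<Sum>C\<in>N. f C * (if C = A then c C else 0)) = f A * c A"
proof -
  have "(\<Sum>C\<in>N. (if A = C then c C else 0) * f C) = (\<Sum>C\<in>N. if A = C then c C * f C else 0)"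
    "(\<Sum>C\<in>N. (if C = A then c C else 0) * f C) = (\<Sum>C\<in>N. if A = C then c C * f C else 0)"
    "(\<Sum>C\<in>N. f C * (if A = C then c C else 0)) = (\<Sum>C\<in>N. if A = C then f C * c C else 0)"
    "(\<Sum>C\<in>N. f C * (if C = A then c C else 0)) = (\<Sum>C\<in>N. if A = C then f C * c C else 0)"
    by (auto intro!: sum.cong)
  then show "(\<Sum>C\<in>N. (if A = C then c C else 0) * f C) = c A * f A"
    "(\<Sum>C\<in>N. (if C = A then c C else 0) * f C) = c A * f A"
    "(\<Sum>C\<in>N. f C * (if A = C then c C else 0)) = f A * c A"
    "(\<Sum>C\<in>N. f C * (if C = A then c C else 0)) = f A * c A"
    using assms by simp_all
qed

lemma mat_1_nth: "mat 1 $ i $ j = (if i = j then 1 else 0)"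
  by (simp add: mat_def)

text \<open>Adds to the definition of the signature the completeness relation of the basis, which
  also shows that \<open>G\<close> is nondegenerate. The Gram matrix of the basis is a diagonal of
  signs, hence its own inverse.\<close>

lemma signature_basis:
  fixes G :: "real^'n^'n"
  assumes "has_signature G r s"
  obtains \<sigma> :: "'n \<Rightarrow> real" and e :: "'n \<Rightarrow> real^'n" where "\<And>i. \<sigma> i = 1 \<or> \<sigma> i = (-1::real)" "card {i. \<sigma> i = 1} = r" "card {i. \<sigma> i = -1} = s"
    "\<And>i j. form G (e i) (e j) = (if i = j then \<sigma> i else 0)"
    "\<And>i j. (\<Sum>k\<in>UNIV. \<sigma> k * (G *v e k) $ i * e k $ j) = (if i = j then 1 else 0)"
    "invertible G"
proof -
  obtain e :: "'n \<Rightarrow> real^'n" and \<sigma> where e: "\<And>i. \<sigma> i = 1 \<or> \<sigma> i = (-1::real)" "card {i. \<sigma> i = 1} = r" "card {i. \<sigma> i = -1} = s"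
    "\<And>i j. form G (e i) (e j) = (if i = j then \<sigma> i else 0)"
  proof -
    obtain e :: "'n \<Rightarrow> real^'n" and \<sigma> where "(\<forall>i. \<sigma> i = 1 \<or> \<sigma> i = (-1::real)) \<and> card {i. \<sigma> i = 1} = r \<and> card {i. \<sigma> i = -1} = s \<and>
        (\<forall>i j. form G (e i) (e j) = (if i = j then \<sigma> i else 0))"
      using assms unfolding has_signature_def form_def by blast
    then show ?thesis by (intro that[of \<sigma> e]) simp_all
  qed
  define P :: "real^'n^'n" where "P = (\<chi> i. e i)"
  define T :: "real^'n^'n" where "T = (\<chi> i j. if i = j then \<sigma> i else 0)"
  have "P ** G ** transpose P = T"
    unfolding vec_eq_iff T_def
    by (simp add: e(4)[symmetric] form_eq_sum P_def matrix_matrix_mult_def transpose_def sum_distrib_left sum_distrib_right mult_ac)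
       (intro allI sum.swap)
  moreover have "T ** T = mat 1"
  proof -
    have "\<sigma> i * \<sigma> i = 1" for i using e(1)[of i] by auto
    then show ?thesis by (simp add: T_def vec_eq_iff matrix_matrix_mult_def mat_def sum_delta_times)
  qed
  ultimately have c: "G ** transpose P ** T ** P = mat 1" by (rule gram_completeness)
  have "(\<Sum>k\<in>UNIV. \<sigma> k * (G *v e k) $ i * e k $ j) = (G ** transpose P ** T ** P) $ i $ j" for i j
    by (simp add: matrix_matrix_mult_def T_def P_def transpose_def matrix_vector_mult_def if_distrib mult_ac cong: if_cong)
  then have 1: "(\<Sum>k\<in>UNIV. \<sigma> k * (G *v e k) $ i * e k $ j) = (if i = j then 1 else 0)" for i j
    by (simp add: c mat_1_nth)
  have "G ** (transpose P ** T ** P) = mat 1" using c by (simp add: matrix_mul_assoc)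
  then have "invertible G" using invertible_right_inverse by blast
  from that[OF e 1 this] show ?thesis .
qed

text \<open>Counting dimensions, some combination \<open>W c\<close> of the basis vectors of sign \<open>t\<close> is orthogonal to all
  members of the family that have sign \<open>t\<close>. Projecting off the members of the opposite sign only
  increases \<open>t\<close> times its square.\<close>
lemma orthonormal_extend:
  fixes \<eta> :: "real^'d^'d" and u :: "'i \<Rightarrow> real^'d::finite" and f :: "'d \<Rightarrow> real^'d"
  assumes sym: "transpose \<eta> = \<eta>" and t: "t = 1 \<or> t = (-1::real)"
    and f: "\<And>i j. form \<eta> (f i) (f j) = (if i = j then \<sigma> i else 0)"
    and I: "finite I" "\<And>a. a \<in> I \<Longrightarrow> s a = 1 \<or> s a = (-1::real)"
    and u: "\<And>a b. a \<in> I \<Longrightarrow> b \<in> I \<Longrightarrow> form \<eta> (u a) (u b) = (if a = b then s a else 0)"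
    and card: "card {a \<in> I. s a = t} < card {i. \<sigma> i = t}"
  obtains v where "form \<eta> v v = t" "\<And>a. a \<in> I \<Longrightarrow> form \<eta> (u a) v = 0"
proof -
  define J where "J = {a \<in> I. s a = t}"
  define V where "V = {c::real^'d. \<forall>i. i \<notin> {i. \<sigma> i = t} \<longrightarrow> c $ i = 0}"
  define W where "W c = (\<Sum>i\<in>UNIV. c $ i *\<^sub>R f i)" for c :: "real^'d"
  define L where "L c = (\<Sum>b\<in>J. form \<eta> (W c) (u b) *\<^sub>R u b)" for c
  have lW: "linear W" unfolding W_def
    by (rule linearI) (simp_all add: scaleR_left_distrib sum.distrib scaleR_sum_right)
  have lL: "linear L" unfolding L_def
    by (rule linearI) (simp_all add: linear_add[OF lW] linear_cmul[OF lW] form.add_left form.scaleR_left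
        scaleR_left_distrib sum.distrib scaleR_sum_right)
  have sV: "subspace V" unfolding V_def subspace_def by auto
  have dV: "dim V = card {i. \<sigma> i = t}"
    using dim_substandard_cart[where ?'a=real and d="{i. \<sigma> i = t}"] unfolding V_def dim_vec_eq .
  have fJ: "finite J" using I(1) by (simp add: J_def)
  have "L ` V \<subseteq> span (u ` J)" unfolding L_def by (intro image_subsetI span_sum span_scale) (auto intro: span_base)
  then have "dim (L ` V) \<le> card (u ` J)" by (rule dim_le_card) (use fJ in simp)
  also have "\<dots> \<le> card J" by (rule card_image_le[OF fJ])
  also have "\<dots> < dim V" using card by (simp add: J_def dV)
  finally have "\<not> inj_on L V"
    using dim_image_eq[OF lL, of V] span_eq_iff[THEN iffD2, OF sV] by force
  then obtain c where c: "c \<in> V" "c \<noteq> 0" "L c = 0"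
    using linear_injective_on_subspace_0[OF lL sV] by blast
  \<comment> \<open>\<open>L c = 0\<close> is a relation between the vectors \<open>u b\<close>;
    pairing it with one of them isolates its coefficient.\<close>
  have Jorth: "form \<eta> (W c) (u b) = 0" if b: "b \<in> J" for b
  proof -
    have "form \<eta> (L c) (u b) = (\<Sum>a\<in>J. form \<eta> (W c) (u a) * form \<eta> (u a) (u b))"
      by (simp add: L_def form.sum_left form.scaleR_left)
    also have "\<dots> = (\<Sum>a\<in>J. if a = b then form \<eta> (W c) (u b) * s b else 0)"
      using b by (intro sum.cong) (auto simp: u J_def)
    also have "\<dots> = form \<eta> (W c) (u b) * s b" using b fJ by simp
    finally show ?thesis using c(3) b I(2)[of b] by (auto simp: form.zero_left J_def)
  qed
  have "form \<eta> (W c) (W c) = (\<Sum>i\<in>UNIV. \<Sum>j\<in>UNIV. c $ i * (c $ j * form \<eta> (f i) (f j)))"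
    by (subst sum.swap) (simp add: W_def form.sum_left form.sum_right form.scaleR_left form.scaleR_right sum_distrib_left mult_ac)
  also have "\<dots> = (\<Sum>i\<in>UNIV. \<sigma> i * (c $ i)\<^sup>2)"
    by (simp add: f if_distrib power2_eq_square mult_ac cong: if_cong)
  also have "\<dots> = (\<Sum>i\<in>UNIV. t * (c $ i)\<^sup>2)"
    using c(1) by (intro sum.cong) (auto simp: V_def)
  finally have WW: "t * form \<eta> (W c) (W c) = (\<Sum>i\<in>UNIV. (c $ i)\<^sup>2)"
    using t by (auto simp: sum_distrib_left[symmetric])
  obtain i where "c $ i \<noteq> 0" using c(2) by (auto simp: vec_eq_iff)
  then have pos: "t * form \<eta> (W c) (W c) > 0"
    unfolding WW by (intro sum_pos2[of _ i]) auto
  define v where "v = W c - (\<Sum>a\<in>I. (s a * form \<eta> (W c) (u a)) *\<^sub>R u a)"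
  have vu: "form \<eta> v (u b) = 0" if b: "b \<in> I" for b
  proof -
    have "form \<eta> v (u b) = form \<eta> (W c) (u b) - (\<Sum>a\<in>I. s a * form \<eta> (W c) (u a) * form \<eta> (u a) (u b))"
      by (simp add: v_def form.diff_left form.sum_left form.scaleR_left)
    also have "(\<Sum>a\<in>I. s a * form \<eta> (W c) (u a) * form \<eta> (u a) (u b))
        = (\<Sum>a\<in>I. if a = b then s b * s b * form \<eta> (W c) (u b) else 0)"
      using b by (intro sum.cong) (auto simp: u)
    also have "\<dots> = form \<eta> (W c) (u b)" using b I(1) I(2)[OF b] by auto
    finally show ?thesis by simp
  qed
  have "form \<eta> v v = form \<eta> v (W c)"
  proof -
    have "form \<eta> v v = form \<eta> v (W c) - (\<Sum>a\<in>I. (s a * form \<eta> (W c) (u a)) * form \<eta> v (u a))"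
      by (subst (2) v_def) (simp add: form.diff_right form.sum_right form.scaleR_right)
    then show ?thesis using vu by simp
  qed
  also have "\<dots> = form \<eta> (W c) (W c) - (\<Sum>a\<in>I. s a * (form \<eta> (W c) (u a))\<^sup>2)"
    by (simp add: v_def form.diff_left form.sum_left form.scaleR_left form_commute[OF sym, of "u _" "W c"] power2_eq_square mult.assoc)
  finally have tvv: "t * form \<eta> v v = t * form \<eta> (W c) (W c) + (\<Sum>a\<in>I. - (t * s a) * (form \<eta> (W c) (u a))\<^sup>2)"
    by (simp add: right_diff_distrib sum_distrib_left sum_negf mult.assoc)
  have "(\<Sum>a\<in>I. - (t * s a) * (form \<eta> (W c) (u a))\<^sup>2) \<ge> 0"
  proof (rule sum_nonneg)
    fix a assume a: "a \<in> I"
    show "0 \<le> - (t * s a) * (form \<eta> (W c) (u a))\<^sup>2"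
    proof (cases "s a = t")
      case True
      then show ?thesis using Jorth a by (simp add: J_def)
    next
      case False
      then have "t * s a = -1" using t I(2)[OF a] by auto
      then show ?thesis by simp
    qed
  qed
  then have tv: "t * form \<eta> v v > 0" unfolding tvv using pos by linarith
  define z where "z = (1 / sqrt (t * form \<eta> v v)) *\<^sub>R v"
  have "form \<eta> z z = form \<eta> v v / (t * form \<eta> v v)"
    using tv by (simp add: z_def form.scaleR_left form.scaleR_right power2_eq_square[symmetric] real_sqrt_mult[symmetric]
        divide_simps)
  also have "\<dots> = t" using t tv by auto
  finally have "form \<eta> z z = t" .
  moreover have "form \<eta> (u a) z = 0" if "a \<in> I" for a
    using vu[OF that] form_commute[OF sym] by (simp add: z_def form.scaleR_right)
  ultimately show ?thesis by (rule that)
qed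

text \<open>Serves to label the basis of the ambient space by tangent and normal indices with
  matching signs.\<close>

lemma bij_betw_of_card_fibres:
  fixes \<sigma> :: "'a \<Rightarrow> real" and \<tau> :: "'b \<Rightarrow> real"
  assumes "finite A" "finite B" "\<And>a. a \<in> A \<Longrightarrow> \<sigma> a = 1 \<or> \<sigma> a = -1" "\<And>b. b \<in> B \<Longrightarrow> \<tau> b = 1 \<or> \<tau> b = -1"
    and "card {a \<in> A. \<sigma> a = 1} = card {b \<in> B. \<tau> b = 1}" "card {a \<in> A. \<sigma> a = -1} = card {b \<in> B. \<tau> b = -1}"
  obtains \<psi> where "bij_betw \<psi> A B" "\<And>a. a \<in> A \<Longrightarrow> \<tau> (\<psi> a) = \<sigma> a"
proof -
  obtain p where p: "bij_betw p {a \<in> A. \<sigma> a = 1} {b \<in> B. \<tau> b = 1}"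
    using assms finite_same_card_bij[of "{a \<in> A. \<sigma> a = 1}" "{b \<in> B. \<tau> b = 1}"] by auto
  obtain q where q: "bij_betw q {a \<in> A. \<sigma> a = -1} {b \<in> B. \<tau> b = -1}"
    using assms finite_same_card_bij[of "{a \<in> A. \<sigma> a = -1}" "{b \<in> B. \<tau> b = -1}"] by auto
  define \<psi> where "\<psi> a = (if \<sigma> a = 1 then p a else q a)" for a
  have 1: "bij_betw \<psi> {a \<in> A. \<sigma> a = 1} {b \<in> B. \<tau> b = 1}"
    using p by (rule bij_betw_cong[THEN iffD1, rotated]) (auto simp: \<psi>_def)
  have 2: "bij_betw \<psi> {a \<in> A. \<sigma> a = -1} {b \<in> B. \<tau> b = -1}"
    using q by (rule bij_betw_cong[THEN iffD1, rotated]) (auto simp: \<psi>_def)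
  have "bij_betw \<psi> ({a \<in> A. \<sigma> a = 1} \<union> {a \<in> A. \<sigma> a = -1}) ({b \<in> B. \<tau> b = 1} \<union> {b \<in> B. \<tau> b = -1})"
    by (rule bij_betw_combine[OF 1 2]) auto
  also have "{a \<in> A. \<sigma> a = 1} \<union> {a \<in> A. \<sigma> a = -1} = A" using assms(3) by auto
  also have "{b \<in> B. \<tau> b = 1} \<union> {b \<in> B. \<tau> b = -1} = B" using assms(4) by auto
  finally have "bij_betw \<psi> A B" .
  moreover have "\<tau> (\<psi> a) = \<sigma> a" if "a \<in> A" for a
    using assms(3)[OF that] that bij_betwE[OF 1] bij_betwE[OF 2] by auto
  ultimately show ?thesis by (rule that)
qed

section \<open>Block matrices indexed by tangent and normal directions\<close>

text \<open>Frames of the ambient space are square matrices over the index type \<open>'d\<close>,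
  and the labelling \<open>\<psi>\<close> reads an index as tangent or normal. The normal indices
  form a set and not a type, so the labels fill only a part of \<open>'n + nat\<close>.\<close>

locale block_index =
  fixes \<psi> :: "'d::finite \<Rightarrow> 'n::finite + nat" and N :: "nat set"
  assumes finite_N: "finite N" and \<psi>: "bij_betw \<psi> UNIV (UNIV <+> N)"
begin

definition mx :: "('n + nat \<Rightarrow> 'n + nat \<Rightarrow> real) \<Rightarrow> real^'d^'d" where
  "mx f = (\<chi> a b. f (\<psi> a) (\<psi> b))"

lemma sum_\<psi>: "(\<Sum>a\<in>UNIV. f (\<psi> a)) = (\<Sum>i\<in>UNIV. f (Inl i)) + (\<Sum>A\<in>N. f (Inr A))"
  for f :: "'n + nat \<Rightarrow> 'b::comm_monoid_add"
proof -
  have "(\<Sum>a\<in>UNIV. f (\<psi> a)) = sum f (UNIV <+> N)"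
    by (rule sum.reindex_bij_betw[OF \<psi>])
  then show ?thesis by (simp add: sum.Plus finite_N)
qed

lemma \<psi>_eq_iff: "\<psi> a = \<psi> b \<longleftrightarrow> a = b"
  using \<psi> by (auto simp: bij_betw_def inj_on_def)

lemma \<psi>_cases:
  obtains i where "\<psi> a = Inl i" | A where "A \<in> N" "\<psi> a = Inr A"
  using bij_betwE[OF \<psi>] by (metis PlusE UNIV_I)

lemma obtain_\<psi>:
  obtains \<iota> \<nu> where "\<And>i. \<psi> (\<iota> i) = Inl i" "\<And>A. A \<in> N \<Longrightarrow> \<psi> (\<nu> A) = Inr A"
proof -
  have "\<exists>a. \<psi> a = Inl i" for i using \<psi> by (metis InlI UNIV_I bij_betw_def image_iff)
  moreover have "\<exists>a. \<psi> a = Inr A" if "A \<in> N" for A using \<psi> that by (metis InrI bij_betw_def image_iff)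
  ultimately show ?thesis using that by metis
qed

lemma mx_nth: "mx f $ a $ b = f (\<psi> a) (\<psi> b)" by (simp add: mx_def)

lemma mx_mult: "mx f ** mx g = mx (\<lambda>z w. (\<Sum>i\<in>UNIV. f z (Inl i) * g (Inl i) w) + (\<Sum>A\<in>N. f z (Inr A) * g (Inr A) w))"
proof -
  have "(mx f ** mx g) $ a $ b = (\<Sum>i\<in>UNIV. f (\<psi> a) (Inl i) * g (Inl i) (\<psi> b)) + (\<Sum>A\<in>N. f (\<psi> a) (Inr A) * g (Inr A) (\<psi> b))" for a b
    using sum_\<psi>[of "\<lambda>z. f (\<psi> a) z * g z (\<psi> b)"] by (simp add: matrix_matrix_mult_def mx_def)
  then show ?thesis by (simp add: vec_eq_iff mx_nth)
qed

lemma mx_cong: 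
  assumes "\<And>i j. f (Inl i) (Inl j) = g (Inl i) (Inl j)" "\<And>i A. A \<in> N \<Longrightarrow> f (Inl i) (Inr A) = g (Inl i) (Inr A)"
   "\<And>i A. A \<in> N \<Longrightarrow> f (Inr A) (Inl i) = g (Inr A) (Inl i)" "\<And>A B. A \<in> N \<Longrightarrow> B \<in> N \<Longrightarrow> f (Inr A) (Inr B) = g (Inr A) (Inr B)"
  shows "mx f = mx g"
proof -
  have "f (\<psi> a) (\<psi> b) = g (\<psi> a) (\<psi> b)" for a b
    by (rule \<psi>_cases[of a]; rule \<psi>_cases[of b]) (simp_all add: assms)
  then show ?thesis by (simp add: mx_def)
qed

lemma mx_1: "mx (\<lambda>z w. if z = w then 1 else 0) = mat 1"
  by (simp add: vec_eq_iff mx_def mat_def \<psi>_eq_iff)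

definition blk :: "real^'n^'n \<Rightarrow> (nat \<Rightarrow> real) \<Rightarrow> 'n + nat \<Rightarrow> 'n + nat \<Rightarrow> real" where
  "blk G \<epsilon> z w = (case z of Inl i \<Rightarrow> (case w of Inl j \<Rightarrow> G $ i $ j | Inr B \<Rightarrow> 0)
      | Inr A \<Rightarrow> (case w of Inl j \<Rightarrow> 0 | Inr B \<Rightarrow> if A = B then \<epsilon> A else 0))"

lemma blk_simps [simp]:
  "blk G \<epsilon> (Inl i) (Inl j) = G $ i $ j" "blk G \<epsilon> (Inl i) (Inr B) = 0"
  "blk G \<epsilon> (Inr A) (Inl j) = 0" "blk G \<epsilon> (Inr A) (Inr B) = (if A = B then \<epsilon> A else 0)"
  by (simp_all add: blk_def)

text \<open>A sign is its own inverse, which is why the same \<epsilon> stands in both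
  matrices.\<close>

lemma blk_inverse:
  assumes "G ** Gi = mat 1" "\<And>A. A \<in> N \<Longrightarrow> \<epsilon> A = 1 \<or> \<epsilon> A = -1"
  shows "mx (blk G \<epsilon>) ** mx (blk Gi \<epsilon>) = mat 1"
proof -
  have G: "(\<Sum>k\<in>UNIV. G $ i $ k * Gi $ k $ j) = (if i = j then 1 else 0)" for i j
    using assms(1) by (simp add: matrix_matrix_mult_def mat_def vec_eq_iff)
  have \<epsilon>: "\<epsilon> A * \<epsilon> A = 1" if "A \<in> N" for A using assms(2)[OF that] by auto
  show ?thesis unfolding mx_mult mx_1[symmetric]
    by (rule mx_cong) (auto simp: G \<epsilon> sum_delta_times[OF finite_N])
qed

text \<open>A Parseval formula: the completeness relation of the frame is inserted between
  \<open>u\<close> and \<open>\<eta> *v v\<close>.\<close>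

lemma frame_completeness:
  fixes e :: "'n \<Rightarrow> real^'d" and n :: "nat \<Rightarrow> real^'d" and \<eta> :: "real^'d^'d"
  assumes sym: "transpose \<eta> = \<eta>"
    and G: "\<And>i j. form \<eta> (e i) (e j) = G $ i $ j" "G ** Gi = mat 1"
    and n: "\<And>i A. A \<in> N \<Longrightarrow> form \<eta> (e i) (n A) = 0"
      "\<And>A B. A \<in> N \<Longrightarrow> B \<in> N \<Longrightarrow> form \<eta> (n A) (n B) = (if A = B then \<epsilon> A else 0)"
    and \<epsilon>: "\<And>A. A \<in> N \<Longrightarrow> \<epsilon> A = 1 \<or> \<epsilon> A = -1"
  shows "form \<eta> u v = (\<Sum>l\<in>UNIV. \<Sum>m\<in>UNIV. Gi $ l $ m * form \<eta> u (e l) * form \<eta> v (e m))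
     + (\<Sum>A\<in>N. \<epsilon> A * form \<eta> u (n A) * form \<eta> v (n A))"
proof -
  define E where "E z = (case z of Inl i \<Rightarrow> e i | Inr A \<Rightarrow> n A)" for z
  define F :: "real^'d^'d" where "F = (\<chi> a. E (\<psi> a))"
  have "F ** \<eta> ** transpose F = mx (\<lambda>z w. form \<eta> (E z) (E w))"
    by (simp add: F_def mx_def vec_eq_iff form_eq_sum matrix_matrix_mult_def transpose_def sum_distrib_left sum_distrib_right mult_ac)
       (intro allI sum.swap)
  also have "\<dots> = mx (blk G \<epsilon>)"
    by (rule mx_cong) (auto simp: E_def G n form_commute[OF sym, of "n _" "e _"])
  finally have c: "\<eta> ** transpose F ** mx (blk Gi \<epsilon>) ** F = mat 1"
    by (rule gram_completeness[OF _ blk_inverse[OF G(2) \<epsilon>]])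
  have uF: "(u v* \<eta> v* transpose F) $ a = form \<eta> u (E (\<psi> a))" for a u
    by (simp add: form_eq_sum F_def vector_matrix_mult_def transpose_def sum_distrib_left sum_distrib_right mult_ac)
       (rule sum.swap)
  have vF: "(F *v (\<eta> *v v)) $ a = form \<eta> v (E (\<psi> a))" for a v
    unfolding form_commute[OF sym, of v]
    by (simp add: form_def F_def matrix_vector_mult_def inner_vec_def)
  have mxv: "(mx f *v y) $ a = (\<Sum>b\<in>UNIV. f (\<psi> a) (\<psi> b) * y $ b)" for f y a
    by (simp add: matrix_vector_mult_def mx_nth)
  have "form \<eta> u v = u \<bullet> ((\<eta> ** transpose F ** mx (blk Gi \<epsilon>) ** F) *v (\<eta> *v v))"
    unfolding c by (simp add: form_def)
  also have "\<dots> = (u v* \<eta> v* transpose F) \<bullet> (mx (blk Gi \<epsilon>) *v (F *v (\<eta> *v v)))"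
    by (simp only: dot_lmul_matrix matrix_vector_mul_assoc matrix_mul_assoc)
  also have "\<dots> = (\<Sum>a\<in>UNIV. form \<eta> u (E (\<psi> a)) * (\<Sum>b\<in>UNIV. blk Gi \<epsilon> (\<psi> a) (\<psi> b) * form \<eta> v (E (\<psi> b))))"
    by (simp only: inner_vec_def uF mxv vF inner_real_def)
  also have "\<dots> = (\<Sum>i\<in>UNIV. form \<eta> u (e i) * (\<Sum>j\<in>UNIV. Gi $ i $ j * form \<eta> v (e j)))
     + (\<Sum>A\<in>N. form \<eta> u (n A) * (\<Sum>B\<in>N. (if A = B then \<epsilon> A else 0) * form \<eta> v (n B)))"
    unfolding sum_\<psi>[of "\<lambda>w. blk Gi \<epsilon> _ w * form \<eta> v (E w)"]
    by (subst sum_\<psi>[of "\<lambda>z. form \<eta> u (E z) * _ z"]) (simp add: E_def)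
  also have "\<dots> = (\<Sum>l\<in>UNIV. \<Sum>m\<in>UNIV. Gi $ l $ m * form \<eta> u (e l) * form \<eta> v (e m))
     + (\<Sum>A\<in>N. \<epsilon> A * form \<eta> u (n A) * form \<eta> v (n A))"
    by (simp add: sum_distrib_left mult_ac if_distrib if_distribR finite_N cong: if_cong sum.cong)
  finally show ?thesis .
qed

end

section \<open>Smoothness of the inverse metric and orthonormal normal frames\<close>

lemma smooth_on_det:
  fixes M :: "_ \<Rightarrow> real^'n^'n"
  assumes "open S" "\<And>i j. smooth_on (\<lambda>x. M x $ i $ j) S"
  shows "smooth_on (\<lambda>x. det (M x)) S"
  unfolding det_def
  by (rule smooth_on_sum[OF assms(1)], rule smooth_on_mult[OF assms(1)], rule smooth_on_const[OF assms(1)],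
      rule smooth_on_prod[OF assms(1)], rule assms(2))

text \<open>Cramer's rule: column \<open>l\<close> of the inverse solves the linear system with
  right-hand side \<open>axis l 1\<close>, so its entries are quotients of determinants, which are
  polynomials in the entries of \<open>G x\<close>.\<close>

lemma smooth_on_metric_inv:
  fixes G :: "real^'n \<Rightarrow> real^'n::finite^'n"
  assumes S: "open S" and G: "smooth_on G S" and inv: "\<And>x. x \<in> S \<Longrightarrow> invertible (G x)"
  shows "smooth_on (metric_inv G k l) S"
proof -
  have Gij: "smooth_on (\<lambda>x. G x $ i $ j) S" for i j by (intro smooth_on_vec_nth S G)
  have d: "det (G x) \<noteq> 0" if "x \<in> S" for x using inv[OF that] by (simp add: invertible_det_nz)
  have e: "det (\<chi> i j. if j = k then axis l 1 $ i else G x $ i $ j) * inverse (det (G x)) = metric_inv G k l x"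
    if "x \<in> S" for x
  proof -
    have "G x *v (matrix_inv (G x) *v axis l 1) = axis l 1"
      by (simp add: matrix_vector_mul_assoc matrix_inv_right[OF inv[OF that]])
    then have "matrix_inv (G x) *v axis l 1 = (\<chi> k. det (\<chi> i j. if j = k then axis l 1 $ i else G x $ i $ j) / det (G x))"
      by (rule cramer[OF d[OF that], THEN iffD1])
    moreover have "(matrix_inv (G x) *v axis l 1) $ k = matrix_inv (G x) $ k $ l"
      by (simp add: matrix_vector_mult_def axis_def if_distrib cong: if_cong)
    ultimately show ?thesis by (simp add: metric_inv_def divide_inverse)
  qed
  have "smooth_on (\<lambda>x. det (\<chi> i j. if j = k then axis l 1 $ i else G x $ i $ j) * inverse (det (G x))) S"
  proof (intro smooth_on_mult S smooth_on_inverse smooth_on_det Gij d)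
    show "smooth_on (\<lambda>x. (\<chi> i j. if j = k then axis l 1 $ i else G x $ i $ j) $ i $ j) S" for i j
      by (cases "j = k") (simp_all add: smooth_on_const[OF S] Gij)
  qed
  then show ?thesis
    using smooth_on_cong[OF S, of "\<lambda>x. det (\<chi> i j. if j = k then axis l 1 $ i else G x $ i $ j) * inverse (det (G x))"
        "metric_inv G k l"] e by simp
qed

lemma metric_inv_right:
  "invertible (G x) \<Longrightarrow> (\<Sum>m\<in>UNIV. G x $ i $ m * metric_inv G m j x) = (if i = j then 1 else 0)"
  unfolding metric_inv_def using matrix_inv_right[of "G x"]
  by (simp add: vec_eq_iff matrix_matrix_mult_def mat_def)

lemma metric_inv_commute:
  assumes "invertible (G x)" "transpose (G x) = G x"
  shows "metric_inv G i j x = metric_inv G j i x"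
proof -
  have "transpose (matrix_inv (G x)) ** G x = mat 1"
    using arg_cong[OF matrix_inv_right[OF assms(1)], of transpose] assms(2) by (simp add: matrix_transpose_mul)
  then have "transpose (matrix_inv (G x)) ** (G x ** matrix_inv (G x)) = matrix_inv (G x)"
    by (simp add: matrix_mul_assoc)
  then have "transpose (matrix_inv (G x)) = matrix_inv (G x)"
    by (simp add: matrix_inv_right[OF assms(1)])
  then have "transpose (matrix_inv (G x)) $ i $ j = matrix_inv (G x) $ i $ j" by simp
  then show ?thesis by (simp add: metric_inv_def transpose_def)
qed

text \<open>Induction over the normal indices. \<open>orthonormal_extend\<close> supplies a vector
  at \<open>x0\<close>; it is kept constant, projected off the tangent vectors and the earlier
  normals at each \<open>x\<close>, and normalised on a possibly smaller ball where its square keeps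
  its sign.\<close>

lemma orthonormal_normal_frame:
  fixes \<eta> :: "real^'d^'d" and e :: "'n \<Rightarrow> real^'n \<Rightarrow> real^'d::finite" and G :: "real^'n \<Rightarrow> real^'n::finite^'n"
  assumes S: "open S" "x0 \<in> S" and sym: "transpose \<eta> = \<eta>" and \<eta>: "has_signature \<eta> p q"
    and e: "\<And>i. smooth_on (e i) S" "\<And>x i j. x \<in> S \<Longrightarrow> form \<eta> (e i x) (e j x) = G x $ i $ j"
    and G: "smooth_on G S" "\<And>x. x \<in> S \<Longrightarrow> has_signature (G x) r s"
    and N: "finite N" "\<And>A. A \<in> N \<Longrightarrow> \<epsilon> A = 1 \<or> \<epsilon> A = -1"
      "r + card {A \<in> N. \<epsilon> A = 1} \<le> p" "s + card {A \<in> N. \<epsilon> A = -1} \<le> q"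
  obtains \<rho> n where "\<rho> > 0" "ball x0 \<rho> \<subseteq> S" "\<And>A. A \<in> N \<Longrightarrow> smooth_on (n A) (ball x0 \<rho>)"
    "\<And>x i A. x \<in> ball x0 \<rho> \<Longrightarrow> A \<in> N \<Longrightarrow> form \<eta> (e i x) (n A x) = 0"
    "\<And>x A B. x \<in> ball x0 \<rho> \<Longrightarrow> A \<in> N \<Longrightarrow> B \<in> N \<Longrightarrow> form \<eta> (n A x) (n B x) = (if A = B then \<epsilon> A else 0)"
proof -
  have "M \<subseteq> N \<Longrightarrow> \<exists>\<rho> n. \<rho> > 0 \<and> ball x0 \<rho> \<subseteq> S \<and> (\<forall>A\<in>M. smooth_on (n A) (ball x0 \<rho>)) \<and>
     (\<forall>x\<in>ball x0 \<rho>. \<forall>A\<in>M. (\<forall>i. form \<eta> (e i x) (n A x) = 0) \<and>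
        (\<forall>B\<in>M. form \<eta> (n A x) (n B x) = (if A = B then \<epsilon> A else 0)))" if "finite M" for M
    using that
  proof (induction M rule: finite_induct)
    case empty
    obtain \<rho> where "\<rho> > 0" "ball x0 \<rho> \<subseteq> S" using S openE by blast
    then show ?case by auto
  next
    case (insert C M)
    then have "\<exists>\<rho> n. \<rho> > 0 \<and> ball x0 \<rho> \<subseteq> S \<and> (\<forall>A\<in>M. smooth_on (n A) (ball x0 \<rho>)) \<and>
     (\<forall>x\<in>ball x0 \<rho>. \<forall>A\<in>M. (\<forall>i. form \<eta> (e i x) (n A x) = 0) \<and>
        (\<forall>B\<in>M. form \<eta> (n A x) (n B x) = (if A = B then \<epsilon> A else 0)))" by blast
    then obtain \<rho> n where R: "\<rho> > 0 \<and> ball x0 \<rho> \<subseteq> S \<and> (\<forall>A\<in>M. smooth_on (n A) (ball x0 \<rho>)) \<and>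
     (\<forall>x\<in>ball x0 \<rho>. \<forall>A\<in>M. (\<forall>i. form \<eta> (e i x) (n A x) = 0) \<and>
        (\<forall>B\<in>M. form \<eta> (n A x) (n B x) = (if A = B then \<epsilon> A else 0)))" by blast
    have \<rho>: "\<rho> > 0" "ball x0 \<rho> \<subseteq> S" and sn: "\<And>A. A \<in> M \<Longrightarrow> smooth_on (n A) (ball x0 \<rho>)"
      and en: "\<And>x i A. x \<in> ball x0 \<rho> \<Longrightarrow> A \<in> M \<Longrightarrow> form \<eta> (e i x) (n A x) = 0"
      and nn: "\<And>x A B. x \<in> ball x0 \<rho> \<Longrightarrow> A \<in> M \<Longrightarrow> B \<in> M \<Longrightarrow> form \<eta> (n A x) (n B x) = (if A = B then \<epsilon> A else 0)"
      using R by blast+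
    let ?B = "ball x0 \<rho>"
    have x0: "x0 \<in> ?B" using \<rho> by simp
    have CN: "C \<in> N" and MN: "M \<subseteq> N" using insert.prems by auto
    note \<epsilon>C = N(2)[OF CN]
    have \<epsilon>M: "\<epsilon> A = 1 \<or> \<epsilon> A = -1" if "A \<in> M" for A using N(2) MN that by blast
    obtain \<sigma> :: "'d \<Rightarrow> real" and f :: "'d \<Rightarrow> real^'d"
      where f: "card {i. \<sigma> i = 1} = p" "card {i. \<sigma> i = -1} = q"
        "\<And>i j. form \<eta> (f i) (f j) = (if i = j then \<sigma> i else 0)"
      using \<eta> unfolding has_signature_def form_def by blast
    obtain \<tau> :: "'n \<Rightarrow> real" and g :: "'n \<Rightarrow> real^'n" where g: "\<And>i. \<tau> i = 1 \<or> \<tau> i = (-1::real)" "card {i. \<tau> i = 1} = r" "card {i. \<tau> i = -1} = s"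
      "\<And>i j. form (G x0) (g i) (g j) = (if i = j then \<tau> i else 0)"
      "\<And>i j. (\<Sum>k\<in>UNIV. \<tau> k * (G x0 *v g k) $ i * g k $ j) = (if i = j then 1 else 0)"
      "invertible (G x0)"
      by (rule signature_basis[OF G(2)[OF S(2)]]) blast
    \<comment> \<open>An \<open>\<eta>\<close>-orthonormal basis of the tangent space at
      \<open>x0\<close>, made from the coordinate vectors, which in general are not
      orthonormal.\<close>
    define E where "E i = (\<Sum>j\<in>UNIV. g i $ j *\<^sub>R e j x0)" for i
    define u where "u z = (case z of Inl i \<Rightarrow> E i | Inr A \<Rightarrow> n A x0)" for z
    define sg where "sg z = (case z of Inl i \<Rightarrow> \<tau> i | Inr A \<Rightarrow> \<epsilon> A)" for z
    have EE: "form \<eta> (E i) (E j) = (if i = j then \<tau> i else 0)" for i j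
    proof -
      have "form \<eta> (E i) (E j) = form (G x0) (g i) (g j)"
        by (simp add: E_def form.sum_left form.sum_right form.scaleR_left form.scaleR_right e(2)[OF S(2)]
            form_eq_sum[of "G x0"] sum_distrib_left mult_ac) (rule sum.swap)
      then show ?thesis by (simp add: g(4))
    qed
    have En: "form \<eta> (E i) (n A x0) = 0" if "A \<in> M" for i A
      using en[OF x0 that] by (simp add: E_def form.sum_left form.scaleR_left)
    have uu: "form \<eta> (u a) (u b) = (if a = b then sg a else 0)" if "a \<in> UNIV <+> M" "b \<in> UNIV <+> M" for a b
      using that by (auto simp: u_def sg_def EE En nn[OF x0] form_commute[OF sym, of "n _ _" "E _"] split: if_splits)
    \<comment> \<open>Strictness comes from \<open>C\<close>, which is counted in \<open>N\<close>
      but not in \<open>M\<close>.\<close>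
    have card: "card {a \<in> UNIV <+> M. sg a = \<epsilon> C} < card {i. \<sigma> i = \<epsilon> C}"
    proof -
      have "{a \<in> UNIV <+> M. sg a = \<epsilon> C} = {i. \<tau> i = \<epsilon> C} <+> {A \<in> M. \<epsilon> A = \<epsilon> C}"
        by (auto simp: sg_def)
      then have "card {a \<in> UNIV <+> M. sg a = \<epsilon> C} = card {i. \<tau> i = \<epsilon> C} + card {A \<in> M. \<epsilon> A = \<epsilon> C}"
        using insert.hyps(1) by (simp add: card_Plus)
      also have "card {A \<in> M. \<epsilon> A = \<epsilon> C} < card {A \<in> N. \<epsilon> A = \<epsilon> C}"
        by (rule psubset_card_mono) (use N(1) MN CN insert.hyps(2) in auto)
      finally show ?thesis using \<epsilon>C f(1,2) g(2,3) N(3,4) by auto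
    qed
    obtain v where v: "form \<eta> v v = \<epsilon> C" "\<And>a. a \<in> UNIV <+> M \<Longrightarrow> form \<eta> (u a) v = 0"
    proof (rule orthonormal_extend[OF sym \<epsilon>C f(3) _ _ uu card])
      show "finite ((UNIV :: 'n set) <+> M)" using insert.hyps(1) by simp
      show "sg a = 1 \<or> sg a = -1" if "a \<in> UNIV <+> M" for a
        using that
      proof (cases a)
        case (Inl i)
        then show ?thesis using g(1)[of i] by (simp add: sg_def)
      next
        case (Inr A)
        then show ?thesis using that \<epsilon>M[of A] by (auto simp: sg_def)
      qed
    qed auto
    \<comment> \<open>Orthogonality to the vectors \<open>E k\<close> passes back to the coordinate
      vectors by the completeness relation of \<open>g\<close>.\<close>
    have ev: "form \<eta> (e i x0) v = 0" for i
    proof -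
      have Ev: "(\<Sum>j\<in>UNIV. g k $ j * form \<eta> (e j x0) v) = 0" for k
        using v(2)[OF InlI[OF UNIV_I], of k] by (simp add: u_def E_def form.sum_left form.scaleR_left)
      have "form \<eta> (e i x0) v = (\<Sum>j\<in>UNIV. (if i = j then 1 else 0) * form \<eta> (e j x0) v)" 
        by (simp add: sum_delta_times)
      also have "\<dots> = (\<Sum>j\<in>UNIV. \<Sum>k\<in>UNIV. \<tau> k * (G x0 *v g k) $ i * g k $ j * form \<eta> (e j x0) v)"
        unfolding g(5)[symmetric] sum_distrib_right ..
      also have "\<dots> = (\<Sum>k\<in>UNIV. \<tau> k * (G x0 *v g k) $ i * (\<Sum>j\<in>UNIV. g k $ j * form \<eta> (e j x0) v))"
        by (subst sum.swap) (simp add: sum_distrib_left mult.assoc)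
      finally show ?thesis by (simp add: Ev)
    qed
    have nv: "form \<eta> (n A x0) v = 0" if "A \<in> M" for A
      using v(2)[of "Inr A"] that by (auto simp: u_def)
    \<comment> \<open>Orthogonal projection: the tangent vectors are not orthonormal and require the
      inverse metric, the earlier normals only their signs. At \<open>x0\<close> both sums
      vanish.\<close>
    define w where "w x = v - (\<Sum>l\<in>UNIV. \<Sum>m\<in>UNIV. (metric_inv G l m x * form \<eta> (e m x) v) *\<^sub>R e l x)
        - (\<Sum>A\<in>M. (\<epsilon> A * form \<eta> (n A x) v) *\<^sub>R n A x)" for x
    have inv: "invertible (G x)" if "x \<in> ?B" for x
      by (rule signature_basis[OF G(2)]) (use \<rho>(2) that in auto)
    have eB: "smooth_on (e i) ?B" "smooth_on G ?B" for i using e(1) G(1) \<rho>(2) smooth_on_subset by blast+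
    have sw: "smooth_on w ?B" unfolding w_def[abs_def]
      by (intro smooth_on_diff open_ball smooth_on_const smooth_on_sum smooth_on_scaleR smooth_on_mult
          smooth_on_metric_inv[OF _ eB(2) inv] smooth_on_bilinear[OF _ bounded_bilinear_form] eB(1) sn)
    have ew: "form \<eta> (e i x) (w x) = 0" if x: "x \<in> ?B" for i x
    proof -
      have xS: "x \<in> S" using \<rho>(2) x by blast
      have "form \<eta> (e i x) (w x) = form \<eta> (e i x) v - (\<Sum>l\<in>UNIV. \<Sum>m\<in>UNIV. metric_inv G l m x * form \<eta> (e m x) v * G x $ i $ l)"
        unfolding w_def by (simp add: form.diff_right form.sum_right form.scaleR_right en[OF x] e(2)[OF xS])
      also have "(\<Sum>l\<in>UNIV. \<Sum>m\<in>UNIV. metric_inv G l m x * form \<eta> (e m x) v * G x $ i $ l)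
         = (\<Sum>m\<in>UNIV. (\<Sum>l\<in>UNIV. G x $ i $ l * metric_inv G l m x) * form \<eta> (e m x) v)"
        by (subst sum.swap) (simp add: sum_distrib_left sum_distrib_right mult_ac)
      also have "form \<eta> (e i x) v - \<dots> = 0" by (simp add: metric_inv_right inv[OF x] sum_delta_times)
      finally show ?thesis .
    qed
    have nw: "form \<eta> (n A x) (w x) = 0" if x: "x \<in> ?B" and A: "A \<in> M" for A x
    proof -
      have "form \<eta> (n A x) (w x) = form \<eta> (n A x) v - (\<Sum>B\<in>M. \<epsilon> B * form \<eta> (n B x) v * form \<eta> (n A x) (n B x))"
        unfolding w_def
        by (simp add: form.diff_right form.sum_right form.scaleR_right form_commute[OF sym, of "n A x" "e _ x"] en[OF x A])
      also have "(\<Sum>B\<in>M. \<epsilon> B * form \<eta> (n B x) v * form \<eta> (n A x) (n B x))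
          = (\<Sum>B\<in>M. if A = B then \<epsilon> A * \<epsilon> A * form \<eta> (n A x) v else 0)"
        using A by (intro sum.cong) (auto simp: nn[OF x])
      also have "\<dots> = form \<eta> (n A x) v" using A insert.hyps(1) \<epsilon>M[OF A] by auto
      finally show ?thesis by simp
    qed
    \<comment> \<open>The sign makes this equal to 1 at \<open>x0\<close> whatever the value of
      \<open>\<epsilon> C\<close>.\<close>
    define h where "h x = \<epsilon> C * form \<eta> (w x) (w x)" for x
    have sh: "smooth_on h ?B" unfolding h_def[abs_def]
      by (intro smooth_on_mult open_ball smooth_on_const smooth_on_bilinear[OF _ bounded_bilinear_form] sw)
    have "w x0 = v" unfolding w_def using ev nv by simp
    then have h0: "h x0 = 1" using \<epsilon>C by (auto simp: h_def v(1))
    have "isCont h x0" using smooth_on_imp_continuous_on[OF sh] x0 continuous_on_eq_continuous_at open_ball by blast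
    then obtain d where d: "d > 0" "\<And>y. dist y x0 < d \<Longrightarrow> dist (h y) (h x0) < 1"
      unfolding continuous_at_eps_delta using zero_less_one by blast
    define \<rho>' where "\<rho>' = min d \<rho>"
    have \<rho>': "\<rho>' > 0" "ball x0 \<rho>' \<subseteq> ?B" using d(1) \<rho>(1) by (auto simp: \<rho>'_def)
    have hpos: "h x > 0" if "x \<in> ball x0 \<rho>'" for x
      using d(2)[of x] that h0 by (auto simp: \<rho>'_def dist_commute dist_real_def)
    define n' where "n' = n(C := (\<lambda>x. h x powr (-1/2) *\<^sub>R w x))"
    have n'C: "n' C x = h x powr (-1/2) *\<^sub>R w x" for x by (simp add: n'_def)
    have n'M: "n' A = n A" if "A \<in> M" for A using that insert.hyps(2) by (auto simp: n'_def)
    have CC: "form \<eta> (n' C x) (n' C x) = \<epsilon> C" if x: "x \<in> ball x0 \<rho>'" for x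
    proof -
      have "form \<eta> (n' C x) (n' C x) = (h x powr (-1/2) * h x powr (-1/2)) * form \<eta> (w x) (w x)"
        by (simp add: n'C form.scaleR_left form.scaleR_right)
      also have "h x powr (-1/2) * h x powr (-1/2) = h x powr (-1)" by (subst powr_add[symmetric]) simp
      also have "\<dots> = inverse (h x)" using hpos[OF x] by (simp add: powr_minus)
      also have "form \<eta> (w x) (w x) = \<epsilon> C * h x" using \<epsilon>C by (auto simp: h_def)
      finally show ?thesis using hpos[OF x] by simp
    qed
    have a: "smooth_on (n' A) (ball x0 \<rho>')" if "A \<in> insert C M" for A
    proof (cases "A = C")
      case True
      then show ?thesis unfolding True n'_def
        using \<rho>'(2) by (auto intro!: smooth_on_scaleR smooth_on_powr hpos smooth_on_subset[OF sh] smooth_on_subset[OF sw] simp del: mem_ball)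
    next
      case False
      then show ?thesis using that n'M sn \<rho>'(2) smooth_on_subset by (metis insertE)
    qed
    have b: "form \<eta> (e i x) (n' A x) = 0" if "x \<in> ball x0 \<rho>'" "A \<in> insert C M" for i x A
      using that \<rho>'(2) ew en n'M by (cases "A = C") (auto simp: n'C form.scaleR_right simp del: mem_ball)
    have c: "form \<eta> (n' A x) (n' B x) = (if A = B then \<epsilon> A else 0)"
      if x: "x \<in> ball x0 \<rho>'" and AB: "A \<in> insert C M" "B \<in> insert C M" for x A B
    proof -
      have xB: "x \<in> ?B" using x \<rho>'(2) by blast
      have 1: "form \<eta> (n' A x) (n' C x) = 0" if "A \<in> M" for A
        using nw[OF xB that] that by (simp add: n'M n'C form.scaleR_right)
      have 2: "form \<eta> (n' A x) (n' B x) = (if A = B then \<epsilon> A else 0)" if "A \<in> M" "B \<in> M" for A B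
        using nn[OF xB] that by (simp add: n'M)
      show ?thesis
      proof (cases "A = C")
        case True
        then show ?thesis
          using AB(2) 1[of B] CC[OF x] insert.hyps(2) form_commute[OF sym, of "n' C x" "n' B x"] by (cases "B = C") auto
      next
        case False
        then show ?thesis using AB 1[of A] 2[of A B] by (cases "B = C") auto
      qed
    qed
    show ?case
    proof (intro exI[of _ \<rho>'] exI[of _ n'] conjI ballI allI)
      show "0 < \<rho>'" "ball x0 \<rho>' \<subseteq> S" using \<rho>' \<rho>(2) by blast+
    qed (fact a b c)+
  qed
  from this[OF N(1) order.refl] obtain \<rho> n where R: "\<rho> > 0 \<and> ball x0 \<rho> \<subseteq> S \<and> (\<forall>A\<in>N. smooth_on (n A) (ball x0 \<rho>)) \<and>
     (\<forall>x\<in>ball x0 \<rho>. \<forall>A\<in>N. (\<forall>i. form \<eta> (e i x) (n A x) = 0) \<and>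
        (\<forall>B\<in>N. form \<eta> (n A x) (n B x) = (if A = B then \<epsilon> A else 0)))" by blast
  show ?thesis by (rule that[of \<rho> n]) (use R in blast)+
qed

section \<open>Levi-Civita connection and the equations of Gauss, Codazzi and Ricci\<close>

text \<open>The Christoffel symbols of the first kind, with the lowered index in front.\<close>
definition christoffel_low :: "(real^'n \<Rightarrow> real^'n^'n) \<Rightarrow> 'n::finite \<Rightarrow> 'n \<Rightarrow> 'n \<Rightarrow> real^'n \<Rightarrow> real" where
  "christoffel_low G h i j x = (partial i (\<lambda>y. G y $ h $ j) x + partial j (\<lambda>y. G y $ h $ i) x - partial h (\<lambda>y. G y $ i $ j) x) / 2"

lemma christoffel_eq: "christoffel G k i j x = (\<Sum>l\<in>UNIV. metric_inv G k l x * christoffel_low G l i j x)"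
  by (simp add: christoffel_def christoffel_low_def)

locale metric_domain =
  fixes G :: "real^'n \<Rightarrow> real^'n::finite^'n" and S
  assumes open_S: "open S" and smooth_G: "smooth_on G S"
    and sym_G: "\<And>x. x \<in> S \<Longrightarrow> transpose (G x) = G x" and inv_G: "\<And>x. x \<in> S \<Longrightarrow> invertible (G x)"
begin

lemma G_commute: "x \<in> S \<Longrightarrow> G x $ i $ j = G x $ j $ i"
  using arg_cong[OF sym_G[of x], of "\<lambda>M. M $ j $ i"] by (simp add: transpose_def)

lemma smooth_Gij: "smooth_on (\<lambda>x. G x $ i $ j) S"
  by (intro smooth_on_vec_nth open_S smooth_G)

lemma partial_G_commute: "x \<in> S \<Longrightarrow> partial k (\<lambda>y. G y $ i $ j) x = partial k (\<lambda>y. G y $ j $ i) x"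
  by (rule partial_cong[OF open_S]) (auto intro: smooth_on_differentiable[OF smooth_Gij] G_commute)

lemma christoffel_low_commute: "x \<in> S \<Longrightarrow> christoffel_low G h i j x = christoffel_low G h j i x"
  by (simp add: christoffel_low_def partial_G_commute[of x h i j])

lemma christoffel_commute: "x \<in> S \<Longrightarrow> christoffel G h i j x = christoffel G h j i x"
  by (simp add: christoffel_eq christoffel_low_commute[of x _ i j])

text \<open>This says that the covariant derivative of the metric vanishes.\<close>

lemma metric_compatible:
  assumes x: "x \<in> S"
  shows "partial j (\<lambda>y. G y $ h $ l) x = christoffel_low G h j l x + christoffel_low G l j h x"
  unfolding christoffel_low_def
    partial_G_commute[OF x, of j l h] partial_G_commute[OF x, of h l j] partial_G_commute[OF x, of l j h]
  by (simp add: field_simps)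

lemma smooth_christoffel_low: "smooth_on (christoffel_low G h i j) S"
proof -
  have "smooth_on (\<lambda>x. (1/2) * (partial i (\<lambda>y. G y $ h $ j) x + partial j (\<lambda>y. G y $ h $ i) x - partial h (\<lambda>y. G y $ i $ j) x)) S"
    by (intro smooth_on_mult smooth_on_diff smooth_on_add smooth_on_const open_S smooth_on_partial smooth_Gij)
  then show ?thesis by (simp add: christoffel_low_def[abs_def])
qed

lemma metric_inv_sym: "x \<in> S \<Longrightarrow> metric_inv G i j x = metric_inv G j i x"
  by (rule metric_inv_commute) (rule inv_G sym_G, assumption)+

lemma smooth_inv: "smooth_on (metric_inv G k l) S"
  by (rule smooth_on_metric_inv[OF open_S smooth_G inv_G])

lemma smooth_christoffel: "smooth_on (christoffel G h i j) S"
  unfolding christoffel_eq[abs_def]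
  by (intro smooth_on_sum smooth_on_mult open_S smooth_christoffel_low smooth_inv)

lemma christoffel_lower:
  assumes x: "x \<in> S"
  shows "(\<Sum>l\<in>UNIV. G x $ h $ l * christoffel G l i j x) = christoffel_low G h i j x"
proof -
  have "(\<Sum>l\<in>UNIV. G x $ h $ l * christoffel G l i j x)
      = (\<Sum>m\<in>UNIV. (\<Sum>l\<in>UNIV. G x $ h $ l * metric_inv G l m x) * christoffel_low G m i j x)"
    unfolding christoffel_eq sum_distrib_left sum_distrib_right by (subst sum.swap) (simp add: mult_ac)
  then show ?thesis by (simp add: metric_inv_right inv_G[OF x] sum_delta_times)
qed

text \<open>Moving the metric under the derivative costs two terms by
  \<open>metric_compatible\<close>, one of which cancels the quadratic term of the curvature. For an
  immersion the lowered symbols are inner products of second with first derivatives, so this form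
  can be compared with the ambient space.\<close>

lemma curvature_low_eq:
  assumes x: "x \<in> S"
  shows "curvature_low G h i j k x = partial j (christoffel_low G h i k) x - partial k (christoffel_low G h i j) x
     - (\<Sum>l\<in>UNIV. christoffel G l i k x * christoffel_low G l j h x)
     + (\<Sum>l\<in>UNIV. christoffel G l i j x * christoffel_low G l k h x)"
proof -
  have d: "(\<Sum>l\<in>UNIV. G x $ h $ l * partial j (christoffel G l i k) x)
     = partial j (christoffel_low G h i k) x - (\<Sum>l\<in>UNIV. christoffel_low G h j l x * christoffel G l i k x)
       - (\<Sum>l\<in>UNIV. christoffel G l i k x * christoffel_low G l j h x)" for j k
  proof -
    have df: "(\<lambda>y. G y $ h $ l) differentiable (at x)" "christoffel G l i k differentiable (at x)" for l
      by (rule smooth_on_differentiable[OF smooth_Gij x], rule smooth_on_differentiable[OF smooth_christoffel x])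
    have sm: "smooth_on (\<lambda>y. \<Sum>l\<in>UNIV. G y $ h $ l * christoffel G l i k y) S"
      by (intro smooth_on_sum smooth_on_mult open_S smooth_Gij smooth_christoffel)
    have "partial j (christoffel_low G h i k) x = partial j (\<lambda>y. \<Sum>l\<in>UNIV. G y $ h $ l * christoffel G l i k y) x"
      by (rule partial_cong[OF open_S x, symmetric])
        (auto simp: christoffel_lower intro: smooth_on_differentiable[OF sm x])
    also have "\<dots> = (\<Sum>l\<in>UNIV. partial j (\<lambda>y. G y $ h $ l * christoffel G l i k y) x)"
      by (rule partial_sum) (intro differentiable_mult df)
    also have "\<dots> = (\<Sum>l\<in>UNIV. G x $ h $ l * partial j (christoffel G l i k) x
        + (christoffel_low G h j l x + christoffel_low G l j h x) * christoffel G l i k x)"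
      by (simp add: partial_mult[OF df] metric_compatible[OF x])
    finally show ?thesis by (simp add: sum.distrib algebra_simps)
  qed
  have q: "(\<Sum>l\<in>UNIV. G x $ h $ l * (\<Sum>m\<in>UNIV. christoffel G l j m x * christoffel G m i k x))
     = (\<Sum>m\<in>UNIV. christoffel_low G h j m x * christoffel G m i k x)" for j k
    unfolding christoffel_lower[OF x, symmetric] sum_distrib_left sum_distrib_right
    by (subst sum.swap) (simp add: mult_ac)
  have "curvature_low G h i j k x = (\<Sum>l\<in>UNIV. G x $ h $ l * partial j (christoffel G l i k) x)
     - (\<Sum>l\<in>UNIV. G x $ h $ l * partial k (christoffel G l i j) x)
     + (\<Sum>l\<in>UNIV. G x $ h $ l * (\<Sum>m\<in>UNIV. christoffel G l j m x * christoffel G m i k x))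
     - (\<Sum>l\<in>UNIV. G x $ h $ l * (\<Sum>m\<in>UNIV. christoffel G l k m x * christoffel G m i j x))"
    unfolding curvature_low_def curvature_def
    by (simp add: sum.distrib sum_subtractf distrib_left right_diff_distrib)
  then show ?thesis unfolding d q by simp
qed

lemma sum_normal_metric_inv:
  assumes "finite N"
  shows "(\<Sum>A\<in>N. \<Sum>B\<in>N. normal_metric_inv \<epsilon> A B * f A B) = (\<Sum>A\<in>N. \<epsilon> A * f A A)"
  by (rule sum.cong) (auto simp: normal_metric_inv_def sum_delta_times[OF assms])

text \<open>This and the next two equivalences separate derivatives from products and write the
  products as an expression minus its copy with \<open>j\<close> and \<open>k\<close> exchanged, the
  shape in which \<open>flatness\<close> and \<open>partial_Th\<close> can use them.\<close>

lemma gauss_iff: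
  assumes "finite N" "x \<in> S"
  shows "gauss_equation N \<epsilon> G b x \<longleftrightarrow> (\<forall>h i j k.
    partial j (christoffel_low G h i k) x - partial k (christoffel_low G h i j) x =
      (\<Sum>l\<in>UNIV. christoffel G l i k x * christoffel_low G l j h x) + (\<Sum>A\<in>N. \<epsilon> A * (b i k A x * b j h A x))
      - ((\<Sum>l\<in>UNIV. christoffel G l i j x * christoffel_low G l k h x) + (\<Sum>A\<in>N. \<epsilon> A * (b i j A x * b k h A x))))"
  unfolding gauss_equation_def curvature_low_eq[OF assms(2)] sum_normal_metric_inv[OF assms(1)]
  by (intro all_cong1, unfold right_diff_distrib sum_subtractf) (intro iffI; linarith)

lemma codazzi_iff:
  assumes "finite N" "x \<in> S"
  shows "codazzi_equation N \<epsilon> G b a x \<longleftrightarrow> (\<forall>i j k. \<forall>C\<in>N.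
    partial j (b i k C) x - partial k (b i j C) x =
      (- (\<Sum>l\<in>UNIV. christoffel G l i k x * b l j C x) - (\<Sum>A\<in>N. \<epsilon> A * (b i k A x * a j A C x)))
      - (- (\<Sum>l\<in>UNIV. christoffel G l i j x * b l k C x) - (\<Sum>A\<in>N. \<epsilon> A * (b i j A x * a k A C x))))"
proof -
  \<comment> \<open>The Christoffel terms for the index pair \<open>j\<close>, \<open>k\<close> are
    symmetric and drop out of the difference.\<close>
  have 1: "partial k (b i j C) x - (\<Sum>m\<in>UNIV. christoffel G m i k x * b m j C x) - (\<Sum>m\<in>UNIV. christoffel G m j k x * b i m C x) -
      (partial j (b i k C) x - (\<Sum>m\<in>UNIV. christoffel G m i j x * b m k C x) - (\<Sum>m\<in>UNIV. christoffel G m k j x * b i m C x))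
     = partial k (b i j C) x - partial j (b i k C) x - (\<Sum>m\<in>UNIV. christoffel G m i k x * b m j C x)
       + (\<Sum>m\<in>UNIV. christoffel G m i j x * b m k C x)" for i j k C
    by (simp add: christoffel_commute[OF assms(2), of _ j k])
  show ?thesis
  unfolding codazzi_equation_def cov_deriv2_def sum_normal_metric_inv[OF assms(1)] 1
  by (intro all_cong1 ball_cong refl, unfold right_diff_distrib sum_subtractf) (intro iffI; linarith)
qed

lemma ricci_iff:
  assumes "finite N" "x \<in> S"
  shows "ricci_equation N \<epsilon> G b a x \<longleftrightarrow> (\<forall>j k. \<forall>A\<in>N. \<forall>B\<in>N.
    partial j (a k A B) x - partial k (a j A B) x =
      ((\<Sum>l\<in>UNIV. \<Sum>m\<in>UNIV. metric_inv G l m x * (b k l A x * b m j B x)) - (\<Sum>M\<in>N. \<epsilon> M * (a k A M x * a j M B x)))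
      - ((\<Sum>l\<in>UNIV. \<Sum>m\<in>UNIV. metric_inv G l m x * (b j l A x * b m k B x)) - (\<Sum>M\<in>N. \<epsilon> M * (a j A M x * a k M B x))))"
proof -
  have "(\<Sum>m\<in>UNIV. christoffel G m j k x * a m A B x) = (\<Sum>m\<in>UNIV. christoffel G m k j x * a m A B x)" for j k A B
    by (simp add: christoffel_commute[OF assms(2), of _ j k])
  then have e: "cov_deriv1 G (\<lambda>j. a j A B) j k x - cov_deriv1 G (\<lambda>j. a j A B) k j x = partial k (a j A B) x - partial j (a k A B) x" for j k A B
    unfolding cov_deriv1_def by simp
  show ?thesis unfolding ricci_equation_def e sum_normal_metric_inv[OF assms(1)]
    by (intro all_cong1 ball_cong refl, unfold right_diff_distrib sum_subtractf) (intro iffI; linarith)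
qed

end

section \<open>Necessity of the equations\<close>

locale immersed_domain = metric_domain G S + block_index \<psi> N
  for G :: "real^'n \<Rightarrow> real^'n::finite^'n" and S and \<psi> :: "'d::finite \<Rightarrow> 'n + nat" and N +
  fixes \<eta> :: "real^'d^'d" and \<epsilon> :: "nat \<Rightarrow> real" and Y :: "real^'n \<Rightarrow> real^'d" and n :: "nat \<Rightarrow> real^'n \<Rightarrow> real^'d"
  assumes sym: "transpose \<eta> = \<eta>" and \<epsilon>: "\<And>A. A \<in> N \<Longrightarrow> \<epsilon> A = 1 \<or> \<epsilon> A = -1"
    and smooth_Y: "smooth_on Y S" and smooth_n: "\<And>A. A \<in> N \<Longrightarrow> smooth_on (n A) S"
    and isometric: "\<And>x i j. x \<in> S \<Longrightarrow> form \<eta> (partial i Y x) (partial j Y x) = G x $ i $ j"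
    and normal: "\<And>x i A. x \<in> S \<Longrightarrow> A \<in> N \<Longrightarrow> form \<eta> (partial i Y x) (n A x) = 0"
    and orthonormal: "\<And>x A B. x \<in> S \<Longrightarrow> A \<in> N \<Longrightarrow> B \<in> N \<Longrightarrow> form \<eta> (n A x) (n B x) = (if A = B then \<epsilon> A else 0)"
begin

text \<open>The second fundamental form. Covariant and partial second derivatives of
  \<open>Y\<close> differ by a tangent vector, so they have the same product with a normal.\<close>

definition sff :: "'n \<Rightarrow> 'n \<Rightarrow> nat \<Rightarrow> real^'n \<Rightarrow> real" where
  "sff i j A x = form \<eta> (partial j (partial i Y) x) (n A x)"

text \<open>The connection form of the normal bundle in the frame \<open>n\<close>.\<close>

definition torsion :: "'n \<Rightarrow> nat \<Rightarrow> nat \<Rightarrow> real^'n \<Rightarrow> real" where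
  "torsion i A B x = form \<eta> (partial i (n A) x) (n B x)"

lemma smooth_dY: "smooth_on (partial i Y) S" by (rule smooth_on_partial[OF smooth_Y])

lemma smooth_sff: "A \<in> N \<Longrightarrow> smooth_on (sff i j A) S"
  unfolding sff_def[abs_def]
  by (rule smooth_on_bilinear[OF open_S bounded_bilinear_form smooth_on_partial[OF smooth_dY] smooth_n])

lemma smooth_torsion: "A \<in> N \<Longrightarrow> B \<in> N \<Longrightarrow> smooth_on (torsion i A B) S"
  unfolding torsion_def[abs_def]
  by (rule smooth_on_bilinear[OF open_S bounded_bilinear_form smooth_on_partial[OF smooth_n] smooth_n])

lemma partial_form:
  assumes "smooth_on f S" "smooth_on h S" "x \<in> S"
  shows "partial j (\<lambda>y. form \<eta> (f y) (h y)) x = form \<eta> (f x) (partial j h x) + form \<eta> (partial j f x) (h x)"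
  by (rule partial_bilinear[OF bounded_bilinear_form]) (auto intro: smooth_on_differentiable assms)

lemma sff_commute: "x \<in> S \<Longrightarrow> sff i j A x = sff j i A x"
  unfolding sff_def by (simp add: partial_commute[OF open_S smooth_Y])

lemma torsion_skew:
  assumes x: "x \<in> S" and A: "A \<in> N" "B \<in> N"
  shows "torsion i A B x = - torsion i B A x"
proof -
  have "partial i (\<lambda>y. form \<eta> (n A y) (n B y)) x = partial i (\<lambda>y. if A = B then \<epsilon> A else 0) x"
    by (rule partial_cong[OF open_S x smooth_on_differentiable[OF _ x]])
       (auto simp: orthonormal A intro!: smooth_on_bilinear[OF open_S bounded_bilinear_form] smooth_n)
  then show ?thesis unfolding partial_form[OF smooth_n[OF A(1)] smooth_n[OF A(2)] x] torsion_def
    by (simp add: form_commute[OF sym, of "n A x"])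
qed

lemma normal_deriv:
  assumes x: "x \<in> S" and A: "A \<in> N"
  shows "form \<eta> (partial j (n A) x) (partial i Y x) = - sff i j A x"
proof -
  have "partial j (\<lambda>y. form \<eta> (partial i Y y) (n A y)) x = partial j (\<lambda>y. 0) x"
    by (rule partial_cong[OF open_S x smooth_on_differentiable[OF _ x]])
       (auto simp: normal A intro!: smooth_on_bilinear[OF open_S bounded_bilinear_form] smooth_n smooth_dY)
  then show ?thesis unfolding partial_form[OF smooth_dY smooth_n[OF A] x] sff_def
    by (simp add: form_commute[OF sym, of _ "partial i Y x"])
qed

text \<open>The three derivatives of the isometry condition give six inner products. By symmetry of
  second derivatives four of them cancel and the other two are equal.\<close>

lemma koszul:
  assumes x: "x \<in> S"
  shows "form \<eta> (partial j (partial i Y) x) (partial h Y x) = christoffel_low G h i j x"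
proof -
  let ?c = "\<lambda>i j k. form \<eta> (partial j (partial i Y) x) (partial k Y x)"
  have c: "?c i j k = ?c j i k" for i j k by (simp add: partial_commute[OF open_S smooth_Y x])
  have d: "partial k (\<lambda>y. G y $ i $ j) x = ?c i k j + ?c j k i" for i j k
  proof -
    have "partial k (\<lambda>y. form \<eta> (partial i Y y) (partial j Y y)) x = partial k (\<lambda>y. G y $ i $ j) x"
      by (rule partial_cong[OF open_S x smooth_on_differentiable[OF _ x]])
         (auto simp: isometric intro!: smooth_on_bilinear[OF open_S bounded_bilinear_form] smooth_dY)
    then show ?thesis unfolding partial_form[OF smooth_dY smooth_dY x]
      by (simp add: form_commute[OF sym, of "partial i Y x"])
  qed
  show ?thesis unfolding christoffel_low_def d
    using c[of i j h] c[of i h j] c[of j h i] by simp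
qed

lemma form_expand:
  assumes x: "x \<in> S"
  shows "form \<eta> u v = (\<Sum>l\<in>UNIV. \<Sum>m\<in>UNIV. metric_inv G l m x * form \<eta> u (partial l Y x) * form \<eta> v (partial m Y x))
     + (\<Sum>A\<in>N. \<epsilon> A * form \<eta> u (n A x) * form \<eta> v (n A x))"
  unfolding metric_inv_def
  by (rule frame_completeness[OF sym isometric[OF x] matrix_inv_right[OF inv_G[OF x]] normal[OF x] orthonormal[OF x] \<epsilon>])

text \<open>Differentiating the two inner products produces mixed second derivatives of
  \<open>f\<close>, which are symmetric and cancel. The flatness of the ambient space enters in that
  its covariant derivative is the ordinary one.\<close>

lemma flatness:
  assumes "smooth_on f S" "smooth_on h S" and x: "x \<in> S"
    and 1: "\<And>y. y \<in> S \<Longrightarrow> form \<eta> (partial k f y) (h y) = u y" and 2: "\<And>y. y \<in> S \<Longrightarrow> form \<eta> (partial j f y) (h y) = v y"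
  shows "partial j u x - partial k v x
     = form \<eta> (partial k f x) (partial j h x) - form \<eta> (partial j f x) (partial k h x)"
proof -
  have s: "smooth_on (\<lambda>y. form \<eta> (partial k f y) (h y)) S" for k
    by (rule smooth_on_bilinear[OF open_S bounded_bilinear_form smooth_on_partial[OF assms(1)] assms(2)])
  have "partial j u x = partial j (\<lambda>y. form \<eta> (partial k f y) (h y)) x"
    by (rule partial_cong[OF open_S x smooth_on_differentiable[OF s x] 1, symmetric])
  moreover have "partial k v x = partial k (\<lambda>y. form \<eta> (partial j f y) (h y)) x"
    by (rule partial_cong[OF open_S x smooth_on_differentiable[OF s x] 2, symmetric])
  ultimately show ?thesis
    by (simp add: partial_form[OF smooth_on_partial[OF assms(1)] assms(2) x] partial_commute[OF open_S assms(1) x, of j k])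
qed

text \<open>The Gauss formula for the second derivatives of \<open>Y\<close>, paired with
  \<open>v\<close>; raising the first index of \<open>christoffel_low\<close> gives the tangential
  coefficients.\<close>

lemma tangential_product:
  assumes x: "x \<in> S"
  shows "form \<eta> (partial k (partial i Y) x) v = (\<Sum>m\<in>UNIV. christoffel G m i k x * form \<eta> v (partial m Y x))
     + (\<Sum>A\<in>N. \<epsilon> A * (sff i k A x * form \<eta> v (n A x)))"
proof -
  have "(\<Sum>l\<in>UNIV. \<Sum>m\<in>UNIV. metric_inv G l m x * form \<eta> (partial k (partial i Y) x) (partial l Y x) * form \<eta> v (partial m Y x))
    = (\<Sum>m\<in>UNIV. (\<Sum>l\<in>UNIV. metric_inv G m l x * christoffel_low G l i k x) * form \<eta> v (partial m Y x))"
    unfolding koszul[OF x] sum_distrib_right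
    by (subst sum.swap) (simp add: metric_inv_sym[OF x])
  then show ?thesis
    by (subst form_expand[OF x, of "partial k (partial i Y) x" v])
       (simp add: christoffel_eq sff_def[symmetric] mult.assoc)
qed

theorem gauss: assumes x: "x \<in> S" shows "gauss_equation N \<epsilon> G sff x"
  unfolding gauss_iff[OF finite_N x]
proof (intro allI)
  fix h i j k
  have "partial j (christoffel_low G h i k) x - partial k (christoffel_low G h i j) x
     = form \<eta> (partial k (partial i Y) x) (partial j (partial h Y) x) - form \<eta> (partial j (partial i Y) x) (partial k (partial h Y) x)"
    by (rule flatness[OF smooth_dY smooth_dY x]) (auto simp: koszul)
  then show "partial j (christoffel_low G h i k) x - partial k (christoffel_low G h i j) x =
      (\<Sum>l\<in>UNIV. christoffel G l i k x * christoffel_low G l j h x) + (\<Sum>A\<in>N. \<epsilon> A * (sff i k A x * sff j h A x))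
      - ((\<Sum>l\<in>UNIV. christoffel G l i j x * christoffel_low G l k h x) + (\<Sum>A\<in>N. \<epsilon> A * (sff i j A x * sff k h A x)))"
    unfolding tangential_product[OF x, of k i "partial j (partial h Y) x"] tangential_product[OF x, of j i "partial k (partial h Y) x"]
    by (simp add: koszul[OF x] sff_def[symmetric] sff_commute[OF x, of h] christoffel_low_commute[OF x, of _ h])
qed

theorem codazzi: assumes x: "x \<in> S" shows "codazzi_equation N \<epsilon> G sff torsion x"
  unfolding codazzi_iff[OF finite_N x]
proof (intro allI ballI)
  fix i j k C assume C: "C \<in> N"
  have "partial j (sff i k C) x - partial k (sff i j C) x
     = form \<eta> (partial k (partial i Y) x) (partial j (n C) x) - form \<eta> (partial j (partial i Y) x) (partial k (n C) x)"
    by (rule flatness[OF smooth_dY smooth_n[OF C] x]) (auto simp: sff_def)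
  \<comment> \<open>Skewness brings the normal indices into the order of the Codazzi
    equation.\<close>
  moreover have "(\<Sum>A\<in>N. \<epsilon> A * (sff i k A x * torsion j C A x)) = - (\<Sum>A\<in>N. \<epsilon> A * (sff i k A x * torsion j A C x))" for j k
    unfolding sum_negf[symmetric] by (rule sum.cong) (auto simp: torsion_skew[OF x C])
  ultimately show "partial j (sff i k C) x - partial k (sff i j C) x =
      (- (\<Sum>l\<in>UNIV. christoffel G l i k x * sff l j C x) - (\<Sum>A\<in>N. \<epsilon> A * (sff i k A x * torsion j A C x)))
      - (- (\<Sum>l\<in>UNIV. christoffel G l i j x * sff l k C x) - (\<Sum>A\<in>N. \<epsilon> A * (sff i j A x * torsion k A C x)))"
    by (simp add: tangential_product[OF x] normal_deriv[OF x C] torsion_def[symmetric] sum_negf)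
qed

theorem ricci: assumes x: "x \<in> S" shows "ricci_equation N \<epsilon> G sff torsion x"
  unfolding ricci_iff[OF finite_N x]
proof (intro allI ballI)
  fix j k A B assume A: "A \<in> N" and B: "B \<in> N"
  have 1: "partial j (torsion k A B) x - partial k (torsion j A B) x
     = form \<eta> (partial k (n A) x) (partial j (n B) x) - form \<eta> (partial j (n A) x) (partial k (n B) x)"
    by (rule flatness[OF smooth_n[OF A] smooth_n[OF B] x]) (auto simp: torsion_def)
  have 2: "form \<eta> (partial k (n A) x) (partial j (n B) x) =
     (\<Sum>l\<in>UNIV. \<Sum>m\<in>UNIV. metric_inv G l m x * (sff k l A x * sff m j B x)) - (\<Sum>M\<in>N. \<epsilon> M * (torsion k A M x * torsion j M B x))" for j k
  proof -
    have "(\<Sum>M\<in>N. \<epsilon> M * (torsion k A M x * torsion j B M x)) = - (\<Sum>M\<in>N. \<epsilon> M * (torsion k A M x * torsion j M B x))"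
      unfolding sum_negf[symmetric] by (rule sum.cong) (auto simp: torsion_skew[OF x B])
    then show ?thesis
      by (subst form_expand[OF x, of "partial k (n A) x" "partial j (n B) x"])
         (simp add: normal_deriv[OF x A] normal_deriv[OF x B] torsion_def[symmetric] sff_commute[OF x, of _ k] mult.assoc)
  qed
  show "partial j (torsion k A B) x - partial k (torsion j A B) x =
      ((\<Sum>l\<in>UNIV. \<Sum>m\<in>UNIV. metric_inv G l m x * (sff k l A x * sff m j B x)) - (\<Sum>M\<in>N. \<epsilon> M * (torsion k A M x * torsion j M B x)))
      - ((\<Sum>l\<in>UNIV. \<Sum>m\<in>UNIV. metric_inv G l m x * (sff j l A x * sff m k B x)) - (\<Sum>M\<in>N. \<epsilon> M * (torsion j A M x * torsion k M B x)))"
    unfolding 1 2 ..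
qed

end

section \<open>Sufficiency of the equations\<close>

lemma bounded_bilinear_matrix_mult: "bounded_bilinear ((**) :: real^'m^'n \<Rightarrow> real^'k^'m \<Rightarrow> real^'k^'n)"
  unfolding bilinear_conv_bounded_bilinear[symmetric] bilinear_def
  by (auto intro!: linearI simp: vec_eq_iff matrix_matrix_mult_def sum.distrib sum_distrib_left algebra_simps)

interpretation matrix_mult: bounded_bilinear "(**) :: real^'m^'n \<Rightarrow> real^'k^'m \<Rightarrow> real^'k^'n"
  by (rule bounded_bilinear_matrix_mult)

lemma bounded_linear_transpose: "bounded_linear (transpose :: real^'m^'n \<Rightarrow> real^'n^'m)"
  unfolding linear_conv_bounded_linear[symmetric]
  by (auto intro!: linearI simp: vec_eq_iff transpose_def)

context block_index
begin

lemma smooth_on_mx: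
  assumes S: "open S" and "\<And>i j. smooth_on (f (Inl i) (Inl j)) S" "\<And>i A. A \<in> N \<Longrightarrow> smooth_on (f (Inl i) (Inr A)) S"
    "\<And>i A. A \<in> N \<Longrightarrow> smooth_on (f (Inr A) (Inl i)) S" "\<And>A B. A \<in> N \<Longrightarrow> B \<in> N \<Longrightarrow> smooth_on (f (Inr A) (Inr B)) S"
  shows "smooth_on (\<lambda>x. mx (\<lambda>z w. f z w x)) S"
proof (intro smooth_on_vec S)
  fix a b
  have "smooth_on (f (\<psi> a) (\<psi> b)) S"
    by (rule \<psi>_cases[of a]; rule \<psi>_cases[of b]) (simp_all add: assms)
  then show "smooth_on (\<lambda>x. mx (\<lambda>z w. f z w x) $ a $ b) S" by (simp add: mx_nth)
qed

lemma partial_mx: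
  assumes "(\<lambda>x. mx (\<lambda>z w. f z w x)) differentiable (at x)"
  shows "partial i (\<lambda>x. mx (\<lambda>z w. f z w x)) x = mx (\<lambda>z w. partial i (f z w) x)"
proof -
  have d: "(\<lambda>x. mx (\<lambda>z w. f z w x) $ a) differentiable (at x)" for a
  proof -
    obtain D where D: "((\<lambda>x. mx (\<lambda>z w. f z w x)) has_derivative D) (at x)"
      using assms unfolding differentiable_def by (rule exE)
    show ?thesis unfolding differentiable_def
      by (rule exI, rule bounded_linear.has_derivative[OF bounded_linear_vec_nth D])
  qed
  have "partial i (\<lambda>x. mx (\<lambda>z w. f z w x)) x $ a $ b = partial i (f (\<psi> a) (\<psi> b)) x" for a b
    by (simp only: partial_vec_nth[OF assms, symmetric] partial_vec_nth[OF d, symmetric] mx_nth)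
  then show ?thesis by (simp add: vec_eq_iff mx_nth)
qed

lemma mx_transpose: "transpose (mx f) = mx (\<lambda>z w. f w z)"
  by (simp add: vec_eq_iff mx_nth transpose_def)

lemma mx_add: "mx f + mx g = mx (\<lambda>z w. f z w + g z w)"
  by (simp add: vec_eq_iff mx_nth)

lemma mx_diff: "mx f - mx g = mx (\<lambda>z w. f z w - g z w)"
  by (simp add: vec_eq_iff mx_nth)

text \<open>Computes the products \<open>Th k x ** Hi x ** transpose (Th j x)\<close> as
  contractions with the inverse metric and the signs.\<close>

lemma mx_blk_product:
  "mx f ** mx (blk M \<epsilon>) ** transpose (mx g) = mx (\<lambda>z w. (\<Sum>l\<in>UNIV. \<Sum>m\<in>UNIV. M $ l $ m * (f z (Inl l) * g w (Inl m)))
     + (\<Sum>A\<in>N. \<epsilon> A * (f z (Inr A) * g w (Inr A))))"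
proof -
  have 1: "mx f ** mx (blk M \<epsilon>) = mx (\<lambda>z w. case w of Inl m \<Rightarrow> \<Sum>l\<in>UNIV. f z (Inl l) * M $ l $ m | Inr A \<Rightarrow> f z (Inr A) * \<epsilon> A)"
    unfolding mx_mult by (rule mx_cong) (simp_all add: sum_delta_times[OF finite_N])
  have 2: "(\<Sum>m\<in>UNIV. (\<Sum>l\<in>UNIV. f z (Inl l) * M $ l $ m) * g w (Inl m))
     = (\<Sum>l\<in>UNIV. \<Sum>m\<in>UNIV. M $ l $ m * (f z (Inl l) * g w (Inl m)))" for z w
    unfolding sum_distrib_right by (subst sum.swap) (simp add: mult_ac)
  show ?thesis unfolding 1 unfolding mx_transpose mx_mult by (simp add: 2) (simp add: mult_ac)
qed

end

locale gcr_domain = metric_domain G S + block_index \<psi> N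
  for G :: "real^'n \<Rightarrow> real^'n::finite^'n" and S and \<psi> :: "'d::finite \<Rightarrow> 'n + nat" and N +
  fixes \<epsilon> :: "nat \<Rightarrow> real"
    and b :: "'n \<Rightarrow> 'n \<Rightarrow> nat \<Rightarrow> real^'n \<Rightarrow> real" and a :: "'n \<Rightarrow> nat \<Rightarrow> nat \<Rightarrow> real^'n \<Rightarrow> real"
  assumes \<epsilon>: "\<And>A. A \<in> N \<Longrightarrow> \<epsilon> A = 1 \<or> \<epsilon> A = -1"
    and smooth_b: "\<And>i j A. A \<in> N \<Longrightarrow> smooth_on (b i j A) S"
    and smooth_a: "\<And>i A B. A \<in> N \<Longrightarrow> B \<in> N \<Longrightarrow> smooth_on (a i A B) S"
    and b_commute: "\<And>x i j A. x \<in> S \<Longrightarrow> A \<in> N \<Longrightarrow> b i j A x = b j i A x"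
    and a_skew: "\<And>x i A B. x \<in> S \<Longrightarrow> A \<in> N \<Longrightarrow> B \<in> N \<Longrightarrow> a i A B x = - a i B A x"
    and gauss: "\<And>x. x \<in> S \<Longrightarrow> gauss_equation N \<epsilon> G b x"
    and codazzi: "\<And>x. x \<in> S \<Longrightarrow> codazzi_equation N \<epsilon> G b a x"
    and ricci: "\<And>x. x \<in> S \<Longrightarrow> ricci_equation N \<epsilon> G b a x"
begin

text \<open>For an adapted frame \<open>E\<close> of an isometric immersion, \<open>conn i z w\<close> is the inner product of
  \<open>\<partial>\<^sub>i E\<^sub>z\<close> with \<open>E\<^sub>w\<close>, and \<open>Om i\<close> is the matrix with \<open>\<partial>\<^sub>i E = Om i E\<close>.\<close>
fun conn :: "'n \<Rightarrow> 'n + nat \<Rightarrow> 'n + nat \<Rightarrow> real^'n \<Rightarrow> real" where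
  "conn i (Inl j) (Inl k) = christoffel_low G k j i"
| "conn i (Inl j) (Inr A) = b j i A"
| "conn i (Inr A) (Inl k) = (\<lambda>x. - b k i A x)"
| "conn i (Inr A) (Inr B) = a i A B"

definition Th :: "'n \<Rightarrow> real^'n \<Rightarrow> real^'d^'d" where "Th i x = mx (\<lambda>z w. conn i z w x)"
definition Hm :: "real^'n \<Rightarrow> real^'d^'d" where "Hm x = mx (\<lambda>z w. blk (G x) \<epsilon> z w)"
definition Hi :: "real^'n \<Rightarrow> real^'d^'d" where "Hi x = mx (\<lambda>z w. blk (matrix_inv (G x)) \<epsilon> z w)"
definition Om :: "'n \<Rightarrow> real^'n \<Rightarrow> real^'d^'d" where "Om i x = Th i x ** Hi x"

lemma Hm_Hi: "x \<in> S \<Longrightarrow> Hm x ** Hi x = mat 1"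
  unfolding Hm_def Hi_def by (rule blk_inverse[OF matrix_inv_right[OF inv_G] \<epsilon>])

lemma Hi_Hm: "x \<in> S \<Longrightarrow> Hi x ** Hm x = mat 1"
  using Hm_Hi matrix_left_right_inverse by blast

lemma smooth_Th: "smooth_on (Th i) S"
  unfolding Th_def[abs_def]
  by (rule smooth_on_mx[OF open_S]) (auto intro!: smooth_christoffel_low smooth_b smooth_a smooth_on_uminus open_S)

lemma smooth_Hm: "smooth_on Hm S"
  unfolding Hm_def[abs_def]
  by (rule smooth_on_mx[OF open_S, of "\<lambda>z w x. blk (G x) \<epsilon> z w"]) (auto intro!: smooth_Gij smooth_on_const open_S)

lemma smooth_Hi: "smooth_on Hi S"
  unfolding Hi_def[abs_def]
  by (rule smooth_on_mx[OF open_S, of "\<lambda>z w x. blk (matrix_inv (G x)) \<epsilon> z w"])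
     (auto intro!: smooth_inv[unfolded metric_inv_def[abs_def]] smooth_on_const open_S)

lemma smooth_Om: "smooth_on (Om i) S"
  unfolding Om_def[abs_def] by (rule smooth_on_bilinear[OF open_S bounded_bilinear_matrix_mult smooth_Th smooth_Hi])

lemma Om_Hm: "x \<in> S \<Longrightarrow> Om i x ** Hm x = Th i x"
  unfolding Om_def by (simp add: matrix_mul_assoc[symmetric] Hi_Hm)

text \<open>The tangent block is metric compatibility, the normal block is skewness of
  \<open>a\<close>, and the mixed blocks cancel by the sign that \<open>conn\<close> gives to
  \<open>b\<close>. It is the rule by which the Gram matrix of a frame with connection
  \<open>Th\<close> would change.\<close>

lemma partial_Hm: assumes x: "x \<in> S" shows "partial i Hm x = Th i x + transpose (Th i x)"
proof -
  have "partial i Hm x = mx (\<lambda>z w. partial i (\<lambda>x. blk (G x) \<epsilon> z w) x)"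
    unfolding Hm_def[abs_def]
    by (rule partial_mx, rule smooth_on_differentiable[OF smooth_Hm[unfolded Hm_def[abs_def]] x])
  also have "\<dots> = Th i x + transpose (Th i x)"
    unfolding Th_def mx_transpose mx_add
  proof (rule mx_cong)
    show "partial i (\<lambda>x. blk (G x) \<epsilon> (Inr A) (Inr B)) x = conn i (Inr A) (Inr B) x + conn i (Inr B) (Inr A) x"
      if "A \<in> N" "B \<in> N" for A B
      using a_skew[OF x that, of i] by simp
    show "partial i (\<lambda>x. blk (G x) \<epsilon> (Inl j) (Inl k)) x = conn i (Inl j) (Inl k) x + conn i (Inl k) (Inl j) x" for j k
      using metric_compatible[OF x, of i j k] christoffel_low_commute[OF x, of j k i] christoffel_low_commute[OF x, of k j i] by simp
  qed simp_all
  finally show ?thesis .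
qed

lemma inv_sum_christoffel: 
  "x \<in> S \<Longrightarrow> (\<Sum>l\<in>UNIV. \<Sum>m\<in>UNIV. matrix_inv (G x) $ l $ m * (christoffel_low G l i k x * f m)) = (\<Sum>m\<in>UNIV. christoffel G m i k x * f m)"
  unfolding christoffel_eq sum_distrib_right
  by (subst sum.swap) (simp add: metric_inv_def[symmetric] metric_inv_sym mult.assoc)

text \<open>Block by block this is the Gauss, Codazzi, Codazzi and Ricci equation. The second
  Codazzi block carries the sign that \<open>conn\<close> gives to \<open>b\<close>.\<close>

lemma partial_Th:
  assumes x: "x \<in> S"
  shows "partial j (Th k) x - partial k (Th j) x
    = Th k x ** Hi x ** transpose (Th j x) - Th j x ** Hi x ** transpose (Th k x)"
proof -
  have p: "partial j (Th k) x = mx (\<lambda>z w. partial j (conn k z w) x)" for j k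
    unfolding Th_def[abs_def]
    by (rule partial_mx, rule smooth_on_differentiable[OF smooth_Th[unfolded Th_def[abs_def]] x])
  have G: "partial j (christoffel_low G h i k) x - partial k (christoffel_low G h i j) x =
      (\<Sum>l\<in>UNIV. christoffel G l i k x * christoffel_low G l h j x) + (\<Sum>A\<in>N. \<epsilon> A * (b i k A x * b h j A x))
      - ((\<Sum>l\<in>UNIV. christoffel G l i j x * christoffel_low G l h k x) + (\<Sum>A\<in>N. \<epsilon> A * (b i j A x * b h k A x)))" for h i
    using gauss[OF x] unfolding gauss_iff[OF finite_N x]
    by (simp add: christoffel_low_commute[OF x, of _ h] b_commute[OF x, of _ h] cong: sum.cong)
  have skew: "(\<Sum>A\<in>N. \<epsilon> A * (f A * a j C A x)) = - (\<Sum>A\<in>N. \<epsilon> A * (f A * a j A C x))" if "C \<in> N" for f j C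
    unfolding sum_negf[symmetric] by (rule sum.cong) (auto simp: a_skew[OF x that])
  have skew': "(\<Sum>A\<in>N. \<epsilon> A * (a j C A x * f A)) = - (\<Sum>A\<in>N. \<epsilon> A * (f A * a j A C x))" if "C \<in> N" for f j C
    unfolding sum_negf[symmetric] by (rule sum.cong) (auto simp: a_skew[OF x that])
  \<comment> \<open>In the lower left block the Christoffel symbol is the right factor, so the
    symmetric inverse metric is read in the other order.\<close>
  have swap: "(\<Sum>l\<in>UNIV. \<Sum>m\<in>UNIV. matrix_inv (G x) $ l $ m * (b l j C x * christoffel_low G m i k x))
     = (\<Sum>m\<in>UNIV. christoffel G m i k x * b m j C x)" for C i j k
    unfolding inv_sum_christoffel[OF x, symmetric]
    by (subst sum.swap) (simp add: metric_inv_def[symmetric] metric_inv_sym[OF x] mult_ac)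
  have C: "partial j (b i k C) x - partial k (b i j C) x =
      (- (\<Sum>l\<in>UNIV. christoffel G l i k x * b l j C x) - (\<Sum>A\<in>N. \<epsilon> A * (b i k A x * a j A C x)))
      - (- (\<Sum>l\<in>UNIV. christoffel G l i j x * b l k C x) - (\<Sum>A\<in>N. \<epsilon> A * (b i j A x * a k A C x)))" if "C \<in> N" for i C
    using codazzi[OF x] that unfolding codazzi_iff[OF finite_N x] by blast
  have db: "partial j (\<lambda>x. - b i k C x) x = - partial j (b i k C) x" if "C \<in> N" for i j k C
    by (rule partial_linear_compose[OF bounded_linear_minus[OF bounded_linear_ident]])
       (rule smooth_on_differentiable[OF smooth_b[OF that] x])
  have bs: "(\<Sum>l\<in>UNIV. \<Sum>m\<in>UNIV. matrix_inv (G x) $ l $ m * (b l k A x * b m j B x))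
     = (\<Sum>l\<in>UNIV. \<Sum>m\<in>UNIV. metric_inv G l m x * (b k l A x * b m j B x))" if "A \<in> N" for A B j k
    by (simp add: metric_inv_def b_commute[OF x that, of _ k])
  have R: "partial j (a k A B) x - partial k (a j A B) x =
      ((\<Sum>l\<in>UNIV. \<Sum>m\<in>UNIV. metric_inv G l m x * (b k l A x * b m j B x)) - (\<Sum>M\<in>N. \<epsilon> M * (a k A M x * a j M B x)))
      - ((\<Sum>l\<in>UNIV. \<Sum>m\<in>UNIV. metric_inv G l m x * (b j l A x * b m k B x)) - (\<Sum>M\<in>N. \<epsilon> M * (a j A M x * a k M B x)))"
    if "A \<in> N" "B \<in> N" for A B
    using ricci[OF x] that unfolding ricci_iff[OF finite_N x] by blast
  show ?thesis unfolding p unfolding Th_def Hi_def mx_blk_product mx_diff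
  proof (rule mx_cong)
    show "partial j (conn k (Inl i) (Inl h)) x - partial k (conn j (Inl i) (Inl h)) x =
       (\<Sum>l\<in>UNIV. \<Sum>m\<in>UNIV. matrix_inv (G x) $ l $ m * (conn k (Inl i) (Inl l) x * conn j (Inl h) (Inl m) x))
        + (\<Sum>A\<in>N. \<epsilon> A * (conn k (Inl i) (Inr A) x * conn j (Inl h) (Inr A) x))
       - ((\<Sum>l\<in>UNIV. \<Sum>m\<in>UNIV. matrix_inv (G x) $ l $ m * (conn j (Inl i) (Inl l) x * conn k (Inl h) (Inl m) x))
        + (\<Sum>A\<in>N. \<epsilon> A * (conn j (Inl i) (Inr A) x * conn k (Inl h) (Inr A) x)))" for i h
      unfolding conn.simps inv_sum_christoffel[OF x] by (rule G)
    show "partial j (conn k (Inl i) (Inr C)) x - partial k (conn j (Inl i) (Inr C)) x =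
       (\<Sum>l\<in>UNIV. \<Sum>m\<in>UNIV. matrix_inv (G x) $ l $ m * (conn k (Inl i) (Inl l) x * conn j (Inr C) (Inl m) x))
        + (\<Sum>A\<in>N. \<epsilon> A * (conn k (Inl i) (Inr A) x * conn j (Inr C) (Inr A) x))
       - ((\<Sum>l\<in>UNIV. \<Sum>m\<in>UNIV. matrix_inv (G x) $ l $ m * (conn j (Inl i) (Inl l) x * conn k (Inr C) (Inl m) x))
        + (\<Sum>A\<in>N. \<epsilon> A * (conn j (Inl i) (Inr A) x * conn k (Inr C) (Inr A) x)))" if "C \<in> N" for i C
      unfolding conn.simps inv_sum_christoffel[OF x] skew[OF that] C[OF that] by (simp add: sum_negf)
    show "partial j (conn k (Inr C) (Inl i)) x - partial k (conn j (Inr C) (Inl i)) x =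
       (\<Sum>l\<in>UNIV. \<Sum>m\<in>UNIV. matrix_inv (G x) $ l $ m * (conn k (Inr C) (Inl l) x * conn j (Inl i) (Inl m) x))
        + (\<Sum>A\<in>N. \<epsilon> A * (conn k (Inr C) (Inr A) x * conn j (Inl i) (Inr A) x))
       - ((\<Sum>l\<in>UNIV. \<Sum>m\<in>UNIV. matrix_inv (G x) $ l $ m * (conn j (Inr C) (Inl l) x * conn k (Inl i) (Inl m) x))
        + (\<Sum>A\<in>N. \<epsilon> A * (conn j (Inr C) (Inr A) x * conn k (Inl i) (Inr A) x)))" if "C \<in> N" for i C
      unfolding conn.simps skew'[OF that] db[OF that] using C[OF that, of i] 
      by (simp add: sum_negf swap)
    show "partial j (conn k (Inr A) (Inr B)) x - partial k (conn j (Inr A) (Inr B)) x =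
       (\<Sum>l\<in>UNIV. \<Sum>m\<in>UNIV. matrix_inv (G x) $ l $ m * (conn k (Inr A) (Inl l) x * conn j (Inr B) (Inl m) x))
        + (\<Sum>M\<in>N. \<epsilon> M * (conn k (Inr A) (Inr M) x * conn j (Inr B) (Inr M) x))
       - ((\<Sum>l\<in>UNIV. \<Sum>m\<in>UNIV. matrix_inv (G x) $ l $ m * (conn j (Inr A) (Inl l) x * conn k (Inr B) (Inl m) x))
        + (\<Sum>M\<in>N. \<epsilon> M * (conn j (Inr A) (Inr M) x * conn k (Inr B) (Inr M) x)))" if "A \<in> N" "B \<in> N" for A B
      unfolding conn.simps skew[OF that(2)] R[OF that] by (simp add: bs[OF that(1)])
  qed
qed

text \<open>Differentiating \<open>Om k x ** Hm x = Th k x\<close> turns \<open>partial_Hm\<close>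
  into two products. The one with \<open>Th j x\<close> equals
  \<open>Om k x ** Om j x ** Hm x\<close> and absorbs the quadratic term; the other is the
  right-hand side of \<open>partial_Th\<close>. Finally \<open>Hm x\<close> is invertible.\<close>

lemma Om_flat:
  assumes x: "x \<in> S"
  shows "partial j (Om k) x + Om k x ** Om j x = partial k (Om j) x + Om j x ** Om k x"
proof -
  have *: "(partial j (Om k) x + Om k x ** Om j x) ** Hm x = partial j (Th k) x - Th k x ** Hi x ** transpose (Th j x)" for j k
  proof -
    have d: "Om k differentiable (at x)" "Hm differentiable (at x)"
      by (rule smooth_on_differentiable[OF smooth_Om x] smooth_on_differentiable[OF smooth_Hm x])+
    have "partial j (\<lambda>y. Om k y ** Hm y) x = partial j (Th k) x"
      by (rule partial_cong[OF open_S x smooth_on_differentiable[OF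
            smooth_on_bilinear[OF open_S bounded_bilinear_matrix_mult smooth_Om smooth_Hm] x] Om_Hm])
    then have "partial j (Th k) x = Om k x ** (Th j x + transpose (Th j x)) + partial j (Om k) x ** Hm x"
      unfolding partial_bilinear[OF bounded_bilinear_matrix_mult d] partial_Hm[OF x] by simp
    then show ?thesis
      by (simp add: matrix_mult.add_left matrix_mult.add_right matrix_mul_assoc[symmetric] Om_def Hi_Hm[OF x])
  qed
  have "(partial j (Om k) x + Om k x ** Om j x) ** Hm x = (partial k (Om j) x + Om j x ** Om k x) ** Hm x"
    unfolding * using partial_Th[OF x, of j k] by (simp add: algebra_simps)
  then have "(partial j (Om k) x + Om k x ** Om j x) ** Hm x ** Hi x = (partial k (Om j) x + Om j x ** Om k x) ** Hm x ** Hi x"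
    by simp
  then show ?thesis by (simp add: matrix_mul_assoc[symmetric] Hm_Hi[OF x])
qed

text \<open>The integrability condition for the immersion: the derivative of the i-th tangent vector
  in direction j is symmetric, because the Christoffel symbols and \<open>b\<close> are.\<close>

lemma Om_torsion_free:
  assumes x: "x \<in> S" and \<iota>: "\<And>i. \<psi> (\<iota> i) = Inl i"
  shows "(Om j x ** F) $ \<iota> i = (Om i x ** F) $ \<iota> j"
proof -
  have "Th j x $ \<iota> i $ c = Th i x $ \<iota> j $ c" for c
    by (rule \<psi>_cases[of c]) (simp_all add: Th_def mx_nth \<iota> christoffel_low_commute[OF x, of _ i j] b_commute[OF x, of _ i j])
  then show ?thesis unfolding Om_def by (simp add: vec_eq_iff matrix_matrix_mult_def)
qed

end

section \<open>The joint system for immersion and frame\<close>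

context gcr_domain
begin

text \<open>A state is a pair of position and frame. The frame vectors are the rows of a matrix, and
  \<open>\<iota> i\<close> is the row of the i-th tangent vector. With the position in the state, no
  separate integration of its first derivatives remains.\<close>

definition sys_at :: "('n \<Rightarrow> 'd) \<Rightarrow> real^'n \<Rightarrow> real^'n \<Rightarrow> (real^'d) \<times> (real^'d^'d) \<Rightarrow> (real^'d) \<times> (real^'d^'d)" where
  "sys_at \<iota> x h w = ((\<Sum>i\<in>UNIV. h $ i *\<^sub>R snd w $ \<iota> i), (\<Sum>i\<in>UNIV. h $ i *\<^sub>R Om i x) ** snd w)"

text \<open>The system \<open>\<partial>\<^sub>i Y = E\<^sub>i\<close>, \<open>\<partial>\<^sub>i E = Om i E\<close> for the immersion together with its frame.\<close>
definition sys :: "('n \<Rightarrow> 'd) \<Rightarrow> real^'n \<Rightarrow> (real^'n) \<Rightarrow>\<^sub>L ((real^'d) \<times> (real^'d^'d)) \<Rightarrow>\<^sub>L ((real^'d) \<times> (real^'d^'d))" where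
  "sys \<iota> x = Blinfun (\<lambda>h. Blinfun (sys_at \<iota> x h))"

lemma sys_apply: "sys \<iota> x h w = sys_at \<iota> x h w"
proof -
  have 1: "bounded_linear (sys_at \<iota> x h)" for h
    unfolding linear_conv_bounded_linear[symmetric] sys_at_def
    by (rule linearI) (simp_all add: matrix_mult.add_right matrix_mult.scaleR_right scaleR_add_right sum.distrib scaleR_sum_right mult.commute)
  have 2: "linear (\<lambda>h. Blinfun (sys_at \<iota> x h))"
  proof (rule linearI)
    show "Blinfun (sys_at \<iota> x (h1 + h2)) = Blinfun (sys_at \<iota> x h1) + Blinfun (sys_at \<iota> x h2)" for h1 h2
      by (rule blinfun_eqI)
         (simp add: blinfun.add_left bounded_linear_Blinfun_apply[OF 1], simp add: sys_at_def scaleR_add_left sum.distrib matrix_mult.add_left)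
    show "Blinfun (sys_at \<iota> x (c *\<^sub>R h)) = c *\<^sub>R Blinfun (sys_at \<iota> x h)" for c h
      by (rule blinfun_eqI)
         (simp add: blinfun.scaleR_left bounded_linear_Blinfun_apply[OF 1], simp add: sys_at_def scaleR_sum_right matrix_mult.scaleR_left[symmetric])
  qed
  then have "bounded_linear (\<lambda>h. Blinfun (sys_at \<iota> x h))" by (simp add: linear_conv_bounded_linear)
  then show ?thesis unfolding sys_def by (simp add: bounded_linear_Blinfun_apply 1)
qed

lemma smooth_sum_Om: "smooth_on (\<lambda>x. \<Sum>i\<in>UNIV. h $ i *\<^sub>R Om i x) S"
  by (intro smooth_on_sum smooth_on_scaleR smooth_on_const open_S smooth_Om)

lemma smooth_sys: "smooth_on (sys \<iota>) S"
proof (rule smooth_on_blinfun[OF open_S], rule smooth_on_blinfun[OF open_S])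
  fix h w
  have "smooth_on (\<lambda>x. sys_at \<iota> x h w) S"
    unfolding sys_at_def
    by (rule smooth_on_Pair[OF open_S smooth_on_const[OF open_S] smooth_on_bilinear[OF open_S bounded_bilinear_matrix_mult smooth_sum_Om smooth_on_const[OF open_S]]])
  then show "smooth_on (\<lambda>x. sys \<iota> x h w) S" by (simp add: sys_apply)
qed

lemma sys_deriv:
  assumes x: "x \<in> S"
  shows "frechet_derivative (sys \<iota>) (at x) k h w
    = (0, (\<Sum>i\<in>UNIV. \<Sum>j\<in>UNIV. (h $ i * k $ j) *\<^sub>R partial j (Om i) x) ** snd w)"
proof -
  have 1: "((\<lambda>x. sys \<iota> x h w) has_derivative (\<lambda>k. frechet_derivative (sys \<iota>) (at x) k h w)) (at x)"
    by (rule bounded_linear.has_derivative[OF blinfun.bounded_linear_left],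
        rule bounded_linear.has_derivative[OF blinfun.bounded_linear_left],
        rule smooth_on_has_derivative[OF smooth_sys x])
  have "((\<lambda>x. \<Sum>i\<in>UNIV. h $ i *\<^sub>R Om i x) has_derivative (\<lambda>k. \<Sum>i\<in>UNIV. h $ i *\<^sub>R (\<Sum>j\<in>UNIV. k $ j *\<^sub>R partial j (Om i) x))) (at x)"
    by (intro has_derivative_sum has_derivative_scaleR_right has_derivative_partial smooth_on_differentiable[OF smooth_Om x])
  then have "((\<lambda>x. (\<Sum>i\<in>UNIV. h $ i *\<^sub>R Om i x) ** snd w) has_derivative
      (\<lambda>k. (\<Sum>i\<in>UNIV. h $ i *\<^sub>R (\<Sum>j\<in>UNIV. k $ j *\<^sub>R partial j (Om i) x)) ** snd w)) (at x)"
    by (rule bounded_linear.has_derivative[OF matrix_mult.bounded_linear_left])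
  from has_derivative_Pair[OF has_derivative_const this]
  have 2: "((\<lambda>x. sys \<iota> x h w) has_derivative
      (\<lambda>k. (0, (\<Sum>i\<in>UNIV. h $ i *\<^sub>R (\<Sum>j\<in>UNIV. k $ j *\<^sub>R partial j (Om i) x)) ** snd w))) (at x)"
    unfolding sys_apply sys_at_def .
  show ?thesis using fun_cong[OF has_derivative_unique[OF 1 2], of k] by (simp add: scaleR_sum_right)
qed

text \<open>The position component is \<open>Om_torsion_free\<close>, the frame component is
  \<open>Om_flat\<close>.\<close>

lemma sys_compat:
  assumes x: "x \<in> S" and \<iota>: "\<And>i. \<psi> (\<iota> i) = Inl i"
  shows "frechet_derivative (sys \<iota>) (at x) k h w + sys \<iota> x h (sys \<iota> x k w)
     = frechet_derivative (sys \<iota>) (at x) h k w + sys \<iota> x k (sys \<iota> x h w)"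
proof -
  let ?F = "snd w"
  have e: "frechet_derivative (sys \<iota>) (at x) k h w + sys \<iota> x h (sys \<iota> x k w)
     = ((\<Sum>i\<in>UNIV. \<Sum>j\<in>UNIV. (h $ i * k $ j) *\<^sub>R (Om j x ** ?F) $ \<iota> i),
        (\<Sum>i\<in>UNIV. \<Sum>j\<in>UNIV. (h $ i * k $ j) *\<^sub>R ((partial j (Om i) x + Om i x ** Om j x) ** ?F)))" for h k
    unfolding sys_deriv[OF x] sys_apply sys_at_def
    by (simp add: matrix_mult.sum_left matrix_mult.sum_right matrix_mult.scaleR_left matrix_mult.scaleR_right
        matrix_mult.add_left scaleR_sum_right scaleR_add_right sum.distrib matrix_mul_assoc)
       (subst sum.swap, simp add: mult.commute)
  show ?thesis unfolding e
  proof (rule prod_eqI; simp only: fst_conv snd_conv)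
    show "(\<Sum>i\<in>UNIV. \<Sum>j\<in>UNIV. (h $ i * k $ j) *\<^sub>R (Om j x ** ?F) $ \<iota> i) = (\<Sum>i\<in>UNIV. \<Sum>j\<in>UNIV. (k $ i * h $ j) *\<^sub>R (Om j x ** ?F) $ \<iota> i)"
      by (subst sum.swap) (intro sum.cong refl arg_cong2[where f="(*\<^sub>R)"] mult.commute Om_torsion_free[OF x \<iota>])
    show "(\<Sum>i\<in>UNIV. \<Sum>j\<in>UNIV. (h $ i * k $ j) *\<^sub>R ((partial j (Om i) x + Om i x ** Om j x) ** ?F))
       = (\<Sum>i\<in>UNIV. \<Sum>j\<in>UNIV. (k $ i * h $ j) *\<^sub>R ((partial j (Om i) x + Om i x ** Om j x) ** ?F))"
      by (subst sum.swap) (intro sum.cong refl arg_cong2[where f="(*\<^sub>R)"] mult.commute arg_cong2[where f="(**)"] Om_flat[OF x])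
  qed
qed

theorem isometric_immersion_exists:
  fixes \<eta> F0 :: "real^'d^'d"
  assumes sym: "transpose \<eta> = \<eta>" and x0: "x0 \<in> S"
    and F0: "F0 ** \<eta> ** transpose F0 = mx (blk (G x0) \<epsilon>)"
  obtains r Y where "r > 0" "ball x0 r \<subseteq> S" "smooth_on Y (ball x0 r)"
    "\<And>x i j. x \<in> ball x0 r \<Longrightarrow> form \<eta> (partial i Y x) (partial j Y x) = G x $ i $ j"
proof -
  obtain \<iota> where \<iota>: "\<And>i. \<psi> (\<iota> i) = Inl i" by (rule obtain_\<psi>) (rule that)
  obtain r where r: "r > 0" "ball x0 r \<subseteq> S"
    and sol: "\<And>w. \<exists>u. u x0 = w \<and> (\<forall>x\<in>ball x0 r. (u has_derivative (\<lambda>h. sys \<iota> x h (u x))) (at x))"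
  proof (rule linear_total_differential[OF open_S x0 smooth_sys[of \<iota>]])
    show "frechet_derivative (sys \<iota>) (at x) k h w + sys \<iota> x h (sys \<iota> x k w)
       = frechet_derivative (sys \<iota>) (at x) h k w + sys \<iota> x k (sys \<iota> x h w)" if "x \<in> S" for x h k w
      by (rule sys_compat[OF that \<iota>])
  qed (rule that; assumption)
  obtain u where u0: "u x0 = (0, F0)" and u: "\<And>x. x \<in> ball x0 r \<Longrightarrow> (u has_derivative (\<lambda>h. sys \<iota> x h (u x))) (at x)"
    using sol by blast
  have su: "smooth_on u (ball x0 r)"
    by (rule linear_system_solution_smooth[OF open_ball smooth_on_subset[OF smooth_sys r(2)] u])
  define Y where "Y x = fst (u x)" for x
  define F where "F x = snd (u x)" for x
  have sY: "smooth_on Y (ball x0 r)" unfolding Y_def[abs_def] by (rule smooth_on_linear_compose[OF open_ball bounded_linear_fst su])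
  have dY: "partial i Y x = F x $ \<iota> i" if "x \<in> ball x0 r" for i x
  proof -
    have "partial i Y x = fst (sys \<iota> x (axis i 1) (u x))"
      unfolding Y_def[abs_def] by (rule partial_eqI, rule has_derivative_fst[OF u[OF that]])
    then show ?thesis by (simp add: sys_apply sys_at_def F_def axis_def if_distrib if_distribR cong: if_cong)
  qed
  have dF: "(F has_derivative (\<lambda>h. (\<Sum>i\<in>UNIV. h $ i *\<^sub>R Om i x) ** F x)) (at x)" if "x \<in> ball x0 r" for x
    using has_derivative_snd[OF u[OF that]] unfolding F_def[abs_def] sys_apply sys_at_def by simp
  define v where "v x = F x ** \<eta> ** transpose (F x) - Hm x" for x
  define O' where "O' x h = (\<Sum>i\<in>UNIV. h $ i *\<^sub>R Om i x)" for x and h :: "real^'n"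
  have dv: "(v has_derivative (\<lambda>h. O' x h ** v x + v x ** transpose (O' x h))) (at x)" if x: "x \<in> ball x0 r" for x
  proof -
    have xS: "x \<in> S" using x r(2) by blast
    have dFt: "((\<lambda>x. transpose (F x)) has_derivative (\<lambda>h. transpose (O' x h ** F x))) (at x)"
      unfolding O'_def by (rule bounded_linear.has_derivative[OF bounded_linear_transpose dF[OF x]])
    have dFe: "((\<lambda>x. F x ** \<eta>) has_derivative (\<lambda>h. O' x h ** F x ** \<eta>)) (at x)"
      unfolding O'_def by (rule bounded_linear.has_derivative[OF matrix_mult.bounded_linear_left dF[OF x]])
    have dH: "(Hm has_derivative (\<lambda>h. \<Sum>i\<in>UNIV. h $ i *\<^sub>R (Th i x + transpose (Th i x)))) (at x)"
      using has_derivative_partial[OF smooth_on_differentiable[OF smooth_Hm xS]] by (simp add: partial_Hm[OF xS])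
    have HT: "transpose (Hm x) = Hm x"
      unfolding Hm_def mx_transpose by (rule mx_cong) (auto simp: G_commute[OF xS])
    \<comment> \<open>This gives the derivative of \<open>Hm\<close> the same form as that of
      \<open>F x ** \<eta> ** transpose (F x)\<close>, so the difference \<open>v\<close> solves a
      homogeneous equation.\<close>
    have "(\<Sum>i\<in>UNIV. h $ i *\<^sub>R (Th i x + transpose (Th i x))) = O' x h ** Hm x + Hm x ** transpose (O' x h)" for h
    proof -
      have "transpose (O' x h) = (\<Sum>i\<in>UNIV. h $ i *\<^sub>R transpose (Om i x))"
        unfolding O'_def by (simp add: vec_eq_iff transpose_def)
      moreover have "Hm x ** transpose (Om i x) = transpose (Th i x)" for i
        by (simp add: Om_Hm[OF xS, symmetric] matrix_transpose_mul HT)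
      ultimately show ?thesis
        by (simp add: O'_def matrix_mult.sum_left matrix_mult.sum_right matrix_mult.scaleR_left matrix_mult.scaleR_right
            Om_Hm[OF xS] scaleR_add_right sum.distrib)
    qed
    note dv = has_derivative_diff[OF bounded_bilinear.FDERIV[OF bounded_bilinear_matrix_mult dFe dFt] dH, unfolded this]
    show ?thesis unfolding v_def
      by (rule has_derivative_eq_rhs[OF dv])
         (simp add: fun_eq_iff matrix_transpose_mul matrix_mul_assoc matrix_mult.diff_left matrix_mult.diff_right algebra_simps)
  qed
  have "\<exists>K>0. \<forall>(A :: real^'d^'d) (B :: real^'d^'d). norm (A ** B) \<le> norm A * norm B * K" by (rule matrix_mult.pos_bounded)
  then obtain K where K: "K > 0" "\<And>(A :: real^'d^'d) (B :: real^'d^'d). norm (A ** B) \<le> norm A * norm B * K" by auto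
  \<comment> \<open>On a compact ball the coefficients of the equation for \<open>v\<close> are
    bounded.\<close>
  obtain \<rho> where \<rho>: "\<rho> > 0" "cball x0 \<rho> \<subseteq> ball x0 r" using r(1) open_contains_cball[of "ball x0 r"] by (meson centre_in_ball open_ball)
  define c where "c x = (\<Sum>i\<in>UNIV. norm (Om i x) + norm (transpose (Om i x)))" for x
  have "continuous_on (cball x0 \<rho>) c"
  proof -
    have cO: "continuous_on (cball x0 \<rho>) (Om i)" for i
      using smooth_on_imp_continuous_on[OF smooth_Om] \<rho>(2) r(2) continuous_on_subset by blast
    show ?thesis unfolding c_def
      by (intro continuous_on_sum continuous_on_add continuous_on_norm cO bounded_linear.continuous_on[OF bounded_linear_transpose])
  qed
  then have "bounded (c ` cball x0 \<rho>)" by (intro compact_imp_bounded compact_continuous_image compact_cball)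
  then obtain C where C: "\<And>x. x \<in> cball x0 \<rho> \<Longrightarrow> \<bar>c x\<bar> \<le> C" unfolding bounded_iff real_norm_def ball_simps by blast
  obtain \<rho>' where \<rho>': "\<rho>' > 0" "ball x0 \<rho>' \<subseteq> ball x0 \<rho>" "\<And>x. x \<in> ball x0 \<rho>' \<Longrightarrow> v x = 0"
  proof (rule linear_system_unique[of "ball x0 \<rho>" x0 v "\<lambda>x h. O' x h ** v x + v x ** transpose (O' x h)" "C * K"])
    show "x0 \<in> ball x0 \<rho>" using \<rho> by simp
    show "v x0 = 0" using F0 by (simp add: v_def F_def u0 Hm_def)
    fix x assume x: "x \<in> ball x0 \<rho>"
    show "(v has_derivative (\<lambda>h. O' x h ** v x + v x ** transpose (O' x h))) (at x)"
      by (rule dv) (use x \<rho>(2) in \<open>meson ball_subset_cball subsetD\<close>)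
    fix h :: "real^'n"
    have h: "\<bar>h $ i\<bar> \<le> norm h" for i using component_le_norm_cart[of h i] by simp
    have O1: "norm (O' x h) \<le> (\<Sum>i\<in>UNIV. norm h * norm (Om i x))"
      unfolding O'_def by (rule sum_norm_le) (simp add: h mult_right_mono)
    have "transpose (O' x h) = (\<Sum>i\<in>UNIV. h $ i *\<^sub>R transpose (Om i x))"
      unfolding O'_def by (simp add: vec_eq_iff transpose_def)
    then have O2: "norm (transpose (O' x h)) \<le> (\<Sum>i\<in>UNIV. norm h * norm (transpose (Om i x)))"
      by (simp only:) (rule sum_norm_le, simp add: h mult_right_mono)
    have "norm (O' x h ** v x + v x ** transpose (O' x h)) \<le> norm (O' x h) * norm (v x) * K + norm (v x) * norm (transpose (O' x h)) * K"
      using K(2)[of "O' x h" "v x"] K(2)[of "v x" "transpose (O' x h)"] by (intro norm_triangle_mono)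
    also have "\<dots> = (norm (O' x h) + norm (transpose (O' x h))) * (norm (v x) * K)" by (simp add: algebra_simps)
    also have "\<dots> \<le> (norm h * c x) * (norm (v x) * K)"
      using O1 O2 K(1) by (intro mult_right_mono) (auto simp: c_def sum.distrib sum_distrib_left distrib_left)
    also have "\<dots> \<le> (norm h * C) * (norm (v x) * K)"
      using C[of x] x K(1) by (intro mult_right_mono mult_left_mono) auto
    finally show "norm (O' x h ** v x + v x ** transpose (O' x h)) \<le> C * K * norm h * norm (v x)" by (simp add: mult_ac)
  qed auto
  have sub: "ball x0 \<rho>' \<subseteq> ball x0 r" using \<rho>'(2) \<rho>(2) by (meson ball_subset_cball order_trans)
  show ?thesis
  proof (rule that[OF \<rho>'(1), of Y])
    show "ball x0 \<rho>' \<subseteq> S" using sub r(2) by blast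
    show "smooth_on Y (ball x0 \<rho>')" using sY sub smooth_on_subset by blast
    fix x i j assume x: "x \<in> ball x0 \<rho>'"
    have "F x ** \<eta> ** transpose (F x) = Hm x" using \<rho>'(3)[OF x] by (simp add: v_def)
    \<comment> \<open>The tangent block of the Gram matrix is the pulled back metric.\<close>
    then have "(F x ** \<eta> ** transpose (F x)) $ \<iota> i $ \<iota> j = G x $ i $ j" by (simp add: Hm_def mx_nth \<iota>)
    moreover have "(F x ** \<eta> ** transpose (F x)) $ a $ b = form \<eta> (F x $ a) (F x $ b)" for a b
      by (simp add: form_eq_sum matrix_matrix_mult_def transpose_def sum_distrib_left sum_distrib_right mult_ac) (rule sum.swap)
    ultimately show "form \<eta> (partial i Y x) (partial j Y x) = G x $ i $ j"
      using dY sub x by (metis subsetD)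
  qed
qed

end

text \<open>Supplies the initial frame. The labelling is chosen so that the signs of an
  \<open>\<eta>\<close>-orthonormal basis match those of a \<open>G\<close>-orthonormal basis
  together with \<epsilon>; the tangent part is then transformed to have Gram matrix
  \<open>G\<close>.\<close>

lemma adapted_frame_exists:
  fixes \<eta> :: "real^'d^'d::finite" and G :: "real^'n^'n::finite"
  assumes \<eta>: "has_signature \<eta> p q" and G: "has_signature G r s" "transpose G = G"
    and N: "finite N" "\<And>A. A \<in> N \<Longrightarrow> \<epsilon> A = 1 \<or> \<epsilon> A = -1"
      "r + card {A \<in> N. \<epsilon> A = 1} = p" "s + card {A \<in> N. \<epsilon> A = -1} = q"
  obtains \<psi> :: "'d \<Rightarrow> 'n + nat" and F0 :: "real^'d^'d" where "block_index \<psi> N"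
    "F0 ** \<eta> ** transpose F0 = block_index.mx \<psi> (block_index.blk G \<epsilon>)"
proof -
  obtain f :: "'d \<Rightarrow> real^'d" and \<sigma> :: "'d \<Rightarrow> real"
    where f0: "\<forall>i. \<sigma> i = 1 \<or> \<sigma> i = -1" "card {i. \<sigma> i = 1} = p" "card {i. \<sigma> i = -1} = q"
      and f: "\<And>i j. form \<eta> (f i) (f j) = (if i = j then \<sigma> i else 0)"
    using \<eta> unfolding has_signature_def form_def by blast
  obtain \<tau> :: "'n \<Rightarrow> real" and g :: "'n \<Rightarrow> real^'n" where g0: "\<And>i. \<tau> i = 1 \<or> \<tau> i = (-1::real)" "card {i. \<tau> i = 1} = r" "card {i. \<tau> i = -1} = s"
      "\<And>i j. form G (g i) (g j) = (if i = j then \<tau> i else 0)"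
      and g: "\<And>i j. (\<Sum>k\<in>UNIV. \<tau> k * (G *v g k) $ i * g k $ j) = (if i = j then 1 else 0)"
      "invertible G"
    by (rule signature_basis[OF G(1)]) blast
  define sg where "sg z = (case z of Inl i \<Rightarrow> \<tau> i | Inr A \<Rightarrow> \<epsilon> A)" for z
  have sgc: "card {z \<in> UNIV <+> N. sg z = t} = card {i. \<tau> i = t} + card {A \<in> N. \<epsilon> A = t}" for t
  proof -
    have "{z \<in> UNIV <+> N. sg z = t} = {i. \<tau> i = t} <+> {A \<in> N. \<epsilon> A = t}"
      by (auto simp: sg_def)
    then show ?thesis using N(1) by (simp add: card_Plus)
  qed
  obtain \<psi> where bij: "bij_betw \<psi> UNIV (UNIV <+> N)" "\<And>a. sg (\<psi> a) = \<sigma> a"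
  proof (rule bij_betw_of_card_fibres[of "UNIV :: 'd set" "(UNIV :: 'n set) <+> N" \<sigma> sg])
    show "finite ((UNIV :: 'n set) <+> N)" using N(1) by simp
    show "sg b = 1 \<or> sg b = -1" if "b \<in> UNIV <+> N" for b
      using that
    proof (cases b)
      case (Inl i)
      then show ?thesis using g0(1)[of i] by (simp add: sg_def)
    next
      case (Inr A)
      then show ?thesis using that N(2)[of A] by (auto simp: sg_def)
    qed
    show "card {a \<in> UNIV. \<sigma> a = 1} = card {b \<in> UNIV <+> N. sg b = 1}"
      "card {a \<in> UNIV. \<sigma> a = -1} = card {b \<in> UNIV <+> N. sg b = -1}"
      unfolding sgc using f0 g0(2,3) N(3,4) by simp_all
  qed (use f0 in auto)
  interpret block_index \<psi> N by unfold_locales (use N bij in auto)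
  obtain \<iota> \<nu> where \<iota>: "\<And>i. \<psi> (\<iota> i) = Inl i" and \<nu>: "\<And>A. A \<in> N \<Longrightarrow> \<psi> (\<nu> A) = Inr A"
    by (rule obtain_\<psi>) (rule that)
  \<comment> \<open>The coefficients are those of the i-th coordinate vector in the
    \<open>G\<close>-orthonormal basis \<open>g\<close>. Since \<open>f (\<iota> k)\<close> and
    \<open>g k\<close> have the same sign, replacing one by the other preserves inner
    products.\<close>
  define E where "E z = (case z of Inl i \<Rightarrow> \<Sum>k\<in>UNIV. (\<tau> k * (G *v g k) $ i) *\<^sub>R f (\<iota> k) | Inr A \<Rightarrow> f (\<nu> A))" for z
  define F0 :: "real^'d^'d" where "F0 = (\<chi> a. E (\<psi> a))"
  have \<iota>\<iota>: "\<iota> k = \<iota> l \<longleftrightarrow> k = l" for k l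
  proof
    assume "\<iota> k = \<iota> l"
    then have "\<psi> (\<iota> k) = \<psi> (\<iota> l)" by (rule arg_cong)
    then show "k = l" by (simp only: \<iota> sum.inject)
  qed (rule arg_cong)
  have \<sigma>\<iota>: "\<sigma> (\<iota> k) = \<tau> k" for k using bij(2)[of "\<iota> k"] unfolding \<iota> by (simp add: sg_def)
  have \<tau>\<tau>: "\<tau> k * x * (\<tau> k * y * \<tau> k) = \<tau> k * x * y" for k x y using g0(1)[of k] by auto
  have \<iota>\<nu>: "\<iota> k \<noteq> \<nu> A" if "A \<in> N" for k A
  proof
    assume "\<iota> k = \<nu> A"
    then have "\<psi> (\<iota> k) = \<psi> (\<nu> A)" by (rule arg_cong)
    then show False by (simp only: \<iota> \<nu>[OF that] sum.distinct)
  qed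
  have \<nu>\<nu>: "\<nu> A = \<nu> B \<longleftrightarrow> A = B" if "A \<in> N" "B \<in> N" for A B
  proof
    assume "\<nu> A = \<nu> B"
    then have "\<psi> (\<nu> A) = \<psi> (\<nu> B)" by (rule arg_cong)
    then show "A = B" by (simp only: \<nu>[OF that(1)] \<nu>[OF that(2)] sum.inject)
  qed (rule arg_cong)
  have \<sigma>\<nu>: "\<sigma> (\<nu> A) = \<epsilon> A" if "A \<in> N" for A using bij(2)[of "\<nu> A"] unfolding \<nu>[OF that] by (simp add: sg_def)
  have ff: "form \<eta> (f (\<iota> k)) (f (\<iota> l)) = (if k = l then \<tau> k else 0)" for k l
    by (simp add: f \<iota>\<iota> \<sigma>\<iota> cong: if_cong)
  have Gcomm: "G $ i $ j = G $ j $ i" for i j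
    using arg_cong[OF G(2), of "\<lambda>M. M $ j $ i"] by (simp add: transpose_def)
  have EE: "form \<eta> (E (Inl i)) (E (Inl j)) = G $ i $ j" for i j
  proof -
    have Gj: "(G *v g k) $ j = (\<Sum>m\<in>UNIV. g k $ m * G $ j $ m)" for k
      by (simp add: matrix_vector_mult_def mult.commute)
    have "form \<eta> (E (Inl i)) (E (Inl j)) = (\<Sum>l\<in>UNIV. \<Sum>k\<in>UNIV. \<tau> k * (G *v g k) $ i * (\<tau> l * (G *v g l) $ j * (if k = l then \<tau> k else 0)))"
      by (simp add: E_def form.sum_left form.sum_right form.scaleR_left form.scaleR_right ff sum_distrib_left mult_ac)
    also have "\<dots> = (\<Sum>k\<in>UNIV. \<tau> k * (G *v g k) $ i * (\<tau> k * (G *v g k) $ j * \<tau> k))"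
      by (simp add: if_distrib cong: if_cong)
    also have "\<dots> = (\<Sum>k\<in>UNIV. \<tau> k * (G *v g k) $ i * (G *v g k) $ j)"
      by (simp only: \<tau>\<tau>)
    also have "\<dots> = (\<Sum>k\<in>UNIV. \<Sum>m\<in>UNIV. \<tau> k * (G *v g k) $ i * g k $ m * G $ j $ m)"
      unfolding Gj by (simp only: sum_distrib_left mult.assoc)
    also have "\<dots> = (\<Sum>m\<in>UNIV. (\<Sum>k\<in>UNIV. \<tau> k * (G *v g k) $ i * g k $ m) * G $ j $ m)"
      by (subst sum.swap) (simp add: sum_distrib_right)
    also have "\<dots> = G $ i $ j" unfolding g by (simp add: sum_delta_times Gcomm[of j i])
    finally show ?thesis .
  qed
  have "F0 ** \<eta> ** transpose F0 = mx (\<lambda>z w. form \<eta> (E z) (E w))"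
    by (simp add: F0_def mx_def vec_eq_iff form_eq_sum matrix_matrix_mult_def transpose_def sum_distrib_left sum_distrib_right mult_ac)
       (intro allI sum.swap)
  also have "\<dots> = mx (blk G \<epsilon>)"
  proof (rule mx_cong)
    show "form \<eta> (E (Inl i)) (E (Inl j)) = blk G \<epsilon> (Inl i) (Inl j)" for i j by (simp add: EE)
    show "form \<eta> (E (Inl i)) (E (Inr A)) = blk G \<epsilon> (Inl i) (Inr A)" if "A \<in> N" for i A
      by (simp add: E_def form.sum_left form.scaleR_left f \<iota>\<nu>[OF that])
    show "form \<eta> (E (Inr A)) (E (Inl i)) = blk G \<epsilon> (Inr A) (Inl i)" if "A \<in> N" for i A
      by (simp add: E_def form.sum_right form.scaleR_right f \<iota>\<nu>[OF that, symmetric])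
    show "form \<eta> (E (Inr A)) (E (Inr B)) = blk G \<epsilon> (Inr A) (Inr B)" if "A \<in> N" "B \<in> N" for A B
      using \<sigma>\<nu>[OF that(2)] by (simp add: E_def f \<nu>\<nu>[OF that])
  qed
  finally show ?thesis using that block_index_axioms by blast
qed

section \<open>Charts\<close>

lemma is_chart_inj: "is_chart X c \<Longrightarrow> inj_on (snd c) (fst c)"
  unfolding is_chart_def
  by (metis homeomorphic_imp_injective_map openin_subset topspace_subtopology_subset)

lemma in_coords_snd: "inj_on (snd c) (fst c) \<Longrightarrow> p \<in> fst c \<Longrightarrow> in_coords c f (snd c p) = f p"
  by (simp add: in_coords_def)

lemma is_chart_open_image:
  assumes c: "is_chart X c" and V: "openin X V"
  shows "open (snd c ` (fst c \<inter> V))"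
proof -
  have "openin (top_of_set (coord_range c)) (snd c ` (fst c \<inter> V))"
    using c homeomorphic_imp_open_map[of "subtopology X (fst c)" "top_of_set (coord_range c)" "snd c"]
      openin_subtopology_Int2[OF V, of "fst c"]
    unfolding is_chart_def open_map_def by blast
  then show ?thesis using c unfolding is_chart_def by (meson openin_open_trans)
qed

lemma is_chart_open_preimage:
  assumes c: "is_chart X c" and B: "open B"
  shows "openin X {p \<in> fst c. snd c p \<in> B}"
proof -
  have h: "homeomorphic_map (subtopology X (fst c)) (top_of_set (coord_range c)) (snd c)" and o: "openin X (fst c)"
    using c by (simp_all add: is_chart_def)
  have t: "topspace (subtopology X (fst c)) = fst c" using openin_subset[OF o] by auto
  have "openin (top_of_set (coord_range c)) (coord_range c \<inter> B)" using B by (simp add: openin_open_Int)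
  then have "openin (subtopology X (fst c)) {p \<in> topspace (subtopology X (fst c)). snd c p \<in> coord_range c \<inter> B}"
    using homeomorphic_imp_continuous_map[OF h] openin_continuous_map_preimage by blast
  moreover have "{p \<in> topspace (subtopology X (fst c)). snd c p \<in> coord_range c \<inter> B} = {p \<in> fst c. snd c p \<in> B}"
    unfolding t by (auto simp: coord_range_def)
  ultimately show ?thesis using openin_trans_full[OF _ o] by simp
qed

text \<open>The smaller chart is compatible with every member of the atlas, so it belongs to the
  atlas by maximality. It is needed where fields exist only on a ball but must be given on a full
  coordinate range.\<close>

lemma restricted_chart:
  assumes M: "smooth_manifold X \<A>" and c: "c \<in> \<A>" and B: "open B" "B \<subseteq> coord_range c"
  defines "c' \<equiv> ({p \<in> fst c. snd c p \<in> B}, snd c)"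
  shows "c' \<in> \<A>" "coord_range c' = B" "\<And>f x. x \<in> B \<Longrightarrow> in_coords c' f x = in_coords c f x"
proof -
  have ch: "is_chart X c" using M c by (simp add: smooth_manifold_def)
  note inj = is_chart_inj[OF ch]
  have sub: "fst c' \<subseteq> fst c" "snd c' = snd c" by (auto simp: c'_def)
  have inj': "inj_on (snd c) (fst c')" using inj sub inj_on_subset by blast
  show r: "coord_range c' = B" using B(2) by (auto simp: coord_range_def c'_def)
  show co: "in_coords c' f x = in_coords c f x" if "x \<in> B" for f x
  proof -
    have "x \<in> snd c ` fst c'" using r that by (simp add: coord_range_def c'_def)
    then obtain p where p: "p \<in> fst c'" "x = snd c p" by blast
    then show ?thesis using in_coords_snd[of c' p f] in_coords_snd[of c p f] inj inj' sub by auto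
  qed
  have op: "openin X (fst c')" using is_chart_open_preimage[OF ch B(1)] by (simp add: c'_def)
  have ch': "is_chart X c'"
    unfolding is_chart_def
  proof (intro conjI)
    show "openin X (fst c')" by (fact op)
    show "open (coord_range c')" using r B by simp
    have h: "homeomorphic_map (subtopology X (fst c)) (top_of_set (coord_range c)) (snd c)" and o: "openin X (fst c)"
      using ch by (simp_all add: is_chart_def)
    have t: "topspace (subtopology X (fst c)) = fst c" using openin_subset[OF o] by auto
    have "homeomorphic_map (subtopology (subtopology X (fst c)) (fst c')) (subtopology (top_of_set (coord_range c)) B) (snd c)"
      by (rule homeomorphic_map_subtopologies[OF h]) (unfold t, auto simp: c'_def coord_range_def)
    moreover have "fst c \<inter> fst c' = fst c'" "coord_range c \<inter> B = B" using sub B(2) by auto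
    ultimately show "homeomorphic_map (subtopology X (fst c')) (top_of_set (coord_range c')) (snd c')"
      by (simp add: subtopology_subtopology r sub(2))
  qed
  have "smoothly_compatible c' d" if d: "d \<in> \<A>" for d
  proof -
    have cd: "smoothly_compatible c d" and chd: "is_chart X d" using M c d by (simp_all add: smooth_manifold_def)
    have sub2: "snd c ` (fst c' \<inter> fst d) \<subseteq> snd c ` (fst c \<inter> fst d)" "snd d ` (fst c' \<inter> fst d) \<subseteq> snd d ` (fst c \<inter> fst d)"
      using sub(1) by blast+
    have o: "open (snd c ` (fst c' \<inter> fst d))"
      using is_chart_open_image[OF ch', of "fst d"] chd sub(2) by (simp add: is_chart_def)
    have "smooth_on (transition c d) (snd c ` (fst c' \<inter> fst d))"
      using cd sub2(1) smooth_on_subset unfolding smoothly_compatible_def by blast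
    moreover have "transition c d x = transition c' d x" if "x \<in> snd c ` (fst c' \<inter> fst d)" for x
      using co[of x "snd d"] that by (auto simp: c'_def)
    ultimately have "smooth_on (transition c' d) (snd c ` (fst c' \<inter> fst d))"
      using smooth_on_cong[OF o, of "transition c d" "transition c' d"] by blast
    moreover have "smooth_on (transition d c') (snd d ` (fst c' \<inter> fst d))"
      using cd sub2(2) smooth_on_subset unfolding smoothly_compatible_def sub(2) by blast
    ultimately show ?thesis unfolding smoothly_compatible_def sub(2) by simp
  qed
  then show "c' \<in> \<A>" using M ch' unfolding smooth_manifold_def by blast
qed

lemma chart_at:
  assumes "smooth_manifold X \<A>" "P \<in> topspace X"
  obtains c where "c \<in> \<A>" "P \<in> fst c"
proof -
  have "P \<in> (\<Union>c\<in>\<A>. fst c)" using assms by (simp add: smooth_manifold_def)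
  then show ?thesis using that by blast
qed

section \<open>The two implications on the manifold\<close>

theorem immersed_imp_gauss_codazzi_ricci:
  fixes X :: "'a topology" and \<A> :: "('a, 'n::finite) chart set" and \<eta> :: "real^'d^'d::finite"
  assumes M: "smooth_manifold X \<A>" and g: "pseudo_riemannian_metric \<A> g r s"
    and sym: "transpose \<eta> = \<eta>" and \<eta>: "has_signature \<eta> p q"
    and N: "finite N" "\<And>A. A \<in> N \<Longrightarrow> \<epsilon> A = 1 \<or> \<epsilon> A = -1"
      "r + card {A \<in> N. \<epsilon> A = 1} = p" "s + card {A \<in> N. \<epsilon> A = -1} = q"
    and imm: "locally_isometrically_immersed X \<A> g \<eta>"
  shows "locally_gauss_codazzi_ricci X \<A> g N \<epsilon>"
  unfolding locally_gauss_codazzi_ricci_def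
proof
  fix P assume P: "P \<in> topspace X"
  obtain c where c: "c \<in> \<A>" "P \<in> fst c" by (rule chart_at[OF M P])
  obtain U Y where U: "openin X U" "P \<in> U" and Y: "smooth_immersion \<A> U Y" "pullback_metric_eq \<A> g \<eta> U Y"
    using imm P unfolding locally_isometrically_immersed_def by blast
  have ch: "is_chart X c" using M c by (simp add: smooth_manifold_def)
  define V where "V = snd c ` (fst c \<inter> U)"
  define y where "y = in_coords c Y"
  have oV: "open V" unfolding V_def by (rule is_chart_open_image[OF ch U(1)])
  have x0: "snd c P \<in> V" using c U by (simp add: V_def)
  have VS: "V \<subseteq> coord_range c" by (auto simp: V_def coord_range_def)
  have sy: "smooth_on y V" using Y(1) c by (simp add: smooth_immersion_def y_def V_def)
  have iso: "form \<eta> (partial i y x) (partial j y x) = g c x $ i $ j" if "x \<in> V" for x i j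
    using Y(2) c that unfolding pullback_metric_eq_def form_def y_def V_def by blast
  have gc: "smooth_on (g d) (coord_range d)" "\<And>x. x \<in> coord_range d \<Longrightarrow> transpose (g d x) = g d x"
    "\<And>x. x \<in> coord_range d \<Longrightarrow> has_signature (g d x) r s" if "d \<in> \<A>" for d
    using g that unfolding pseudo_riemannian_metric_def by blast+
  \<comment> \<open>This is for the labelling \<open>\<psi>\<close>, which exists because the
    tangent and normal signs add up to those of \<open>\<eta>\<close>.\<close>
  obtain \<psi> :: "'d \<Rightarrow> 'n + nat" and F0 :: "real^'d^'d" where blk: "block_index \<psi> N"
    by (rule adapted_frame_exists[OF \<eta> gc(3)[OF c(1)] gc(2)[OF c(1)] N]) (use x0 VS in auto)
  obtain \<rho> n where \<rho>: "\<rho> > 0" "ball (snd c P) \<rho> \<subseteq> V" and n: "\<And>A. A \<in> N \<Longrightarrow> smooth_on (n A) (ball (snd c P) \<rho>)"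
    "\<And>x i A. x \<in> ball (snd c P) \<rho> \<Longrightarrow> A \<in> N \<Longrightarrow> form \<eta> (partial i y x) (n A x) = 0"
    "\<And>x A B. x \<in> ball (snd c P) \<rho> \<Longrightarrow> A \<in> N \<Longrightarrow> B \<in> N \<Longrightarrow> form \<eta> (n A x) (n B x) = (if A = B then \<epsilon> A else 0)"
    by (rule orthonormal_normal_frame[OF oV x0 sym \<eta> smooth_on_partial[OF sy] iso smooth_on_subset[OF gc(1)[OF c(1)] VS] gc(3)[OF c(1)] N(1,2)])
       (use N(3,4) VS in auto)
  define B where "B = ball (snd c P) \<rho>"
  define c' where "c' = ({p \<in> fst c. snd c p \<in> B}, snd c)"
  have B: "open B" "B \<subseteq> coord_range c" "B \<subseteq> V" using \<rho> VS by (auto simp: B_def)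
  note c' = restricted_chart[OF M c(1) B(1,2), folded c'_def]
  have Pc': "P \<in> fst c'" using c(2) \<rho>(1) by (simp add: c'_def B_def)
  \<comment> \<open>The metric assigns a component matrix to each chart separately, so agreement in
    the smaller chart needs an argument: both matrices are the pullback of \<open>\<eta>\<close>
    under the same coordinate expression of \<open>Y\<close>.\<close>
  have G: "g c' x $ i $ j = g c x $ i $ j" if x: "x \<in> B" for x i j
  proof -
    have "x \<in> snd c' ` (fst c' \<inter> U)"
    proof -
      obtain p where p: "p \<in> fst c" "p \<in> U" "x = snd c p" using x B(3) unfolding V_def by blast
      then show ?thesis using x by (auto simp: c'_def)
    qed
    then have 1: "form \<eta> (partial i (in_coords c' Y) x) (partial j (in_coords c' Y) x) = g c' x $ i $ j"
      using Y(2) c'(1) unfolding pullback_metric_eq_def form_def by blast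
    have 2: "partial i (in_coords c' Y) x = partial i y x" for i
      by (rule partial_cong[OF B(1) x, symmetric])
         (use smooth_on_differentiable[OF sy] x B(3) in \<open>auto simp: y_def c'(3)\<close>)
    show ?thesis using 1 iso[of x i j] x B(3) unfolding 2 by auto
  qed
  interpret block_index \<psi> N by (fact blk)
  interpret immersed_domain "g c'" B \<psi> N \<eta> \<epsilon> y n
  proof
    show "open B" by (fact B(1))
    show "smooth_on (g c') B" using gc(1)[OF c'(1)] c'(2) by simp
    show "transpose (g c' x) = g c' x" if "x \<in> B" for x using gc(2)[OF c'(1)] c'(2) that by simp
    show "invertible (g c' x)" if "x \<in> B" for x
      by (rule signature_basis[OF gc(3)[OF c'(1)]]) (use c'(2) that in auto)
    show "smooth_on y B" by (rule smooth_on_subset[OF sy B(3)])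
    show "form \<eta> (partial i y x) (partial j y x) = g c' x $ i $ j" if "x \<in> B" for x i j
      using iso[of x i j] G[OF that] B(3) that by auto
  qed (use sym N(2) n in \<open>auto simp: B_def simp del: mem_ball\<close>)
  show "\<exists>c\<in>\<A>. P \<in> fst c \<and> (\<exists>b a. (\<forall>i j. \<forall>A\<in>N. smooth_on (b i j A) (coord_range c)) \<and>
      (\<forall>i. \<forall>A\<in>N. \<forall>B\<in>N. smooth_on (a i A B) (coord_range c)) \<and>
      (\<forall>x\<in>coord_range c. (\<forall>i j. \<forall>A\<in>N. b i j A x = b j i A x) \<and> (\<forall>i. \<forall>A\<in>N. \<forall>B\<in>N. a i A B x = - a i B A x) \<and>
         gauss_equation N \<epsilon> (g c) b x \<and> codazzi_equation N \<epsilon> (g c) b a x \<and> ricci_equation N \<epsilon> (g c) b a x))"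
    by (rule bexI[OF _ c'(1)], intro conjI[OF Pc'] exI[of _ sff] exI[of _ torsion], unfold c'(2))
       (intro conjI allI ballI smooth_sff smooth_torsion sff_commute torsion_skew gauss codazzi ricci; assumption)
qed

text \<open>A vector killed by the differential is orthogonal to everything for the pulled back
  form, hence 0 since the metric is nondegenerate.\<close>

lemma immersion_of_pullback:
  assumes M: "smooth_manifold X \<A>" and g: "pseudo_riemannian_metric \<A> g r s" and U: "openin X U"
    and sm: "\<And>c. c \<in> \<A> \<Longrightarrow> smooth_on (in_coords c Y) (snd c ` (fst c \<inter> U))"
    and pb: "pullback_metric_eq \<A> g \<eta> U Y"
  shows "smooth_immersion \<A> U Y"
  unfolding smooth_immersion_def
proof (intro ballI conjI sm)
  fix c x assume c: "c \<in> \<A>" and x: "x \<in> snd c ` (fst c \<inter> U)"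
  let ?f = "in_coords c Y"
  have df: "?f differentiable (at x)" by (rule smooth_on_differentiable[OF sm[OF c] x])
  have "x \<in> coord_range c" using x by (auto simp: coord_range_def)
  then have "has_signature (g c x) r s" using g c unfolding pseudo_riemannian_metric_def by blast
  then have inv: "invertible (g c x)" by (rule signature_basis)
  have l: "linear (frechet_derivative ?f (at x))" by (rule linear_frechet_derivative[OF df])
  have fr: "frechet_derivative ?f (at x) v = (\<Sum>i\<in>UNIV. v $ i *\<^sub>R partial i ?f x)" for v
    using frechet_derivative_at[OF has_derivative_partial[OF df]] by (rule fun_cong[symmetric])
  show "inj (frechet_derivative ?f (at x))"
    unfolding linear_injective_0[OF l]
  proof (intro allI impI)
    fix v assume "frechet_derivative ?f (at x) v = 0"
    then have 0: "(\<Sum>i\<in>UNIV. v $ i *\<^sub>R partial i ?f x) = 0" by (simp add: fr)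
    have "(v v* g c x) $ j = 0" for j
    proof -
      have "g c x $ i $ j = form \<eta> (partial i ?f x) (partial j ?f x)" for i
        using pb c x unfolding pullback_metric_eq_def form_def by metis
      then
      have "(v v* g c x) $ j = (\<Sum>i\<in>UNIV. v $ i * form \<eta> (partial i ?f x) (partial j ?f x))"
        by (simp add: vector_matrix_mult_def mult.commute)
      also have "\<dots> = form \<eta> (\<Sum>i\<in>UNIV. v $ i *\<^sub>R partial i ?f x) (partial j ?f x)"
        by (simp add: form.sum_left form.scaleR_left)
      finally show ?thesis by (simp add: 0 form.zero_left)
    qed
    then have "v v* g c x = 0" by (simp add: vec_eq_iff)
    then have "v v* g c x v* matrix_inv (g c x) = 0" by simp
    then show "v = 0" by (simp add: vector_matrix_mul_assoc matrix_inv_right[OF inv])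
  qed
qed

theorem gauss_codazzi_ricci_imp_immersed:
  fixes X :: "'a topology" and \<A> :: "('a, 'n::finite) chart set" and \<eta> :: "real^'d^'d::finite"
  assumes M: "smooth_manifold X \<A>" and g: "pseudo_riemannian_metric \<A> g r s"
    and sym: "transpose \<eta> = \<eta>" and \<eta>: "has_signature \<eta> p q"
    and N: "finite N" "\<And>A. A \<in> N \<Longrightarrow> \<epsilon> A = 1 \<or> \<epsilon> A = -1"
      "r + card {A \<in> N. \<epsilon> A = 1} = p" "s + card {A \<in> N. \<epsilon> A = -1} = q"
    and gcr: "locally_gauss_codazzi_ricci X \<A> g N \<epsilon>"
  shows "locally_isometrically_immersed X \<A> g \<eta>"
  unfolding locally_isometrically_immersed_def
proof
  fix P assume P: "P \<in> topspace X"
  obtain c b a where c: "c \<in> \<A>" "P \<in> fst c"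
    and sb: "\<forall>i j. \<forall>A\<in>N. smooth_on (b i j A) (coord_range c)"
    and sa: "\<forall>i. \<forall>A\<in>N. \<forall>B\<in>N. smooth_on (a i A B) (coord_range c)"
    and eqs: "\<forall>x\<in>coord_range c. (\<forall>i j. \<forall>A\<in>N. b i j A x = b j i A x) \<and> (\<forall>i. \<forall>A\<in>N. \<forall>B\<in>N. a i A B x = - a i B A x) \<and>
         gauss_equation N \<epsilon> (g c) b x \<and> codazzi_equation N \<epsilon> (g c) b a x \<and> ricci_equation N \<epsilon> (g c) b a x"
    using gcr P unfolding locally_gauss_codazzi_ricci_def by blast
  have ch: "is_chart X c" using M c by (simp add: smooth_manifold_def)
  note inj = is_chart_inj[OF ch]
  define S where "S = coord_range c"
  have x0: "snd c P \<in> S" using c by (simp add: S_def coord_range_def)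
  have gc: "smooth_on (g c) S" "\<And>x. x \<in> S \<Longrightarrow> transpose (g c x) = g c x" "\<And>x. x \<in> S \<Longrightarrow> has_signature (g c x) r s"
    using g c(1) unfolding pseudo_riemannian_metric_def S_def by blast+
  obtain \<psi> :: "'d \<Rightarrow> 'n + nat" and F0 :: "real^'d^'d" where blk: "block_index \<psi> N"
    "F0 ** \<eta> ** transpose F0 = block_index.mx \<psi> (block_index.blk (g c (snd c P)) \<epsilon>)"
    by (rule adapted_frame_exists[OF \<eta> gc(3)[OF x0] gc(2)[OF x0] N]) auto
  interpret block_index \<psi> N by (fact blk(1))
  interpret gcr_domain "g c" S \<psi> N \<epsilon> b a
  proof
    show "open S" using ch by (simp add: is_chart_def S_def)
    show "invertible (g c x)" if "x \<in> S" for x by (rule signature_basis[OF gc(3)[OF that]])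
    show "b i j A x = b j i A x" if "x \<in> S" "A \<in> N" for x i j A using eqs that by (simp add: S_def)
    show "a i A B x = - a i B A x" if "x \<in> S" "A \<in> N" "B \<in> N" for x i A B using eqs that unfolding S_def by blast
  qed (use gc N(2) sb sa eqs in \<open>auto simp: S_def\<close>)
  obtain \<rho> Y where \<rho>: "\<rho> > 0" "ball (snd c P) \<rho> \<subseteq> S" and sY: "smooth_on Y (ball (snd c P) \<rho>)"
    and Y: "\<And>x i j. x \<in> ball (snd c P) \<rho> \<Longrightarrow> form \<eta> (partial i Y x) (partial j Y x) = g c x $ i $ j"
    by (rule isometric_immersion_exists[OF sym x0 blk(2)]) blast
  define B where "B = ball (snd c P) \<rho>"
  define U where "U = {p \<in> fst c. snd c p \<in> B}"
  define Z where "Z p = Y (snd c p)" for p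
  have oU: "openin X U" unfolding U_def B_def by (rule is_chart_open_preimage[OF ch open_ball])
  have PU: "P \<in> U" using c \<rho>(1) by (simp add: U_def B_def)
  \<comment> \<open>\<open>Y\<close> lives in the one chart \<open>c\<close>, while smoothness and
    isometry are demanded in every chart; the chain rule through the transition map and the
    transformation law of \<open>g\<close> carry them over.\<close>
  have Z: "smooth_on (in_coords d Z) (snd d ` (fst d \<inter> U)) \<and>
      (\<forall>x\<in>snd d ` (fst d \<inter> U). \<forall>i j. partial i (in_coords d Z) x \<bullet> (\<eta> *v partial j (in_coords d Z) x) = g d x $ i $ j)"
    if d: "d \<in> \<A>" for d
  proof -
    have chd: "is_chart X d" using M d by (simp add: smooth_manifold_def)
    note injd = is_chart_inj[OF chd]
    let ?D = "snd d ` (fst d \<inter> U)" and ?T = "transition d c"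
    have oD: "open ?D" by (rule is_chart_open_image[OF chd oU])
    have sub: "?D \<subseteq> snd d ` (fst d \<inter> fst c)" by (auto simp: U_def)
    have "smoothly_compatible d c" using M c(1) d unfolding smooth_manifold_def by blast
    then have sT: "smooth_on ?T ?D" using sub smooth_on_subset unfolding smoothly_compatible_def by blast
    have TB: "?T ` ?D \<subseteq> B" by (auto simp: U_def in_coords_snd[OF injd])
    have e: "in_coords d Z = (\<lambda>x. Y (?T x))" by (simp add: fun_eq_iff in_coords_def Z_def)
    have sm: "smooth_on (in_coords d Z) ?D"
      unfolding e by (rule smooth_on_compose[OF oD _ TB sT]) (use sY in \<open>simp_all add: B_def\<close>)
    moreover have "partial i (in_coords d Z) x \<bullet> (\<eta> *v partial j (in_coords d Z) x) = g d x $ i $ j"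
      if x: "x \<in> ?D" for x i j
    proof -
      have Tx: "?T x \<in> ball (snd c P) \<rho>" using imageI[OF x, of ?T] TB unfolding B_def by blast
      have p: "partial i (in_coords d Z) x = (\<Sum>k\<in>UNIV. partial i ?T x $ k *\<^sub>R partial k Y (?T x))" for i
        unfolding e partial_def[of i ?T]
        by (rule partial_eqI, rule has_derivative_compose[OF smooth_on_has_derivative[OF sT x]
              has_derivative_partial[OF smooth_on_differentiable[OF sY Tx]]])
      have "form \<eta> (partial i (in_coords d Z) x) (partial j (in_coords d Z) x)
        = (\<Sum>k\<in>UNIV. \<Sum>l\<in>UNIV. g c (?T x) $ k $ l * partial i ?T x $ k * partial j ?T x $ l)"
        unfolding p
        by (subst sum.swap) (simp add: form.sum_left form.sum_right form.scaleR_left form.scaleR_right Y[OF Tx] sum_distrib_left mult_ac)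
      also have "\<dots> = g d x $ i $ j"
        using g d c(1) x sub unfolding pseudo_riemannian_metric_def by (metis (no_types, lifting) subsetD)
      finally show ?thesis by (simp add: form_def)
    qed
    ultimately show ?thesis by blast
  qed
  have pb: "pullback_metric_eq \<A> g \<eta> U Z" using Z unfolding pullback_metric_eq_def by blast
  have "smooth_immersion \<A> U Z" by (rule immersion_of_pullback[OF M g oU _ pb]) (use Z in blast)
  then show "\<exists>U Y. openin X U \<and> P \<in> U \<and> smooth_immersion \<A> U Y \<and> pullback_metric_eq \<A> g \<eta> U Y"
    using oU PU pb by blast
qed

theorem mainTheorem1:
  fixes X :: "'a topology" and \<A> :: "('a, 'n::finite) chart set"
    and g :: "('a, 'n) chart \<Rightarrow> real^'n \<Rightarrow> real^'n^'n"
    and \<eta> :: "real^'d^'d::finite"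
    and \<epsilon> :: "nat \<Rightarrow> real"
    and n r s D p q :: nat
  assumes "smooth_manifold X \<A>" and "CARD('n) = n" and "n = r + s"
    and "pseudo_riemannian_metric \<A> g r s"
    and "CARD('d) = D" and "D = p + q"
    and "transpose \<eta> = \<eta>" and "has_signature \<eta> p q"
    and "r \<le> p" and "s \<le> q"
    and "\<forall>A\<in>{n+1..D}. \<epsilon> A = 1 \<or> \<epsilon> A = -1"
    and "card {A\<in>{n+1..D}. \<epsilon> A = 1} = p - r"
    and "card {A\<in>{n+1..D}. \<epsilon> A = -1} = q - s"
  shows "locally_isometrically_immersed X \<A> g \<eta> \<longleftrightarrow>
         locally_gauss_codazzi_ricci X \<A> g {n+1..D} \<epsilon>"
proof -
  \<comment> \<open>\<open>r \<le> p\<close> and \<open>s \<le> q\<close> undo the truncated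
    subtraction in the two cardinalities.\<close>
  have N: "finite {n+1..D}" "\<And>A. A \<in> {n+1..D} \<Longrightarrow> \<epsilon> A = 1 \<or> \<epsilon> A = -1"
    "r + card {A \<in> {n+1..D}. \<epsilon> A = 1} = p" "s + card {A \<in> {n+1..D}. \<epsilon> A = -1} = q"
    using assms(9-13) by auto
  show ?thesis
    using immersed_imp_gauss_codazzi_ricci[OF assms(1,4,7,8) N] gauss_codazzi_ricci_imp_immersed[OF assms(1,4,7,8) N]
    by (rule iffI)
qed

end
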